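(* Let $\psi$ be an admissible wavelet. For all $f\in L^2_\alpha(\mathbb R_+)$, $$\|x\,W_\psi f\|_{2,\nu_\alpha}^2+\|\xi\,\mathcal H_\alpha f\|_{2,\mu_\alpha}^2\ \ge\ (2\alpha+2)\|f\|_{2,\mu_\alpha}^2,$$ and $$\|x\,W_\psi f\|_{2,\nu_\alpha}\,\|\xi\,\mathcal H_\alpha f\|_{2,\mu_\alpha}\ \ge\ (\alpha+1)\|f\|_{2,\mu_\alpha}^2,$$ where $\|x\,W_\psi f\|_{2,\nu_\alpha}^2=\int_{\mathcal R}x^2|W_\psi f(a,x)|^2\,d\nu_\alpha(a,x)$ and $\|\xi\,\mathcal H_\alpha f\|_{2,\mu_\alpha}^2=\int_0^\infty\xi^2|\mathcal H_\alpha f(\xi)|^2\,d\mu_\alpha(\xi)$ (possibly infinite).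
   Context: Fix a real number $\alpha>-1/2$. Let $\mu_\alpha$ be the measure on $\mathbb{R}_+=[0,\infty)$ given by $d\mu_\alpha(x)=\frac{x^{2\alpha+1}}{2^\alpha\Gamma(\alpha+1)}\,dx$; for $1\le p<\infty$ let $L^p_\alpha(\mathbb R_+)=L^p(\mathbb R_+,\mu_\alpha)$ with norm $\|f\|_{p,\mu_\alpha}=\left(\int_0^\infty|f|^p\,d\mu_\alpha\right)^{1/p}$, and let $L^\infty_\alpha(\mathbb R_+)$ be the essentially bounded functions. Let $j_\alpha(z)=\Gamma(\alpha+1)\sum_{n\ge0}\frac{(-1)^n}{n!\,\Gamma(n+\alpha+1)}(z/2)^{2n}$. The Hankel transform is $\mathcal H_\alpha f(\xi)=\int_0^\infty f(x)\,j_\alpha(x\xi)\,d\mu_\alpha(x)$ for $f\in L^1_\alpha(\mathbb R_+)$, extended to a unitary operator on $L^2_\alpha(\mathbb R_+)$. For $x\ge0$ the Hankel translation is $\tau_x^\alpha f(y)=\frac{\Gamma(\alpha+1)}{\Gamma(1/2)\Gamma(\alpha+1/2)}\int_0^\pi f\big(\sqrt{x^2+y^2+2xy\cos\theta}\big)\sin^{2\alpha}\theta\,d\theta$, and for $a>0$ the dilation is $D_af(x)=a^{\alpha+1}f(ax)$. A nonzero $\psi\in L^1_\alpha(\mathbb R_+)\cap L^\infty_\alpha(\mathbb R_+)$ is an admissible wavelet if $0<c_\psi:=\int_0^\infty|\mathcal H_\alpha\psi(a)|^2\,\frac{da}{a}<\infty$. For such $\psi$ and $f\in L^2_\alpha(\mathbb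 R_+)$, the Hankel wavelet transform is $W_\psi f(a,x)=c_\psi^{-1/2}\int_0^\infty f(t)\,\overline{\tau_x^\alpha(D_a\psi)(t)}\,d\mu_\alpha(t)$ for $(a,x)\in\mathcal R:=(0,\infty)\times[0,\infty)$. On $\mathcal R$ let $d\nu_\alpha(a,x)=a^{2\alpha+1}\,da\,d\mu_\alpha(x)$, $L^p_\alpha(\mathcal R)=L^p(\mathcal R,\nu_\alpha)$, with norm $\|F\|_{p,\nu_\alpha}$ (and $\|F\|_\infty$ the essential supremum). *)

theory Defs
  imports "HOL-Analysis.Analysis"
begin

definition mu_weight :: "real \<Rightarrow> real \<Rightarrow> real" where
  "mu_weight \<alpha> x = indicator {0..} x * (x powr (2*\<alpha>+1) / (2 powr \<alpha> * Gamma (\<alpha>+1)))"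

definition mu_alpha :: "real \<Rightarrow> real measure" where
  "mu_alpha \<alpha> = density lborel (\<lambda>x. ennreal (mu_weight \<alpha> x))"

definition nu_alpha :: "real \<Rightarrow> (real \<times> real) measure" where
  "nu_alpha \<alpha> = density (lborel \<Otimes>\<^sub>M lborel)
     (\<lambda>(a,x). ennreal (indicator {0<..} a * a powr (2*\<alpha>+1) * mu_weight \<alpha> x))"

definition bessel_j :: "real \<Rightarrow> real \<Rightarrow> real" where
  "bessel_j \<alpha> z = Gamma (\<alpha>+1) *
     (\<Sum>n. (-1)^n / (fact n * Gamma (real n + \<alpha> + 1)) * (z/2)^(2*n))"

definition hankel_L1 :: "real \<Rightarrow> (real \<Rightarrow> complex) \<Rightarrow> real \<Rightarrow> complex" where
  "hankel_L1 \<alpha> f \<xi> = (\<integral>x. f x * complex_of_real (bessel_j \<alpha> (x*\<xi>)) \<partial>mu_alpha \<alpha>)"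

definition L2_alpha :: "real \<Rightarrow> (real \<Rightarrow> complex) set" where
  "L2_alpha \<alpha> = {f. f \<in> borel_measurable borel \<and>
                   integrable (mu_alpha \<alpha>) (\<lambda>x. (norm (f x))^2)}"

text \<open>Hankel transform on L^2_alpha: the (unitary) extension, realized as the
  L^2_alpha-limit of the transforms of the truncations f * 1_[0,R] as R tends to infinity.\<close>
definition hankel_L2 :: "real \<Rightarrow> (real \<Rightarrow> complex) \<Rightarrow> real \<Rightarrow> complex" where
  "hankel_L2 \<alpha> f = (SOME g. g \<in> L2_alpha \<alpha> \<and>
      ((\<lambda>R. \<integral>\<xi>. (norm (g \<xi> - hankel_L1 \<alpha> (\<lambda>x. indicator {0..R} x * f x) \<xi>))^2 \<partial>mu_alpha \<alpha>)
        \<longlongrightarrow> 0) at_top)"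

definition hankel_transl :: "real \<Rightarrow> real \<Rightarrow> (real \<Rightarrow> complex) \<Rightarrow> real \<Rightarrow> complex" where
  "hankel_transl \<alpha> x f y =
     complex_of_real (Gamma (\<alpha>+1) / (Gamma (1/2) * Gamma (\<alpha>+1/2))) *
     (LINT \<theta>:{0..pi}|lborel. f (sqrt (x^2 + y^2 + 2*x*y*cos \<theta>)) *
                             complex_of_real ((sin \<theta>) powr (2*\<alpha>)))"

definition dilation :: "real \<Rightarrow> real \<Rightarrow> (real \<Rightarrow> complex) \<Rightarrow> real \<Rightarrow> complex" where
  "dilation \<alpha> a f x = complex_of_real (a powr (\<alpha>+1)) * f (a*x)"

definition c_psi :: "real \<Rightarrow> (real \<Rightarrow> complex) \<Rightarrow> ennreal" where
  "c_psi \<alpha> \<psi> = (\<integral>\<^sup>+ a. indicator {0<..} a * ennreal ((norm (hankel_L1 \<alpha> \<psi> a))^2 / a) \<partial>lborel)"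

definition admissible_wavelet :: "real \<Rightarrow> (real \<Rightarrow> complex) \<Rightarrow> bool" where
  "admissible_wavelet \<alpha> \<psi> \<longleftrightarrow>
     \<psi> \<in> borel_measurable borel \<and>
     integrable (mu_alpha \<alpha>) \<psi> \<and>
     (\<exists>C. AE x in mu_alpha \<alpha>. norm (\<psi> x) \<le> C) \<and>
     \<not> (AE x in mu_alpha \<alpha>. \<psi> x = 0) \<and>
     0 < c_psi \<alpha> \<psi> \<and> c_psi \<alpha> \<psi> < \<infinity>"

definition wavelet_transform ::
  "real \<Rightarrow> (real \<Rightarrow> complex) \<Rightarrow> (real \<Rightarrow> complex) \<Rightarrow> real \<times> real \<Rightarrow> complex" where
  "wavelet_transform \<alpha> \<psi> f = (\<lambda>(a,x).
     complex_of_real (1 / sqrt (enn2real (c_psi \<alpha> \<psi>))) *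
     (\<integral>t. f t * cnj (hankel_transl \<alpha> x (dilation \<alpha> a \<psi>) t) \<partial>mu_alpha \<alpha>))"

end

(* For fixed a the function W f(a, .) is, up to a constant, the convolution of f with
   the dilated wavelet, so its transform is H f times the transform of that wavelet.  The Heisenberg
   inequality is applied to each slice and integrated over a; on the frequency side the integral
   over a produces exactly c_psi.  Keeping a free Gaussian parameter b and optimising it only after
   the integration gives the product form.

   The Heisenberg inequality itself avoids derivatives: (1 - exp(-t xi^2)) / t <= xi^2, and
   exp(-t xi^2) corresponds to the positive heat kernel.  Schur's test with the function
   exp(-b x^2) + eps, whose heat evolution is explicit, bounds the heat form from above; t -> 0
   and then eps -> 0 give the sharp constant.

   Plancherel's theorem also comes from the heat kernel (as an approximate identity), and all
   kernel computations rest on two facts: the product formula for the Bessel function and the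
   symmetry of the joint law of x and hyp t x theta. *)

theory Submission
  imports Defs
begin

text \<open>The Gaussian \<open>exp (-b x^2)\<close> is an extremal of the Heisenberg inequality: to
  first order in t the heat flow multiplies it by 1 - 4bt((alpha+1) - b x^2), so as a Schur weight
  it loses nothing in the limit. The constant alpha+1 is the exponent in the factor (1 +
  4bt)^(-(alpha+1)) of the evolved Gaussian. That evolved Gaussian is wider than the original, hence
  for fixed t > 0 their ratio is unbounded in x. The summand eps makes the ratio bounded, which is
  what allows the inequality to pass to L^2 limits, and it dictates the order of the two limits. L^2
  limits enter because f, and with it a slice W f(a, .), is only assumed or known to be square
  integrable; \<open>is_hankel\<close>, the closure of the graph of \<open>H\<close> on integrable
  square-integrable functions, is the setting for both the inequality and the convolution theorem.
  For fixed b the Heisenberg inequality is linear in the two squared moments and the squared norm,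
  so it can be integrated over the scales directly.\<close>

section \<open>Substitution rules on the half-line\<close>

text \<open>The intervals [1/(n+2), n+2] exhaust the open half-line. The substitution rule on each
  of them, read as an equality between two measures of increasing sets, passes to the union by
  continuity from below. The image \<open>J\<close> is a parameter because a map may send the
  half-line onto the positive or the negative one.\<close>

lemma nn_integral_substitution_pos:
  fixes f :: "real \<Rightarrow> ennreal" and g g' :: "real \<Rightarrow> real"
  assumes [measurable]: "f \<in> borel_measurable borel" "g \<in> borel_measurable borel" "g' \<in> borel_measurable borel"
    and deriv: "\<And>x. x > 0 \<Longrightarrow> (g has_real_derivative g' x) (at x)"
    and cont: "continuous_on {0<..} g'"
    and nonneg: "\<And>x. x > 0 \<Longrightarrow> g' x \<ge> 0"
    and image: "(\<Union>n. {g (1 / (real n + 2))..g (real n + 2)}) = J"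
  shows "(\<integral>\<^sup>+x. f x * indicator J x \<partial>lborel) = (\<integral>\<^sup>+x. f (g x) * g' x * indicator {0<..} x \<partial>lborel)"
proof -
  \<comment> \<open>Starting at 2 keeps the left end strictly below the right end also for n = 0, as
    the compact substitution rule requires.\<close>
  define A where "A n = {1 / (real n + 2)..real n + 2}" for n
  define B where "B n = {g (1 / (real n + 2))..g (real n + 2)}" for n
  have incA: "incseq A"
    by (auto simp: incseq_def A_def intro: frac_le)
  have Upos: "(\<Union>n. A n) = {0<..}"
  proof safe
    fix x :: real assume "x > 0"
    obtain n where n: "real n > max x (1/x)" using reals_Archimedean2 by blast
    then have "1 / (real n + 2) \<le> x" "x \<le> real n + 2"
      using \<open>x > 0\<close> by (auto simp: field_simps)
    then show "x \<in> (\<Union>n. A n)" by (auto simp: A_def)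
  qed (auto simp: A_def intro: less_le_trans[rotated])
  have mono: "g x \<le> g y" if "0 < x" "x \<le> y" for x y
    by (rule DERIV_nonneg_imp_nondecreasing[OF that(2)])
       (use deriv nonneg that in \<open>meson less_le_trans\<close>)
  have incB: "incseq B"
  proof (rule incseq_SucI, unfold B_def, rule atLeastatMost_subset_iff[THEN iffD2], intro disjI2 conjI)
    fix n
    show "g (1 / (real (Suc n) + 2)) \<le> g (1 / (real n + 2))"
      by (rule mono) (auto intro: frac_le)
    show "g (real n + 2) \<le> g (real (Suc n) + 2)" by (rule mono) auto
  qed
  have eq: "(\<integral>\<^sup>+x. f x * indicator (B n) x \<partial>lborel) = (\<integral>\<^sup>+x. f (g x) * g' x * indicator (A n) x \<partial>lborel)" for n
    unfolding A_def B_def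
  proof (rule nn_integral_substitution_aux)
    have "1 / (real n + 2) \<le> 1 / 2" by (rule frac_le) auto
    then show "1 / (real n + 2) < real n + 2" by linarith
    have pos: "x > 0" if "x \<in> {1 / (real n + 2)..real n + 2}" for x
      using that by (auto intro: less_le_trans[rotated])
    show "continuous_on {1 / (real n + 2)..real n + 2} g'"
      by (rule continuous_on_subset[OF cont]) (use pos in auto)
    show "(g has_real_derivative g' x) (at x)" "0 \<le> g' x" if "x \<in> {1 / (real n + 2)..real n + 2}" for x
      using deriv nonneg pos[OF that] by auto
  qed auto
  have "(\<integral>\<^sup>+x. f x * indicator J x \<partial>lborel) = emeasure (density lborel f) (\<Union>n. B n)"
    unfolding B_def image[symmetric] by (subst emeasure_density) (auto)
  also have "\<dots> = (SUP n. emeasure (density lborel f) (B n))"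
    using incB by (intro SUP_emeasure_incseq[symmetric]) (auto simp: B_def[abs_def])
  also have "\<dots> = (SUP n. emeasure (density lborel (\<lambda>x. f (g x) * g' x)) (A n))"
    by (intro SUP_cong refl) (use eq in \<open>simp add: emeasure_density A_def B_def\<close>)
  also have "\<dots> = emeasure (density lborel (\<lambda>x. f (g x) * g' x)) (\<Union>n. A n)"
    using incA by (intro SUP_emeasure_incseq) (auto simp: A_def[abs_def])
  also have "\<dots> = (\<integral>\<^sup>+x. f (g x) * g' x * indicator {0<..} x \<partial>lborel)"
    unfolding Upos by (subst emeasure_density) auto
  finally show ?thesis .
qed

lemma nn_integral_substitution_square:
  fixes f :: "real \<Rightarrow> ennreal"
  assumes [measurable]: "f \<in> borel_measurable borel"
  shows "(\<integral>\<^sup>+x. f x * indicator {0<..} x \<partial>lborel) =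
    (\<integral>\<^sup>+x. f (x\<^sup>2) * ennreal (2 * x) * indicator {0<..} x \<partial>lborel)"
proof (rule nn_integral_substitution_pos)
  show "(\<Union>n. {(1 / (real n + 2))\<^sup>2..(real n + 2)\<^sup>2}) = {0<..}"
  proof safe
    fix x :: real assume "x > 0"
    obtain n where n: "real n > max x (1/x)" using reals_Archimedean2 by blast
    have le: "real n + 2 \<le> (real n + 2)\<^sup>2" by (simp add: power2_eq_square)
    have "inverse ((real n + 2)\<^sup>2) \<le> inverse (1/x)"
      by (rule le_imp_inverse_le) (use n le \<open>x > 0\<close> in auto)
    then have "(1 / (real n + 2))\<^sup>2 \<le> x" by (simp add: power_divide inverse_eq_divide)
    moreover have "x \<le> (real n + 2)\<^sup>2" using n le by linarith
    ultimately show "x \<in> (\<Union>n. {(1 / (real n + 2))\<^sup>2..(real n + 2)\<^sup>2})" by auto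
  qed (auto intro: less_le_trans[rotated])
qed (auto intro!: derivative_eq_intros continuous_intros)

text \<open>The map a -> xi/a decreases while the general rule wants a nondecreasing one; b is
  therefore reflected first, and the rule is applied to a -> -xi/a, whose image is the negative
  half-line.\<close>

lemma nn_integral_substitution_inverse:
  fixes f :: "real \<Rightarrow> ennreal" and \<xi> :: real
  assumes [measurable]: "f \<in> borel_measurable borel" and \<xi>: "\<xi> > 0"
  shows "(\<integral>\<^sup>+b. f b * indicator {0<..} b \<partial>lborel) =
    (\<integral>\<^sup>+a. f (\<xi> / a) * ennreal (\<xi> / a\<^sup>2) * indicator {0<..} a \<partial>lborel)"
proof -
  have "(\<integral>\<^sup>+b. f b * indicator {0<..} b \<partial>lborel) = (\<integral>\<^sup>+b. f (- b) * indicator {..<0} b \<partial>lborel)"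
    by (subst nn_integral_real_affine[where c="-1" and t=0]) (auto simp: indicator_def intro!: nn_integral_cong)
  also have "\<dots> = (\<integral>\<^sup>+a. f (- (- \<xi> / a)) * ennreal (\<xi> / a\<^sup>2) * indicator {0<..} a \<partial>lborel)"
  proof (rule nn_integral_substitution_pos[where g="\<lambda>a. - \<xi> / a" and g'="\<lambda>a. \<xi> / a\<^sup>2" and f="\<lambda>b. f (- b)"])
    show "(\<Union>n. {- \<xi> / (1 / (real n + 2))..- \<xi> / (real n + 2)}) = {..<0}"
    proof safe
      fix x :: real assume "x < 0"
      obtain n where n: "real n > max (- x / \<xi>) (\<xi> / -x)" using reals_Archimedean2 by blast
      have "- x / \<xi> \<le> real n + 2" "\<xi> / -x \<le> real n + 2" using n by auto
      then have "- \<xi> / (1 / (real n + 2)) \<le> x" "x \<le> - \<xi> / (real n + 2)"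
        using \<xi> \<open>x < 0\<close> by (auto simp: field_simps)
      then show "x \<in> (\<Union>n. {- \<xi> / (1 / (real n + 2))..- \<xi> / (real n + 2)})" by auto
    next
      fix n x assume "x \<in> {- \<xi> / (1 / (real n + 2))..- \<xi> / (real n + 2)}"
      moreover have "- \<xi> / (real n + 2) < 0" using \<xi> by auto
      ultimately show "x < 0" by auto
    qed
  qed (use \<xi> in \<open>auto intro!: derivative_eq_intros continuous_intros simp: power2_eq_square\<close>)
  finally show ?thesis by simp
qed

section \<open>The measures, the angle variable and polar coordinates\<close>

locale hankel =
  fixes \<alpha> :: real
  assumes alpha: "\<alpha> > -1/2"
begin

abbreviation "\<mu> \<equiv> mu_alpha \<alpha>"

text \<open>The normalisation that gives \<open>angle_measure\<close> total mass 1; see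
  \<open>emeasure_angle\<close>.\<close>

definition angle_const :: real where
  "angle_const = Gamma (\<alpha>+1) / (Gamma (1/2) * Gamma (\<alpha>+1/2))"

definition angle_measure :: "real measure" where
  "angle_measure = density lborel (\<lambda>\<theta>. ennreal (indicator {0..pi} \<theta> * (angle_const * sin \<theta> powr (2*\<alpha>))))"

text \<open>Length of the plane vector x + y e^(i theta); the translation averages a function over
  these lengths.\<close>

definition hyp :: "real \<Rightarrow> real \<Rightarrow> real \<Rightarrow> real" where
  "hyp x y \<theta> = sqrt (x\<^sup>2 + y\<^sup>2 + 2*x*y*cos \<theta>)"

lemma Gamma_alpha_pos: "Gamma (\<alpha>+1) > 0" "Gamma (\<alpha>+1/2) > 0"
  using alpha by (auto intro!: Gamma_real_pos)

lemma angle_const_pos: "angle_const > 0"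
  using Gamma_alpha_pos by (simp add: angle_const_def Gamma_one_half_real)

lemma mu_weight_measurable [measurable]: "mu_weight \<alpha> \<in> borel_measurable borel"
  unfolding mu_weight_def by measurable

lemma mu_weight_nonneg [simp]: "mu_weight \<alpha> x \<ge> 0"
  using Gamma_alpha_pos by (auto simp: mu_weight_def intro!: mult_nonneg_nonneg divide_nonneg_nonneg)

lemma sets_mu [measurable_cong, simp]: "sets \<mu> = sets borel"
  by (simp add: mu_alpha_def)

lemma space_mu [simp]: "space \<mu> = UNIV"
  by (simp add: mu_alpha_def)

lemma sets_angle [measurable_cong, simp]: "sets angle_measure = sets borel"
  by (simp add: angle_measure_def)

lemma space_angle [simp]: "space angle_measure = UNIV"
  by (simp add: angle_measure_def)

lemma measurable_hyp [measurable (raw)]: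
  assumes [measurable]: "f \<in> borel_measurable M" "g \<in> borel_measurable M" "h \<in> borel_measurable M"
  shows "(\<lambda>x. hyp (f x) (g x) (h x)) \<in> borel_measurable M"
  unfolding hyp_def by measurable

lemma hyp_commute: "hyp x y \<theta> = hyp y x \<theta>"
  by (simp add: hyp_def algebra_simps)

lemma sigma_finite_mu: "sigma_finite_measure \<mu>"
  unfolding mu_alpha_def by (subst sigma_finite_measure.sigma_finite_iff_density_finite[OF sigma_finite_lborel]) auto

lemma sigma_finite_angle: "sigma_finite_measure angle_measure"
  unfolding angle_measure_def by (subst sigma_finite_measure.sigma_finite_iff_density_finite[OF sigma_finite_lborel]) auto

sublocale mu: sigma_finite_measure \<mu> by (rule sigma_finite_mu)
sublocale ang: sigma_finite_measure angle_measure by (rule sigma_finite_angle)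
sublocale mm: pair_sigma_finite \<mu> \<mu> by standard
sublocale ma: pair_sigma_finite \<mu> angle_measure by standard

lemma nn_integral_mu:
  assumes [measurable]: "f \<in> borel_measurable borel"
  shows "(\<integral>\<^sup>+x. f x \<partial>\<mu>) = (\<integral>\<^sup>+x. ennreal (mu_weight \<alpha> x) * f x \<partial>lborel)"
  unfolding mu_alpha_def by (subst nn_integral_density) auto

lemma nn_integral_angle:
  assumes [measurable]: "f \<in> borel_measurable borel"
  shows "(\<integral>\<^sup>+x. f x \<partial>angle_measure) =
    (\<integral>\<^sup>+\<theta>. ennreal (indicator {0..pi} \<theta> * (angle_const * sin \<theta> powr (2*\<alpha>))) * f \<theta> \<partial>lborel)"
  unfolding angle_measure_def by (subst nn_integral_density) auto

lemma AE_mu_pos: "AE x in \<mu>. x > 0"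
proof -
  have "AE x in lborel. x \<noteq> (0::real)" by (rule AE_lborel_singleton)
  then show ?thesis unfolding mu_alpha_def
    by (subst AE_density) (auto simp: mu_weight_def indicator_def)
qed

text \<open>Density of \<open>\<mu>\<close> times the angle measure in the coordinates r = x^2, u =
  x cos theta, up to \<open>polar_const\<close>. Here r - u^2 = (x sin theta)^2, and the Jacobian 2
  x^2 sin theta lowers the exponent from alpha to alpha - 1/2.\<close>

definition polar_density :: "real \<Rightarrow> real \<Rightarrow> ennreal" where
  "polar_density r u = ennreal (indicator {0<..} (r - u\<^sup>2) * (r - u\<^sup>2) powr (\<alpha> - 1/2))"

lemma polar_density_measurable [measurable]: "case_prod polar_density \<in> borel_measurable (borel \<Otimes>\<^sub>M borel)"
  unfolding polar_density_def by measurable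

definition polar_const :: real where
  "polar_const = angle_const / (2 * (2 powr \<alpha> * Gamma (\<alpha>+1)))"

text \<open>Substituting u = x cos theta at fixed x produces (x sin theta)^(2 alpha); the factor
  x^(2 alpha) on the left completes the sine weight of the angle measure.\<close>

lemma nn_integral_angle_cos:
  fixes F :: "real \<Rightarrow> ennreal"
  assumes [measurable]: "F \<in> borel_measurable borel" and x: "x > 0"
  shows "ennreal (x powr (2*\<alpha>)) * (\<integral>\<^sup>+\<theta>. F (x * cos \<theta>) \<partial>angle_measure) =
    ennreal angle_const * (\<integral>\<^sup>+u. F u * polar_density (x\<^sup>2) u \<partial>lborel)"
proof -
  \<comment> \<open>The substitution rule needs an increasing map, hence -x cos theta in place of x
    cos theta and the reflected argument here.\<close>
  define f where "f u = F (- u) * ennreal ((x\<^sup>2 - u\<^sup>2) powr (\<alpha> - 1/2))" for u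
  have [measurable]: "f \<in> borel_measurable borel" unfolding f_def by measurable
  \<comment> \<open>At y = 0, which occurs at the ends of the angle interval, both sides vanish
    because \<open>0 powr a\<close> is 0 for every exponent, negative ones included.\<close>
  have key: "(y\<^sup>2) powr (\<alpha> - 1/2) * y = y powr (2*\<alpha>)" if "y \<ge> 0" for y :: real
  proof (cases "y = 0")
    case False
    then have "y > 0" using that by simp
    then have "(y\<^sup>2) powr (\<alpha> - 1/2) * y = y powr (2*\<alpha>-1) * y powr 1"
      by (simp add: powr_powr powr_numeral[symmetric] algebra_simps del: powr_numeral)
    also have "\<dots> = y powr (2*\<alpha>)" by (subst powr_add[symmetric]) simp
    finally show ?thesis .
  qed auto
  have "(\<integral>\<^sup>+u. F u * polar_density (x\<^sup>2) u \<partial>lborel) = (\<integral>\<^sup>+u. F (-u) * polar_density (x\<^sup>2) (-u) \<partial>lborel)"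
    by (subst nn_integral_real_affine[where c="-1" and t=0]) (auto intro!: nn_integral_cong)
  also have "\<dots> = (\<integral>\<^sup>+u. f u * indicator {- x * cos 0..- x * cos pi} u \<partial>lborel)"
  proof (rule nn_integral_cong)
    fix u
    have "u\<^sup>2 < x\<^sup>2 \<longleftrightarrow> \<bar>u\<bar> < x" using x by (metis abs_le_square_iff abs_of_pos linorder_not_le)
    then have *: "u\<^sup>2 < x\<^sup>2 \<longleftrightarrow> -x < u \<and> u < x" by auto
    show "F (-u) * polar_density (x\<^sup>2) (-u) = f u * indicator {- x * cos 0..- x * cos pi} u"
      using * by (auto simp: f_def polar_density_def indicator_def)
  qed
  also have "\<dots> = (\<integral>\<^sup>+\<theta>. f (- x * cos \<theta>) * ennreal (x * sin \<theta>) * indicator {0..pi} \<theta> \<partial>lborel)"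
    by (rule nn_integral_substitution_aux)
       (use x in \<open>auto intro!: derivative_eq_intros continuous_intros mult_nonneg_nonneg sin_ge_zero\<close>)
  also have "\<dots> = (\<integral>\<^sup>+\<theta>. ennreal (x powr (2*\<alpha>)) * (ennreal (indicator {0..pi} \<theta> * sin \<theta> powr (2*\<alpha>)) * F (x * cos \<theta>)) \<partial>lborel)"
  proof (rule nn_integral_cong)
    fix \<theta>
    show "f (- x * cos \<theta>) * ennreal (x * sin \<theta>) * indicator {0..pi} \<theta> =
        ennreal (x powr (2*\<alpha>)) * (ennreal (indicator {0..pi} \<theta> * sin \<theta> powr (2*\<alpha>)) * F (x * cos \<theta>))"
    proof (cases "\<theta> \<in> {0..pi}")
      case True
      then have s: "sin \<theta> \<ge> 0" by (auto intro: sin_ge_zero)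
      have "x\<^sup>2 - (x * cos \<theta>)\<^sup>2 = (x * sin \<theta>)\<^sup>2"
        by (simp add: power_mult_distrib sin_squared_eq algebra_simps)
      then have "f (- x * cos \<theta>) * ennreal (x * sin \<theta>) = F (x * cos \<theta>) * ennreal (((x * sin \<theta>)\<^sup>2) powr (\<alpha> - 1/2) * (x * sin \<theta>))"
        using s x by (simp add: f_def mult.assoc ennreal_mult)
      also have "((x * sin \<theta>)\<^sup>2) powr (\<alpha> - 1/2) * (x * sin \<theta>) = x powr (2*\<alpha>) * sin \<theta> powr (2*\<alpha>)"
        using s x by (subst key) (auto simp: powr_mult)
      finally show ?thesis using True by (simp add: ennreal_mult mult_ac)
    qed auto
  qed
  also have "\<dots> = ennreal (x powr (2*\<alpha>)) * (\<integral>\<^sup>+\<theta>. (ennreal (indicator {0..pi} \<theta> * sin \<theta> powr (2*\<alpha>)) * F (x * cos \<theta>)) \<partial>lborel)"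
    by (subst nn_integral_cmult) auto
  finally have "(\<integral>\<^sup>+u. F u * polar_density (x\<^sup>2) u \<partial>lborel) =
      ennreal (x powr (2*\<alpha>)) * (\<integral>\<^sup>+\<theta>. (ennreal (indicator {0..pi} \<theta> * sin \<theta> powr (2*\<alpha>)) * F (x * cos \<theta>)) \<partial>lborel)" .
  moreover have "(\<integral>\<^sup>+\<theta>. F (x * cos \<theta>) \<partial>angle_measure) =
      ennreal angle_const * (\<integral>\<^sup>+\<theta>. (ennreal (indicator {0..pi} \<theta> * sin \<theta> powr (2*\<alpha>)) * F (x * cos \<theta>)) \<partial>lborel)"
    using angle_const_pos
    by (subst nn_integral_cmult[symmetric], measurable, subst nn_integral_angle, measurable)
       (intro nn_integral_cong, subst mult.assoc[symmetric], subst ennreal_mult'[symmetric], auto simp: mult_ac)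
  ultimately show ?thesis by (simp add: mult_ac)
qed

text \<open>Combines u = x cos theta at fixed x with r = x^2. Of the weight x^(2 alpha + 1), the
  inner substitution absorbs x^(2 alpha) and the Jacobian 2x of the outer one absorbs the
  rest.\<close>

lemma nn_integral_polar:
  fixes \<Phi> :: "real \<Rightarrow> real \<Rightarrow> ennreal"
  assumes [measurable]: "case_prod \<Phi> \<in> borel_measurable (borel \<Otimes>\<^sub>M borel)"
  shows "(\<integral>\<^sup>+x. \<integral>\<^sup>+\<theta>. \<Phi> (x\<^sup>2) (x * cos \<theta>) \<partial>angle_measure \<partial>\<mu>) =
    ennreal polar_const * (\<integral>\<^sup>+r. \<integral>\<^sup>+u. \<Phi> r u * polar_density r u \<partial>lborel \<partial>lborel)"
proof -
  define w where "w = 1 / (2 powr \<alpha> * Gamma (\<alpha>+1))"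
  have w: "w > 0" using Gamma_alpha_pos by (simp add: w_def)
  define f where "f r = (\<integral>\<^sup>+u. \<Phi> r u * polar_density r u \<partial>lborel)" for r
  have [measurable]: "f \<in> borel_measurable borel" unfolding f_def by measurable
  have eq: "ennreal (mu_weight \<alpha> x) * (\<integral>\<^sup>+\<theta>. \<Phi> (x\<^sup>2) (x * cos \<theta>) \<partial>angle_measure) =
    ennreal (w * angle_const / 2) * (f (x\<^sup>2) * ennreal (2 * x) * indicator {0<..} x)" for x
  proof (cases "x > 0")
    case True
    have "x powr (2*\<alpha>+1) = x * x powr (2*\<alpha>)" using True by (simp add: powr_add)
    then have "ennreal (mu_weight \<alpha> x) = ennreal (w * x) * ennreal (x powr (2*\<alpha>))"
      using True w by (simp add: mu_weight_def w_def ennreal_mult'[symmetric] mult_ac)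
    then have "ennreal (mu_weight \<alpha> x) * (\<integral>\<^sup>+\<theta>. \<Phi> (x\<^sup>2) (x * cos \<theta>) \<partial>angle_measure) =
       ennreal (w * x) * (ennreal angle_const * f (x\<^sup>2))"
      unfolding f_def using nn_integral_angle_cos[of "\<Phi> (x\<^sup>2)" x, OF _ True] by (simp add: mult.assoc)
    also have "\<dots> = ennreal (w * angle_const / 2) * (f (x\<^sup>2) * ennreal (2 * x))"
      using True w angle_const_pos
      by (simp add: mult.commute[of "f _"] ennreal_mult'[symmetric] flip: mult.assoc) (simp add: mult_ac)
    finally show ?thesis using True by simp
  qed (auto simp: mu_weight_def indicator_def)
  have "(\<integral>\<^sup>+x. \<integral>\<^sup>+\<theta>. \<Phi> (x\<^sup>2) (x * cos \<theta>) \<partial>angle_measure \<partial>\<mu>) =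
     ennreal (w * angle_const / 2) * (\<integral>\<^sup>+x. f (x\<^sup>2) * ennreal (2 * x) * indicator {0<..} x \<partial>lborel)"
    by (subst nn_integral_mu, measurable) (simp add: eq nn_integral_cmult)
  also have "\<dots> = ennreal (w * angle_const / 2) * (\<integral>\<^sup>+r. f r * indicator {0<..} r \<partial>lborel)"
    by (subst nn_integral_substitution_square) auto
  also have "(\<integral>\<^sup>+r. f r * indicator {0<..} r \<partial>lborel) = (\<integral>\<^sup>+r. f r \<partial>lborel)"
  proof (rule nn_integral_cong)
    fix r :: real
    \<comment> \<open>Nothing is added at r <= 0, because \<open>polar_density\<close> vanishes
      unless u^2 < r.\<close>
    have "f r = 0" if "r \<le> 0"
    proof -
      have "polar_density r u = 0" for u
        using that by (simp add: polar_density_def indicator_def not_less)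
           (smt (verit) zero_le_power2)
      then show ?thesis by (simp add: f_def)
    qed
    then show "f r * indicator {0<..} r = f r" by (auto simp: indicator_def)
  qed
  finally show ?thesis by (simp add: f_def polar_const_def w_def mult.commute)
qed

text \<open>In the coordinates \<open>r = x^2\<close>, \<open>u = x * cos \<theta>\<close> exchanging \<open>x\<close> and
  \<open>hyp t x \<theta>\<close> is the involution \<open>(r, u) \<mapsto> (r + 2*t*u + t^2, -(u + t))\<close>, which preserves
  \<open>r - u^2\<close> and Lebesgue measure.\<close>

lemma nn_integral_hyp_swap:
  fixes \<Psi> :: "real \<Rightarrow> real \<Rightarrow> ennreal"
  assumes [measurable]: "case_prod \<Psi> \<in> borel_measurable (borel \<Otimes>\<^sub>M borel)"
  shows "(\<integral>\<^sup>+x. \<integral>\<^sup>+\<theta>. \<Psi> x (hyp t x \<theta>) \<partial>angle_measure \<partial>\<mu>) =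
    (\<integral>\<^sup>+x. \<integral>\<^sup>+\<theta>. \<Psi> (hyp t x \<theta>) x \<partial>angle_measure \<partial>\<mu>)"
proof -
  have 1: "(\<integral>\<^sup>+x. \<integral>\<^sup>+\<theta>. F x (hyp t x \<theta>) \<partial>angle_measure \<partial>\<mu>) =
    ennreal polar_const * (\<integral>\<^sup>+r. \<integral>\<^sup>+u. F (sqrt r) (sqrt (r + 2*t*u + t\<^sup>2)) * polar_density r u \<partial>lborel \<partial>lborel)"
    if [measurable]: "case_prod F \<in> borel_measurable (borel \<Otimes>\<^sub>M borel)" for F :: "real \<Rightarrow> real \<Rightarrow> ennreal"
  proof -
    have "(\<integral>\<^sup>+x. \<integral>\<^sup>+\<theta>. F x (hyp t x \<theta>) \<partial>angle_measure \<partial>\<mu>) =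
       (\<integral>\<^sup>+x. \<integral>\<^sup>+\<theta>. F (sqrt (x\<^sup>2)) (sqrt (x\<^sup>2 + 2 * t * (x * cos \<theta>) + t\<^sup>2)) \<partial>angle_measure \<partial>\<mu>)"
      by (rule nn_integral_cong_AE, rule AE_mp[OF AE_mu_pos]) (auto simp: hyp_def algebra_simps)
    also have "\<dots> = ennreal polar_const * (\<integral>\<^sup>+r. \<integral>\<^sup>+u. F (sqrt r) (sqrt (r + 2*t*u + t\<^sup>2)) * polar_density r u \<partial>lborel \<partial>lborel)"
      by (rule nn_integral_polar[of "\<lambda>r u. F (sqrt r) (sqrt (r + 2*t*u + t\<^sup>2))"]) measurable
    finally show ?thesis .
  qed
  have "(\<integral>\<^sup>+r. \<integral>\<^sup>+u. \<Psi> (sqrt r) (sqrt (r + 2*t*u + t\<^sup>2)) * polar_density r u \<partial>lborel \<partial>lborel) =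
     (\<integral>\<^sup>+u. \<integral>\<^sup>+r. \<Psi> (sqrt r) (sqrt (r + 2*t*u + t\<^sup>2)) * polar_density r u \<partial>lborel \<partial>lborel)"
    by (rule lborel_pair.Fubini') measurable
  also have "\<dots> = (\<integral>\<^sup>+u. \<integral>\<^sup>+r. \<Psi> (sqrt r) (sqrt (r + 2*t*(-t + -1 * u) + t\<^sup>2)) * polar_density r (-t + -1 * u) \<partial>lborel \<partial>lborel)"
    by (subst nn_integral_real_affine[where c="-1" and t="-t"]) auto
  also have "\<dots> = (\<integral>\<^sup>+u. \<integral>\<^sup>+r. \<Psi> (sqrt (r + 2*t*u + t\<^sup>2)) (sqrt r) * polar_density r u \<partial>lborel \<partial>lborel)"
  \<comment> \<open>The outer variable has just been reflected, u -> -t - u. With u fixed,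
    translating r by 2tu + t^2 completes the involution, so each factor is an affine substitution in
    one variable.\<close>
  proof (rule nn_integral_cong)
    fix u
    have 1: "2*t*u + t\<^sup>2 + 1 * r + 2*t*(-t + -1 * u) + t\<^sup>2 = r" for r by (simp add: algebra_simps power2_eq_square)
    have 2: "polar_density (2*t*u + t\<^sup>2 + 1 * r) (-t + -1 * u) = polar_density r u" for r
    proof -
      have "2*t*u + t\<^sup>2 + 1 * r - (-t + -1 * u)\<^sup>2 = r - u\<^sup>2" by (simp add: algebra_simps power2_eq_square)
      then show ?thesis unfolding polar_density_def by presburger
    qed
    have 3: "2*t*u + t\<^sup>2 + 1 * r = r + 2*t*u + t\<^sup>2" for r by simp
    show "(\<integral>\<^sup>+r. \<Psi> (sqrt r) (sqrt (r + 2*t*(-t + -1 * u) + t\<^sup>2)) * polar_density r (-t + -1 * u) \<partial>lborel) =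
      (\<integral>\<^sup>+r. \<Psi> (sqrt (r + 2*t*u + t\<^sup>2)) (sqrt r) * polar_density r u \<partial>lborel)"
      by (subst nn_integral_real_affine[where c="1" and t="2*t*u + t\<^sup>2"], measurable)
         (simp only: 1 2, simp only: 3, simp)
  qed
  also have "\<dots> = (\<integral>\<^sup>+r. \<integral>\<^sup>+u. \<Psi> (sqrt (r + 2*t*u + t\<^sup>2)) (sqrt r) * polar_density r u \<partial>lborel \<partial>lborel)"
    by (rule lborel_pair.Fubini') measurable
  finally show ?thesis
    using 1[of \<Psi>] 1[of "\<lambda>x y. \<Psi> y x"] by simp
qed

section \<open>The Bessel function\<close>

lemma angle_reflect:
  assumes [measurable]: "F \<in> borel_measurable borel"
  shows "(\<integral>\<^sup>+\<theta>. F \<theta> \<partial>angle_measure) = (\<integral>\<^sup>+\<theta>. F (pi - \<theta>) \<partial>angle_measure)"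
  by (subst (1 2) nn_integral_angle, measurable, subst nn_integral_real_affine[where c="-1" and t=pi])
     (auto simp: indicator_def intro!: nn_integral_cong)

text \<open>On the first half of the angle interval v = sin^2 theta turns the integral into
  \<open>angle_const\<close>/2 times Beta(alpha + 1/2, m + 1/2); the reflection theta -> pi - theta
  supplies the other half. The case m = 0 is the total mass of \<open>angle_measure\<close>.\<close>

lemma nn_integral_cos_power_even:
  "(\<integral>\<^sup>+\<theta>. ennreal (cos \<theta> ^ (2*m)) \<partial>angle_measure) = ennreal (pochhammer (1/2) m / pochhammer (\<alpha>+1) m)"
proof -
  define b where "b = \<alpha> + 1/2"
  define a where "a = real m + 1/2"
  have ab: "a > 0" "b > 0" using alpha by (auto simp: a_def b_def)
  \<comment> \<open>When the two halves are added, only the null point pi/2 is left out.\<close>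
  define F where "F \<theta> = ennreal (cos \<theta> ^ (2*m)) * indicator {..<pi/2} \<theta>" for \<theta> :: real
  have [measurable]: "F \<in> borel_measurable borel" unfolding F_def by measurable
  define f where "f v = ennreal (v powr (b-1) * (1-v) powr (a-1))" for v
  have [measurable]: "f \<in> borel_measurable borel" unfolding f_def by measurable
  have half: "(\<integral>\<^sup>+\<theta>. F \<theta> \<partial>angle_measure) = ennreal (angle_const / 2 * Beta b a)"
  proof -
    have "(\<integral>\<^sup>+v. f v * indicator {0..1} v \<partial>lborel) = ennreal (Beta b a)"
      using nn_integral_has_integral_lebesgue[OF _ has_integral_Beta_real[OF ab(2) ab(1)]]
      by (simp add: f_def indicator_mult_ennreal mult.commute nn_integral_set_ennreal)
    moreover have "(\<integral>\<^sup>+v. f v * indicator {(sin 0)\<^sup>2..(sin (pi/2))\<^sup>2} v \<partial>lborel) =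
      (\<integral>\<^sup>+\<theta>. f ((sin \<theta>)\<^sup>2) * ennreal (2 * sin \<theta> * cos \<theta>) * indicator {0..pi/2} \<theta> \<partial>lborel)"
      by (rule nn_integral_substitution_aux)
         (auto intro!: derivative_eq_intros continuous_intros mult_nonneg_nonneg sin_ge_zero cos_ge_zero simp: f_def)
    ultimately have 1: "(\<integral>\<^sup>+\<theta>. f ((sin \<theta>)\<^sup>2) * ennreal (2 * sin \<theta> * cos \<theta>) * indicator {0..pi/2} \<theta> \<partial>lborel) = ennreal (Beta b a)"
      by simp
    have "(\<integral>\<^sup>+\<theta>. F \<theta> \<partial>angle_measure) =
       (\<integral>\<^sup>+\<theta>. ennreal (angle_const/2) * (f ((sin \<theta>)\<^sup>2) * ennreal (2 * sin \<theta> * cos \<theta>) * indicator {0..pi/2} \<theta>) \<partial>lborel)"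
      unfolding nn_integral_angle[OF \<open>F \<in> _\<close>]
    proof (rule nn_integral_cong_AE, rule AE_mp[OF AE_lborel_singleton[of "pi/2"]], rule AE_I2, rule impI)
      fix \<theta> :: real assume ne: "\<theta> \<noteq> pi/2"
      show "ennreal (indicator {0..pi} \<theta> * (angle_const * sin \<theta> powr (2 * \<alpha>))) * F \<theta> =
         ennreal (angle_const/2) * (f ((sin \<theta>)\<^sup>2) * ennreal (2 * sin \<theta> * cos \<theta>) * indicator {0..pi/2} \<theta>)"
      proof (cases "\<theta> \<in> {0..<pi/2}")
        case True
        then have c: "cos \<theta> > 0" by (auto intro!: cos_gt_zero_pi)
        have s: "sin \<theta> \<ge> 0" using True by (auto intro!: sin_ge_zero)
        have k1: "((sin \<theta>)\<^sup>2) powr (b-1) * sin \<theta> = sin \<theta> powr (2*\<alpha>)"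
        proof (cases "sin \<theta> = 0")
          case False
          then have "sin \<theta> > 0" using s by simp
          then have "((sin \<theta>)\<^sup>2) powr (b-1) * sin \<theta> = sin \<theta> powr (2*\<alpha>-1) * sin \<theta> powr 1"
            by (simp add: powr_powr powr_numeral[symmetric] b_def algebra_simps del: powr_numeral)
          also have "\<dots> = sin \<theta> powr (2*\<alpha>)" by (subst powr_add[symmetric]) simp
          finally show ?thesis .
        qed auto
        have "((cos \<theta>)\<^sup>2) powr (a-1) * cos \<theta> = cos \<theta> powr (2*real m-1) * cos \<theta> powr 1"
          using c by (simp add: powr_powr powr_numeral[symmetric] a_def algebra_simps del: powr_numeral)
        also have "\<dots> = cos \<theta> powr (real (2*m))" by (subst powr_add[symmetric]) simp
        also have "\<dots> = cos \<theta> ^ (2*m)" using c by (rule powr_realpow)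
        finally have k2: "((cos \<theta>)\<^sup>2) powr (a-1) * cos \<theta> = cos \<theta> ^ (2*m)" .
        have "1 - (sin \<theta>)\<^sup>2 = (cos \<theta>)\<^sup>2" by (simp add: cos_squared_eq)
        then have "f ((sin \<theta>)\<^sup>2) * ennreal (2 * sin \<theta> * cos \<theta>) =
           ennreal (2 * ((((sin \<theta>)\<^sup>2) powr (b-1) * sin \<theta>) * (((cos \<theta>)\<^sup>2) powr (a-1) * cos \<theta>)))"
          unfolding f_def using s c by (simp add: ennreal_mult'[symmetric] mult_ac)
        also have "\<dots> = ennreal (2 * (sin \<theta> powr (2*\<alpha>) * cos \<theta> ^ (2*m)))" by (simp only: k1 k2)
        finally show ?thesis using True angle_const_pos c
          by (simp add: F_def ennreal_mult'[symmetric] mult_ac indicator_def)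
      qed (use ne in \<open>auto simp: F_def indicator_def\<close>)
    qed
    also have "\<dots> = ennreal (angle_const/2) * ennreal (Beta b a)"
      by (subst nn_integral_cmult) (auto simp: 1)
    finally show ?thesis using angle_const_pos by (simp add: ennreal_mult'[symmetric])
  qed
  have "(\<integral>\<^sup>+\<theta>. ennreal (cos \<theta> ^ (2*m)) \<partial>angle_measure) = (\<integral>\<^sup>+\<theta>. F \<theta> + F (pi - \<theta>) \<partial>angle_measure)"
  proof (rule nn_integral_cong_AE)
    have "AE \<theta> in angle_measure. \<theta> \<noteq> pi/2" unfolding angle_measure_def
      using AE_lborel_singleton[of "pi/2"] by (subst AE_density) auto
    then show "AE \<theta> in angle_measure. ennreal (cos \<theta> ^ (2*m)) = F \<theta> + F (pi - \<theta>)"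
      by eventually_elim (auto simp: F_def indicator_def)
  qed
  also have "\<dots> = (\<integral>\<^sup>+\<theta>. F \<theta> \<partial>angle_measure) + (\<integral>\<^sup>+\<theta>. F (pi - \<theta>) \<partial>angle_measure)"
    by (rule nn_integral_add) auto
  also have "\<dots> = ennreal (angle_const / 2 * Beta b a) + ennreal (angle_const / 2 * Beta b a)"
    by (subst angle_reflect[symmetric]) (auto simp: half)
  also have "\<dots> = ennreal (angle_const * Beta b a)"
    using angle_const_pos ab by (subst ennreal_plus[symmetric]) (auto simp: Beta_def intro!: divide_nonneg_nonneg mult_nonneg_nonneg Gamma_real_pos less_imp_le)
  also have "angle_const * Beta b a = (Gamma (1/2 + real m) / Gamma (1/2)) / (Gamma (\<alpha> + 1 + real m) / Gamma (\<alpha>+1))"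
  proof -
    have "b + a = \<alpha> + 1 + real m" "a = 1/2 + real m" by (simp_all add: a_def b_def)
    then show ?thesis using Gamma_alpha_pos unfolding angle_const_def Beta_def b_def by (simp add: mult_ac add_ac)
  qed
  also have "\<dots> = pochhammer (1/2) m / pochhammer (\<alpha>+1) m"
    using alpha by (subst (1 2) pochhammer_Gamma) (auto elim!: nonpos_Ints_cases)
  finally show ?thesis .
qed

lemma emeasure_angle [simp]: "emeasure angle_measure UNIV = 1"
  using nn_integral_cos_power_even[of 0] by simp

sublocale ang: finite_measure angle_measure
  by standard simp

lemma integrable_angle_bounded:
  fixes f :: "real \<Rightarrow> 'b::{banach, second_countable_topology}"
  assumes "f \<in> borel_measurable borel" "\<And>\<theta>. norm (f \<theta>) \<le> B"
  shows "integrable angle_measure f"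
  using assms by (intro ang.integrable_const_bound[of _ B]) auto

lemma measure_angle [simp]: "measure angle_measure UNIV = 1"
  by (simp add: measure_def)

text \<open>Odd powers change sign under theta -> pi - theta, which preserves the angle measure;
  even powers are the Beta values above.\<close>

lemma integral_cos_power:
  "(\<integral>\<theta>. cos \<theta> ^ n \<partial>angle_measure) =
     (if even n then pochhammer (1/2) (n div 2) / pochhammer (\<alpha>+1) (n div 2) else 0)"
proof (cases "even n")
  case True
  then obtain m where n: "n = 2 * m" by blast
  have "pochhammer (1/2) m / pochhammer (\<alpha>+1) m \<ge> 0"
    using alpha by (intro divide_nonneg_nonneg pochhammer_nonneg) auto
  then show ?thesis unfolding n using nn_integral_cos_power_even[of m]
    by (subst integral_eq_nn_integral) auto
next
  case False
  have "(\<integral>\<theta>. cos \<theta> ^ n \<partial>angle_measure) = (\<integral>\<theta>. indicator {0..pi} \<theta> * (angle_const * sin \<theta> powr (2*\<alpha>)) * cos \<theta> ^ n \<partial>lborel)"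
    unfolding angle_measure_def using angle_const_pos by (subst integral_density) auto
  also have "\<dots> = (\<integral>\<theta>. indicator {0..pi} (pi + -1 * \<theta>) * (angle_const * sin (pi + -1 * \<theta>) powr (2*\<alpha>)) * cos (pi + -1 * \<theta>) ^ n \<partial>lborel)"
    by (subst lborel_integral_real_affine[where c="-1" and t=pi]) auto
  also have "\<dots> = (\<integral>\<theta>. - (indicator {0..pi} \<theta> * (angle_const * sin \<theta> powr (2*\<alpha>)) * cos \<theta> ^ n) \<partial>lborel)"
    using False by (intro Bochner_Integration.integral_cong) (auto simp: indicator_def)
  also have "\<dots> = - (\<integral>\<theta>. cos \<theta> ^ n \<partial>angle_measure)"
    unfolding angle_measure_def using angle_const_pos by (subst integral_density) auto
  finally show ?thesis using False by simp
qed

text \<open>Coefficients of the hypergeometric function 0F1 with parameter alpha + 1;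
  \<open>j\<close> is its value at -z^2/4. Pochhammer symbols replace the Gamma quotients of
  \<open>bessel_j\<close>.\<close>

definition bessel_coeff :: "nat \<Rightarrow> real" where
  "bessel_coeff n = 1 / (fact n * pochhammer (\<alpha>+1) n)"

text \<open>Every factor alpha + 1 + i exceeds 1/2 because alpha > -1/2. The Bessel series is then
  dominated by the series of exp (2 |w|).\<close>

lemma pochhammer_ge: "pochhammer (\<alpha>+1) n \<ge> (1/2) ^ n"
proof -
  have "(\<Prod>i<n. 1/2) \<le> (\<Prod>i<n. \<alpha> + 1 + real i)"
    using alpha by (intro prod_mono) auto
  then show ?thesis by (simp add: pochhammer_prod atLeast0LessThan)
qed

lemma pochhammer_alpha_pos: "pochhammer (\<alpha>+1) n > 0"
  by (rule less_le_trans[OF _ pochhammer_ge]) simp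

lemma bessel_coeff_pos: "bessel_coeff n > 0"
  using pochhammer_alpha_pos by (simp add: bessel_coeff_def)

lemma bessel_coeff_bound: "norm (bessel_coeff n * w ^ n) \<le> (2 * \<bar>w\<bar>) ^ n / fact n"
proof -
  have "1 / pochhammer (\<alpha>+1) n \<le> 1 / (1/2)^n"
    using pochhammer_ge pochhammer_alpha_pos by (intro divide_left_mono) auto
  then have "1 / pochhammer (\<alpha>+1) n * \<bar>w\<bar>^n / fact n \<le> 2^n * \<bar>w\<bar>^n / fact n"
    by (intro divide_right_mono mult_right_mono) (auto simp: power_divide)
  then show ?thesis using pochhammer_alpha_pos[of n]
    by (simp add: bessel_coeff_def abs_mult power_abs power_mult_distrib mult_ac)
qed

lemma summable_bessel: "summable (\<lambda>n. norm (bessel_coeff n * w ^ n))"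
proof (rule summable_comparison_test'[of "\<lambda>n. (2 * \<bar>w\<bar>) ^ n / fact n" 0])
  show "summable (\<lambda>n. (2 * \<bar>w\<bar>) ^ n / fact n)"
    using summable_exp[of "2 * \<bar>w\<bar>"] by (simp add: field_simps)
qed (use bessel_coeff_bound[of _ w] in auto)

definition bessel_series :: "real \<Rightarrow> real" where
  "bessel_series w = (\<Sum>n. bessel_coeff n * w ^ n)"

lemma bessel_series_sums: "(\<lambda>n. bessel_coeff n * w ^ n) sums bessel_series w"
  unfolding bessel_series_def by (rule summable_sums[OF summable_norm_cancel[OF summable_bessel]])

lemma bessel_series_measurable [measurable]: "bessel_series \<in> borel_measurable borel"
  unfolding bessel_series_def by measurable

abbreviation "j \<equiv> bessel_j \<alpha>"

lemma bessel_j_eq_series: "j z = bessel_series (- (z\<^sup>2/4))"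
proof -
  have *: "bessel_coeff n * (- (z\<^sup>2/4)) ^ n = Gamma (\<alpha>+1) * ((-1)^n / (fact n * Gamma (real n + \<alpha> + 1)) * (z/2)^(2*n))" for n
  proof -
    have "pochhammer (\<alpha>+1) n = Gamma (real n + \<alpha> + 1) / Gamma (\<alpha>+1)"
      using alpha by (subst pochhammer_Gamma) (auto elim!: nonpos_Ints_cases simp: add_ac)
    moreover have "(- (z\<^sup>2/4)) ^ n = (-1)^n * (z/2)^(2*n)"
      by (subst power_minus) (simp add: power_mult power_divide)
    ultimately show ?thesis by (simp add: bessel_coeff_def)
  qed
  have "(\<lambda>n. Gamma (\<alpha>+1) * ((-1)^n / (fact n * Gamma (real n + \<alpha> + 1)) * (z/2)^(2*n))) sums bessel_series (- (z\<^sup>2/4))"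
    using bessel_series_sums[of "- (z\<^sup>2/4)"] unfolding * .
  then have "(\<lambda>n. 1 / Gamma (\<alpha>+1) * (Gamma (\<alpha>+1) * ((-1)^n / (fact n * Gamma (real n + \<alpha> + 1)) * (z/2)^(2*n)))) sums
     (1 / Gamma (\<alpha>+1) * bessel_series (- (z\<^sup>2/4)))"
    by (rule sums_mult)
  then have "(\<lambda>n. ((-1)^n / (fact n * Gamma (real n + \<alpha> + 1)) * (z/2)^(2*n))) sums
     (1 / Gamma (\<alpha>+1) * bessel_series (- (z\<^sup>2/4)))"
    using Gamma_alpha_pos by simp
  then show ?thesis unfolding bessel_j_def using Gamma_alpha_pos by (simp add: sums_iff)
qed

lemma bessel_j_measurable [measurable]: "j \<in> borel_measurable borel"
  unfolding bessel_j_eq_series[abs_def] by measurable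

text \<open>The cosine series integrated term by term against the moments of cos theta gives the
  series of \<open>j\<close>, because (2n)! = 4^n n! (1/2)_n. The bound \<open>bessel_j_le_1\<close>
  rests on this representation.\<close>

lemma bessel_j_Poisson: "j z = (\<integral>\<theta>. cos (z * cos \<theta>) \<partial>angle_measure)"
proof -
  define f where "f n \<theta> = (-1)^n / fact (2*n) * (z * cos \<theta>)^(2*n)" for n \<theta>
  have bound: "norm (f n \<theta>) \<le> (z\<^sup>2)^n / fact n" for n \<theta>
  proof -
    have "(z * cos \<theta>)^(2*n) = (z\<^sup>2)^n * ((cos \<theta>)\<^sup>2)^n"
      by (simp add: power_mult power_mult_distrib)
    then have "norm (f n \<theta>) = (z\<^sup>2)^n * ((cos \<theta>)\<^sup>2)^n / fact (2*n)"
      by (simp add: f_def abs_mult)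
    also have "\<dots> \<le> (z\<^sup>2)^n * 1 / fact n"
    proof -
      have "((cos \<theta>)\<^sup>2)^n \<le> 1" by (rule power_le_one) (auto simp: abs_square_le_1)
      then show ?thesis by (intro frac_le mult_left_mono fact_mono) auto
    qed
    finally show ?thesis by simp
  qed
  have int: "integrable angle_measure (f n)" for n
    by (rule integrable_angle_bounded[OF _ bound]) (simp add: f_def)
  have sm: "summable (\<lambda>n. (z\<^sup>2)^n / fact n)"
    using summable_exp[of "z\<^sup>2"] by (simp add: field_simps)
  have "(\<lambda>n. integral\<^sup>L angle_measure (f n)) sums (\<integral>\<theta>. (\<Sum>n. f n \<theta>) \<partial>angle_measure)"
  proof (rule sums_integral[OF int])
    show "AE \<theta> in angle_measure. summable (\<lambda>n. norm (f n \<theta>))"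
      by (intro AE_I2 summable_comparison_test'[OF sm, of 0]) (use bound in auto)
    show "summable (\<lambda>n. \<integral>\<theta>. norm (f n \<theta>) \<partial>angle_measure)"
    proof (rule summable_comparison_test'[OF sm, of 0])
      fix n
      have "(\<integral>\<theta>. norm (f n \<theta>) \<partial>angle_measure) \<le> (\<integral>\<theta>. (z\<^sup>2)^n / fact n \<partial>angle_measure)"
        using int bound by (intro integral_mono) auto
      then show "norm (\<integral>\<theta>. norm (f n \<theta>) \<partial>angle_measure) \<le> (z\<^sup>2)^n / fact n" by simp
    qed
  qed
  moreover have "(\<Sum>n. f n \<theta>) = cos (z * cos \<theta>)" for \<theta>
    unfolding f_def using cos_paired[of "z * cos \<theta>"] by (simp add: sums_iff)
  moreover have "integral\<^sup>L angle_measure (f n) = bessel_coeff n * (- (z\<^sup>2/4))^n" for n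
  proof -
    have "integral\<^sup>L angle_measure (f n) = (-1)^n / fact (2*n) * z^(2*n) * (pochhammer (1/2) n / pochhammer (\<alpha>+1) n)"
      unfolding f_def using integral_cos_power[of "2*n"] by (simp add: power_mult_distrib mult.assoc)
    also have "\<dots> = (-1)^n * z^(2*n) / 2^(2*n) * bessel_coeff n"
      using pochhammer_alpha_pos[of n] pochhammer_pos[of "1/2::real" n]
      by (subst fact_double) (simp add: bessel_coeff_def field_simps)
    also have "\<dots> = bessel_coeff n * (- (z\<^sup>2/4))^n"
      by (subst power_minus) (simp add: power_mult power_divide)
    finally show ?thesis .
  qed
  ultimately show ?thesis unfolding bessel_j_eq_series bessel_series_def by (simp add: sums_iff)
qed

lemma bessel_j_le_1: "\<bar>j z\<bar> \<le> 1"
proof -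
  have "\<bar>j z\<bar> \<le> (\<integral>\<theta>. \<bar>cos (z * cos \<theta>)\<bar> \<partial>angle_measure)"
    unfolding bessel_j_Poisson by (rule integral_abs_bound)
  also have "\<dots> \<le> (\<integral>\<theta>. 1 \<partial>angle_measure)"
    by (intro integral_mono integrable_angle_bounded[of _ 1]) auto
  finally show ?thesis by simp
qed

section \<open>Gaussian integrals\<close>

text \<open>The substitution r = x^2 turns the moment into a Gamma integral with parameter n + alpha
  + 1.\<close>

lemma nn_integral_gaussian_moment:
  assumes t: "t > 0"
  shows "(\<integral>\<^sup>+x. ennreal (x ^ (2*n) * exp (- t * x\<^sup>2)) \<partial>\<mu>) =
    ennreal ((2*t) powr (-(\<alpha>+1)) * pochhammer (\<alpha>+1) n / t ^ n)"
proof -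
  define s where "s = real n + \<alpha> + 1"
  have s: "s > 0" using alpha by (simp add: s_def)
  define w where "w = 1 / (2 powr \<alpha> * Gamma (\<alpha>+1))"
  have w: "w > 0" using Gamma_alpha_pos by (simp add: w_def)
  define f where "f r = ennreal (indicator {0..} r * r powr (s-1) * exp (-(t*r)))" for r
  have [measurable]: "f \<in> borel_measurable borel" unfolding f_def by measurable
  have "(\<integral>\<^sup>+x. ennreal (x ^ (2*n) * exp (- t * x\<^sup>2)) \<partial>\<mu>) =
     (\<integral>\<^sup>+x. ennreal (w/2) * (f (x\<^sup>2) * ennreal (2 * x) * indicator {0<..} x) \<partial>lborel)"
  proof (subst nn_integral_mu, measurable, rule nn_integral_cong)
    fix x
    show "ennreal (mu_weight \<alpha> x) * ennreal (x ^ (2*n) * exp (- t * x\<^sup>2)) = ennreal (w/2) * (f (x\<^sup>2) * ennreal (2 * x) * indicator {0<..} x)"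
    proof (cases "x > 0")
      case True
      have "(x\<^sup>2) powr (s-1) * x = x powr (2*(s-1)) * x powr 1"
        using True by (simp add: powr_powr powr_numeral[symmetric] del: powr_numeral)
      also have "\<dots> = x powr (2*\<alpha>+1) * x powr real (2*n)"
        by (subst (1 2) powr_add[symmetric]) (simp add: s_def algebra_simps)
      also have "\<dots> = x powr (2*\<alpha>+1) * x ^ (2*n)" using True by (simp only: powr_realpow)
      finally have "x powr (2*\<alpha>+1) * x ^ (2*n) = (x\<^sup>2) powr (s-1) * x" by simp
      then have "w * (x powr (2*\<alpha>+1) * x ^ (2*n)) * exp (-(t*x\<^sup>2)) = w * ((x\<^sup>2) powr (s-1) * x) * exp (-(t*x\<^sup>2))" by simp
      then have "mu_weight \<alpha> x * (x ^ (2*n) * exp (- t * x\<^sup>2)) = w/2 * ((x\<^sup>2) powr (s-1) * exp (-(t*x\<^sup>2)) * (2*x))"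
        using True by (simp add: mu_weight_def w_def mult_ac)
      then show ?thesis using True w unfolding f_def by (simp add: ennreal_mult'[symmetric] ennreal_mult''[symmetric])
    qed (auto simp: mu_weight_def indicator_def f_def)
  qed
  also have "\<dots> = ennreal (w/2) * (\<integral>\<^sup>+r. f r * indicator {0<..} r \<partial>lborel)"
    by (subst nn_integral_substitution_square, measurable) (simp add: nn_integral_cmult)
  also have "(\<integral>\<^sup>+r. f r * indicator {0<..} r \<partial>lborel) = (\<integral>\<^sup>+r. f r \<partial>lborel)"
    by (rule nn_integral_cong) (auto simp: f_def indicator_def)
  also have "\<dots> = ennreal (1/t) * (\<integral>\<^sup>+u. f (u/t) \<partial>lborel)"
    using t by (subst nn_integral_real_affine[where c="1/t" and t=0]) auto
  also have "(\<integral>\<^sup>+u. f (u/t) \<partial>lborel) = (\<integral>\<^sup>+u. ennreal (t powr (1-s)) * ennreal (indicator {0..} u * u powr (s - 1) / exp u) \<partial>lborel)"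
    unfolding f_def using t
    by (intro nn_integral_cong)
       (auto simp: ennreal_mult'[symmetric] indicator_def zero_le_divide_iff powr_divide exp_minus field_simps powr_diff)
  also have "\<dots> = ennreal (t powr (1-s)) * ennreal (Gamma s)"
    using Gamma_conv_nn_integral_real[OF s] by (subst nn_integral_cmult) auto
  also have "ennreal (w/2) * (ennreal (1/t) * (ennreal (t powr (1-s)) * ennreal (Gamma s))) = ennreal (w/2 * (1/t * (t powr (1-s) * Gamma s)))"
    using w t s by (simp add: ennreal_mult'[symmetric] del: times_divide_eq_left times_divide_eq_right)
  also have "w/2 * (1/t * (t powr (1-s) * Gamma s)) = (2*t) powr (-(\<alpha>+1)) * pochhammer (\<alpha>+1) n / t ^ n"
  proof -
    have p: "pochhammer (\<alpha>+1) n = Gamma s / Gamma (\<alpha>+1)"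
      using alpha by (subst pochhammer_Gamma) (auto elim!: nonpos_Ints_cases simp: s_def add_ac)
    have "t powr (1-s) = t powr (-(\<alpha>+1)) * t / t ^ n"
      using t by (simp add: s_def powr_diff powr_minus powr_add powr_realpow field_simps)
    moreover have "(2::real) powr (-(\<alpha>+1)) = 1 / (2 powr \<alpha> * 2)" by (simp add: powr_diff powr_minus powr_add field_simps)
    ultimately show ?thesis using t Gamma_alpha_pos by (simp add: p w_def powr_mult)
  qed
  finally show ?thesis .
qed

lemma gaussian_moment:
  assumes t: "t > 0"
  shows "integrable \<mu> (\<lambda>x. x ^ (2*n) * exp (- t * x\<^sup>2))" (is ?A)
    "(\<integral>x. x ^ (2*n) * exp (- t * x\<^sup>2) \<partial>\<mu>) = (2*t) powr (-(\<alpha>+1)) * pochhammer (\<alpha>+1) n / t ^ n" (is ?B)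
proof -
  have nn: "(2*t) powr (-(\<alpha>+1)) * pochhammer (\<alpha>+1) n / t ^ n \<ge> 0"
    using t pochhammer_alpha_pos[of n] by simp
  have "x ^ (2*n) * exp (- t * x\<^sup>2) \<ge> 0" for x :: real by (simp add: power_mult)
  then show ?A ?B using nn_integral_gaussian_moment[OF t, of n] nn
    by (auto intro!: integrableI_nn_integral_finite[of _ _ "(2*t) powr (-(\<alpha>+1)) * pochhammer (\<alpha>+1) n / t ^ n"] simp: integral_eq_nn_integral)
qed

lemma gaussian_integrable: "t > 0 \<Longrightarrow> integrable \<mu> (\<lambda>x. exp (- t * x\<^sup>2))"
  using gaussian_moment(1)[of t 0] by simp

text \<open>In the term-by-term integral the factor (alpha+1)_n of the moment cancels the one in
  \<open>bessel_coeff\<close> and leaves the exponential series at -xi^2/(4t). The same computation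
  with absolute values gives the series of exp (xi^2/(4t)) and justifies the interchange.\<close>

lemma gaussian_bessel:
  assumes t: "t > 0"
  shows "(\<integral>x. exp (- t * x\<^sup>2) * j (x * \<xi>) \<partial>\<mu>) = (2*t) powr (-(\<alpha>+1)) * exp (- \<xi>\<^sup>2 / (4*t))"
proof -
  define f where "f n x = bessel_coeff n * (- (\<xi>\<^sup>2/4))^n * (x ^ (2*n) * exp (- t * x\<^sup>2))" for n x
  have int: "integrable \<mu> (f n)" for n
    unfolding f_def by (intro integrable_mult_right gaussian_moment t)
  have If: "(\<integral>x. f n x \<partial>\<mu>) = (2*t) powr (-(\<alpha>+1)) * ((- \<xi>\<^sup>2/(4*t))^n / fact n)" for n
  proof -
    have "(\<integral>x. f n x \<partial>\<mu>) = bessel_coeff n * (- (\<xi>\<^sup>2/4))^n * ((2*t) powr (-(\<alpha>+1)) * pochhammer (\<alpha>+1) n / t ^ n)"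
      unfolding f_def by (simp add: gaussian_moment(2)[OF t, simplified])
    also have "\<dots> = (2*t) powr (-(\<alpha>+1)) * ((- (\<xi>\<^sup>2/4))^n / t^n / fact n)"
      using pochhammer_alpha_pos[of n] by (simp add: bessel_coeff_def) (simp add: mult_ac)
    also have "(- (\<xi>\<^sup>2/4))^n / t^n = (- \<xi>\<^sup>2/(4*t))^n"
      by (subst power_divide[symmetric]) simp
    finally show ?thesis .
  qed
  have nf: "norm (f n x) = bessel_coeff n * ((\<xi>\<^sup>2/4))^n * (x ^ (2*n) * exp (- t * x\<^sup>2))" for n x
    using bessel_coeff_pos[of n] by (simp add: f_def abs_mult power_abs power_mult)
  have Inf: "(\<integral>x. norm (f n x) \<partial>\<mu>) = (2*t) powr (-(\<alpha>+1)) * ((\<xi>\<^sup>2/(4*t))^n / fact n)" for n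
  proof -
    have "(\<integral>x. norm (f n x) \<partial>\<mu>) = bessel_coeff n * ((\<xi>\<^sup>2/4))^n * ((2*t) powr (-(\<alpha>+1)) * pochhammer (\<alpha>+1) n / t ^ n)"
      unfolding nf by (simp add: gaussian_moment(2)[OF t, simplified])
    also have "\<dots> = (2*t) powr (-(\<alpha>+1)) * (((\<xi>\<^sup>2/4))^n / t^n / fact n)"
      using pochhammer_alpha_pos[of n] by (simp add: bessel_coeff_def) (simp add: mult_ac)
    also have "((\<xi>\<^sup>2/4))^n / t^n = (\<xi>\<^sup>2/(4*t))^n"
      by (subst power_divide[symmetric]) simp
    finally show ?thesis .
  qed
  have fs: "(\<lambda>n. f n x) sums (exp (- t * x\<^sup>2) * j (x * \<xi>))" for x
  proof -
    have "(\<lambda>n. exp (- t * x\<^sup>2) * (bessel_coeff n * (- ((x*\<xi>)\<^sup>2/4)) ^ n)) sums (exp (- t * x\<^sup>2) * j (x * \<xi>))"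
      unfolding bessel_j_eq_series by (intro sums_mult bessel_series_sums)
    moreover have "exp (- t * x\<^sup>2) * (bessel_coeff n * (- ((x*\<xi>)\<^sup>2/4)) ^ n) = f n x" for n
    proof -
      have "(- ((x*\<xi>)\<^sup>2/4)) ^ n = (- (\<xi>\<^sup>2/4))^n * x^(2*n)"
      proof -
        have "- ((x*\<xi>)\<^sup>2/4) = - (\<xi>\<^sup>2/4) * x\<^sup>2" by (simp add: power_mult_distrib)
        then show ?thesis by (simp only: power_mult_distrib power_mult)
      qed
      then show ?thesis by (simp add: f_def mult_ac)
    qed
    ultimately show ?thesis by simp
  qed
  have "(\<lambda>n. integral\<^sup>L \<mu> (f n)) sums (\<integral>x. (\<Sum>n. f n x) \<partial>\<mu>)"
  proof (rule sums_integral[OF int])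
    show "AE x in \<mu>. summable (\<lambda>n. norm (f n x))"
    proof (rule AE_I2)
      fix x
      have "summable (\<lambda>n. exp (- t * x\<^sup>2) * norm (bessel_coeff n * (((x*\<xi>)\<^sup>2/4)) ^ n))"
        by (intro summable_mult summable_bessel)
      moreover have "exp (- t * x\<^sup>2) * norm (bessel_coeff n * (((x*\<xi>)\<^sup>2/4)) ^ n) = norm (f n x)" for n
      proof -
        have "(x*\<xi>)\<^sup>2/4 = (\<xi>\<^sup>2/4) * x\<^sup>2" by (simp add: power_mult_distrib)
        then have "((x*\<xi>)\<^sup>2/4)^n = (\<xi>\<^sup>2/4)^n * x^(2*n)" by (simp only: power_mult_distrib power_mult)
        then show ?thesis using bessel_coeff_pos[of n] unfolding nf by (simp add: abs_mult)
      qed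
      ultimately show "summable (\<lambda>n. norm (f n x))" by (simp only:)
    qed
    have "summable (\<lambda>n. (2*t) powr (-(\<alpha>+1)) * ((\<xi>\<^sup>2/(4*t))^n / fact n))"
      using summable_exp[of "\<xi>\<^sup>2/(4*t)"] by (intro summable_mult) (simp add: field_simps)
    then show "summable (\<lambda>n. \<integral>x. norm (f n x) \<partial>\<mu>)" unfolding Inf .
  qed
  moreover have "(\<Sum>n. f n x) = exp (- t * x\<^sup>2) * j (x * \<xi>)" for x
    using fs by (simp add: sums_iff)
  moreover have "(\<lambda>n. integral\<^sup>L \<mu> (f n)) sums ((2*t) powr (-(\<alpha>+1)) * exp (- \<xi>\<^sup>2 / (4*t)))"
    unfolding If using exp_converges[of "- \<xi>\<^sup>2 / (4*t)"] by (intro sums_mult) (simp add: field_simps)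
  ultimately show ?thesis using sums_unique2 by simp
qed

section \<open>The product formula for the Bessel function\<close>

text \<open>The Chu-Vandermonde identity with upper entries k and the real number alpha + l,
  rewritten in Pochhammer symbols. It is the finite identity behind the product formula.\<close>

lemma bessel_coeff_Vandermonde:
  "(\<Sum>m | m \<le> k \<and> m \<le> l. 1 / (fact m * fact (k-m) * fact (l-m) * pochhammer (\<alpha>+1) m)) =
     pochhammer (\<alpha>+1) (k+l) / (fact k * fact l * pochhammer (\<alpha>+1) k * pochhammer (\<alpha>+1) l)"
proof -
  have V: "(\<Sum>m=0..l. (real k gchoose m) * ((\<alpha> + real l) gchoose (l - m))) = (real k + (\<alpha> + real l)) gchoose l"
    by (rule gbinomial_Vandermonde)
  have g: "(\<alpha> + real l) gchoose (l - m) = pochhammer (\<alpha>+1) l / (pochhammer (\<alpha>+1) m * fact (l - m))" if "m \<le> l" for m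
  proof -
    have "\<alpha> + real l - real (l - m) + 1 = \<alpha> + 1 + real m" using that by (simp add: of_nat_diff)
    then have "(\<alpha> + real l) gchoose (l - m) = pochhammer (\<alpha> + 1 + real m) (l - m) / fact (l - m)"
      unfolding gbinomial_pochhammer' by (simp only:)
    then show ?thesis using pochhammer_alpha_pos[of m] unfolding pochhammer_product[OF that, of "\<alpha>+1"]
      by simp
  qed
  have r: "(real k + (\<alpha> + real l)) gchoose l = pochhammer (\<alpha>+1) (k+l) / (pochhammer (\<alpha>+1) k * fact l)"
  proof -
    have "real k + (\<alpha> + real l) - real l + 1 = \<alpha> + 1 + real k" by simp
    then have "(real k + (\<alpha> + real l)) gchoose l = pochhammer (\<alpha> + 1 + real k) l / fact l"
      unfolding gbinomial_pochhammer' by (simp only:)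
    then show ?thesis using pochhammer_alpha_pos[of k] unfolding pochhammer_product'[of "\<alpha>+1" k l]
      by simp
  qed
  have "(\<Sum>m | m \<le> k \<and> m \<le> l. 1 / (fact m * fact (k-m) * fact (l-m) * pochhammer (\<alpha>+1) m)) =
    (\<Sum>m | m \<le> k \<and> m \<le> l. (real k gchoose m) * ((\<alpha> + real l) gchoose (l - m)) / (fact k * pochhammer (\<alpha>+1) l))"
  proof (rule sum.cong[OF refl])
    fix m assume "m \<in> {m. m \<le> k \<and> m \<le> l}"
    then have m: "m \<le> k" "m \<le> l" by auto
    have "real k gchoose m = fact k / (fact m * fact (k - m))"
      using m by (subst binomial_gbinomial[symmetric]) (simp add: binomial_fact)
    then show "1 / (fact m * fact (k-m) * fact (l-m) * pochhammer (\<alpha>+1) m) = (real k gchoose m) * ((\<alpha> + real l) gchoose (l - m)) / (fact k * pochhammer (\<alpha>+1) l)"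
      using pochhammer_alpha_pos[of l] unfolding g[OF m(2)] by simp
  qed
  \<comment> \<open>Binomial coefficients vanish for m > k, so the range may be enlarged to all m up
    to l.\<close>
  also have "\<dots> = (\<Sum>m=0..l. (real k gchoose m) * ((\<alpha> + real l) gchoose (l - m)) / (fact k * pochhammer (\<alpha>+1) l))"
    by (rule sum.mono_neutral_left) (auto simp: binomial_gbinomial[symmetric] binomial_eq_0)
  also have "\<dots> = (pochhammer (\<alpha>+1) (k+l) / (pochhammer (\<alpha>+1) k * fact l)) / (fact k * pochhammer (\<alpha>+1) l)"
    by (simp add: sum_divide_distrib[symmetric] V r)
  finally show ?thesis by (simp add: mult_ac)
qed

text \<open>Only the even powers (2pq cos theta)^(2m) survive the average; those contributing to
  (p^2)^k (q^2)^(n-k) are indexed by m and summed by \<open>bessel_coeff_Vandermonde\<close>. The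
  right side is the n-th term of a Cauchy product.\<close>

lemma integral_hyp_power:
  "bessel_coeff n * (\<integral>\<theta>. (p\<^sup>2 + q\<^sup>2 + 2*p*q*cos \<theta>)^n \<partial>angle_measure) =
    (\<Sum>k\<le>n. (bessel_coeff k * (p\<^sup>2)^k) * (bessel_coeff (n-k) * (q\<^sup>2)^(n-k)))"
proof -
  define E where "E i = (\<integral>\<theta>. cos \<theta> ^ i \<partial>angle_measure)" for i
  have intc: "integrable angle_measure (\<lambda>\<theta>. cos \<theta> ^ i)" for i
    by (rule integrable_angle_bounded[of _ 1]) (auto simp: power_abs power_le_one)
  define T where "T i l = of_nat (n choose i) * (2*p*q)^i * E i * (of_nat ((n-i) choose l) * (p\<^sup>2)^l * (q\<^sup>2)^(n-i-l))" for i l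
  have "(p\<^sup>2 + q\<^sup>2 + 2*p*q*cos \<theta>)^n = (\<Sum>i\<le>n. of_nat (n choose i) * (2*p*q)^i * (p\<^sup>2 + q\<^sup>2)^(n-i) * cos \<theta> ^ i)" for \<theta>
    by (subst add.commute, subst binomial_ring) (simp add: power_mult_distrib mult_ac)
  then have "(\<integral>\<theta>. (p\<^sup>2 + q\<^sup>2 + 2*p*q*cos \<theta>)^n \<partial>angle_measure) = (\<Sum>i\<le>n. of_nat (n choose i) * (2*p*q)^i * (p\<^sup>2 + q\<^sup>2)^(n-i) * E i)"
    using intc by (simp add: E_def)
  also have "\<dots> = (\<Sum>i\<le>n. \<Sum>l\<le>n-i. T i l)"
    by (subst binomial_ring) (simp add: T_def sum_distrib_left sum_distrib_right mult_ac)
  also have "\<dots> = (\<Sum>(i,l)\<in>Sigma {..n} (\<lambda>i. {..n-i}). T i l)"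
    by (rule sum.Sigma) auto
  also have "\<dots> = (\<Sum>(i,l)\<in>{(i,l). i + l \<le> n \<and> even i}. T i l)"
    by (rule sum.mono_neutral_right) (auto simp: T_def E_def integral_cos_power split: if_splits)
  \<comment> \<open>The mixed term to the power i = 2m supplies m factors p^2 and m factors q^2, so
    the total exponent of p^2 is k = m + l.\<close>
  also have "\<dots> = (\<Sum>(k,m)\<in>Sigma {..n} (\<lambda>k. {m. m \<le> k \<and> m \<le> n-k}). T (2*m) (k-m))"
    by (rule sum.reindex_bij_witness[of _ "\<lambda>(k,m). (2*m, k-m)" "\<lambda>(i,l). (i div 2 + l, i div 2)"])
       (auto elim!: evenE)
  also have "\<dots> = (\<Sum>k\<le>n. \<Sum>m | m \<le> k \<and> m \<le> n-k. T (2*m) (k-m))"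
    by (rule sum.Sigma[symmetric]) auto
  also have "\<dots> = (\<Sum>k\<le>n. bessel_coeff k * bessel_coeff (n-k) / bessel_coeff n * ((p\<^sup>2)^k * (q\<^sup>2)^(n-k)))"
  proof (rule sum.cong[OF refl])
    fix k assume "k \<in> {..n}"
    then have k: "k \<le> n" by simp
    have "(\<Sum>m | m \<le> k \<and> m \<le> n-k. T (2*m) (k-m)) =
      (\<Sum>m | m \<le> k \<and> m \<le> n-k. fact n * ((p\<^sup>2)^k * (q\<^sup>2)^(n-k)) * (1 / (fact m * fact (k-m) * fact (n-k-m) * pochhammer (\<alpha>+1) m)))"
    proof (rule sum.cong[OF refl])
      fix m assume "m \<in> {m. m \<le> k \<and> m \<le> n-k}"
      then have m: "m \<le> k" "m \<le> n-k" "2*m \<le> n" "k-m \<le> n-2*m" and e: "n-2*m-(k-m) = n-k-m" using k by auto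
      have 1: "real (n choose (2*m)) = fact n / (2^(2*m) * pochhammer (1/2) m * fact m * fact (n-2*m))"
        using binomial_fact[OF m(3), where 'a=real] by (simp add: fact_double)
      have 2: "real ((n-2*m) choose (k-m)) = fact (n-2*m) / (fact (k-m) * fact (n-k-m))"
        using binomial_fact[OF m(4), where 'a=real] by (simp only: e)
      have 3: "E (2*m) = pochhammer (1/2) m / pochhammer (\<alpha>+1) m" by (simp add: E_def integral_cos_power)
      have "(2*p*q)^(2*m) = 2^(2*m) * ((p\<^sup>2)^m * (q\<^sup>2)^m)" by (simp add: power_mult_distrib power_mult)
      moreover have "(p\<^sup>2)^m * (p\<^sup>2)^(k-m) = (p\<^sup>2)^k" "(q\<^sup>2)^m * (q\<^sup>2)^(n-k-m) = (q\<^sup>2)^(n-k)"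
        using m by (auto simp flip: power_add)
      moreover have "(2*p*q)^(2*m) * ((p\<^sup>2)^(k-m) * (q\<^sup>2)^(n-k-m)) =
          2^(2*m) * (((p\<^sup>2)^m * (p\<^sup>2)^(k-m)) * ((q\<^sup>2)^m * (q\<^sup>2)^(n-k-m)))"
        unfolding calculation(1) by (simp only: mult_ac)
      ultimately have 4: "(2*p*q)^(2*m) * ((p\<^sup>2)^(k-m) * (q\<^sup>2)^(n-k-m)) = 2^(2*m) * ((p\<^sup>2)^k * (q\<^sup>2)^(n-k))"
        by (simp only:)
      \<comment> \<open>With P = 2^(2m), h = (1/2)_m and F = (n - 2m)! this is the cancellation
        between the two binomial coefficients, the cosine moment and the mixed power.\<close>
      have aux: "N/(P*h*a*F) * (h/b) * (F/(c*d)) * (P*X) = N*X*(1/(a*c*d*b))"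
        if "P \<noteq> 0" "h \<noteq> 0" "F \<noteq> 0" for N P h a F b c d X :: real using that by simp
      have "T (2*m) (k-m) = real (n choose (2*m)) * E (2*m) * real ((n-2*m) choose (k-m)) * ((2*p*q)^(2*m) * ((p\<^sup>2)^(k-m) * (q\<^sup>2)^(n-k-m)))"
        unfolding T_def e by (simp add: mult_ac)
      also have "\<dots> = fact n * ((p\<^sup>2)^k * (q\<^sup>2)^(n-k)) * (1 / (fact m * fact (k-m) * fact (n-k-m) * pochhammer (\<alpha>+1) m))"
        unfolding 1 2 3 4 using pochhammer_pos[of "1/2::real" m] by (intro aux) auto
      finally show "T (2*m) (k-m) = fact n * ((p\<^sup>2)^k * (q\<^sup>2)^(n-k)) * (1 / (fact m * fact (k-m) * fact (n-k-m) * pochhammer (\<alpha>+1) m))" .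
    qed
    also have "\<dots> = fact n * ((p\<^sup>2)^k * (q\<^sup>2)^(n-k)) * (pochhammer (\<alpha>+1) (k+(n-k)) / (fact k * fact (n-k) * pochhammer (\<alpha>+1) k * pochhammer (\<alpha>+1) (n-k)))"
      by (subst bessel_coeff_Vandermonde[symmetric]) (simp add: sum_distrib_left)
    also have "\<dots> = bessel_coeff k * bessel_coeff (n-k) / bessel_coeff n * ((p\<^sup>2)^k * (q\<^sup>2)^(n-k))"
      using k by (simp add: bessel_coeff_def mult_ac)
    finally show "(\<Sum>m | m \<le> k \<and> m \<le> n-k. T (2*m) (k-m)) = \<dots>" .
  qed
  finally show ?thesis using bessel_coeff_pos[of n] by (simp add: sum_distrib_left mult_ac)
qed

lemma hyp_nonneg: "(x::real)\<^sup>2 + y\<^sup>2 + 2*x*y*cos \<theta> \<ge> 0"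
proof -
  have "x\<^sup>2 + y\<^sup>2 + 2*x*y*cos \<theta> = (x + y * cos \<theta>)\<^sup>2 + (y * sin \<theta>)\<^sup>2"
    by (simp add: power2_sum power_mult_distrib sin_squared_eq algebra_simps)
  then show ?thesis by simp
qed

lemma hyp_square: "(hyp x y \<theta>)\<^sup>2 = x\<^sup>2 + y\<^sup>2 + 2*x*y*cos \<theta>"
  unfolding hyp_def by (rule real_sqrt_pow2[OF hyp_nonneg])

text \<open>The function \<open>hyp\<close> enters \<open>j\<close> only through its square, so both
  sides are power series; by \<open>integral_hyp_power\<close> the average of the n-th term over
  theta is the n-th term of the Cauchy product of the two Bessel series.\<close>

lemma bessel_product_formula:
  "(\<integral>\<theta>. j (hyp x y \<theta> * \<xi>) \<partial>angle_measure) = j (x * \<xi>) * j (y * \<xi>)"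
proof -
  define p q where "p = x * \<xi>" and "q = y * \<xi>"
  define V where "V \<theta> = p\<^sup>2 + q\<^sup>2 + 2*p*q*cos \<theta>" for \<theta>
  have V: "V \<theta> = (hyp x y \<theta> * \<xi>)\<^sup>2" for \<theta>
    by (simp add: V_def p_def q_def power_mult_distrib hyp_square) (simp add: algebra_simps power2_eq_square)
  \<comment> \<open>Upper bound for \<open>V\<close> over all angles; the Bessel series at R/4 then
    majorises every term uniformly in theta.\<close>
  define R where "R = (\<bar>p\<bar> + \<bar>q\<bar>)\<^sup>2"
  have V0: "0 \<le> V \<theta>" for \<theta> by (simp add: V)
  have VR: "V \<theta> \<le> R" for \<theta>
  proof -
    have "p*q*cos \<theta> \<le> \<bar>p*q*cos \<theta>\<bar>" by simp
    also have "\<dots> \<le> \<bar>p\<bar>*\<bar>q\<bar>*1" unfolding abs_mult by (intro mult_mono) auto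
    finally show ?thesis by (simp add: V_def R_def power2_sum)
  qed
  define f where "f n \<theta> = bessel_coeff n * (- (V \<theta> / 4))^n" for n \<theta>
  have nf: "norm (f n \<theta>) \<le> norm (bessel_coeff n * (R/4)^n)" for n \<theta>
  proof -
    have "norm (f n \<theta>) = bessel_coeff n * (V \<theta> / 4)^n"
      using bessel_coeff_pos[of n] V0[of \<theta>] by (simp add: f_def abs_mult power_abs)
    also have "\<dots> \<le> bessel_coeff n * (R/4)^n"
      using bessel_coeff_pos[of n] V0[of \<theta>] VR[of \<theta>] by (intro mult_left_mono power_mono) auto
    finally show ?thesis by simp
  qed
  have [measurable]: "f n \<in> borel_measurable borel" for n unfolding f_def V_def by measurable
  have int: "integrable angle_measure (f n)" for n
    by (rule integrable_angle_bounded[OF _ nf]) measurable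
  have "(\<lambda>n. integral\<^sup>L angle_measure (f n)) sums (\<integral>\<theta>. (\<Sum>n. f n \<theta>) \<partial>angle_measure)"
  proof (rule sums_integral[OF int])
    show "AE \<theta> in angle_measure. summable (\<lambda>n. norm (f n \<theta>))"
      by (intro AE_I2 summable_comparison_test'[OF summable_bessel[of "R/4"], of 0]) (use nf in auto)
    show "summable (\<lambda>n. \<integral>\<theta>. norm (f n \<theta>) \<partial>angle_measure)"
    proof (rule summable_comparison_test'[OF summable_bessel[of "R/4"], of 0])
      fix n
      have "(\<integral>\<theta>. norm (f n \<theta>) \<partial>angle_measure) \<le> (\<integral>\<theta>. norm (bessel_coeff n * (R/4)^n) \<partial>angle_measure)"
        using int nf by (intro integral_mono) auto
      then show "norm (\<integral>\<theta>. norm (f n \<theta>) \<partial>angle_measure) \<le> norm (bessel_coeff n * (R/4)^n)" by simp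
    qed
  qed
  moreover have "(\<Sum>n. f n \<theta>) = j (hyp x y \<theta> * \<xi>)" for \<theta>
    unfolding f_def V bessel_j_eq_series bessel_series_def ..
  moreover have "integral\<^sup>L angle_measure (f n) = (\<Sum>k\<le>n. (bessel_coeff k * (-(p\<^sup>2/4))^k) * (bessel_coeff (n-k) * (-(q\<^sup>2/4))^(n-k)))" for n
  proof -
    have c: "(-(z/4))^m = (-1/4)^m * z^m" for z :: real and m
      by (simp add: power_mult_distrib[symmetric])
    have "integral\<^sup>L angle_measure (f n) = (-1/4)^n * (bessel_coeff n * (\<integral>\<theta>. V \<theta> ^ n \<partial>angle_measure))"
      unfolding f_def c by simp
    also have "\<dots> = (-1/4)^n * (\<Sum>k\<le>n. (bessel_coeff k * (p\<^sup>2)^k) * (bessel_coeff (n-k) * (q\<^sup>2)^(n-k)))"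
      unfolding V_def integral_hyp_power ..
    also have "\<dots> = (\<Sum>k\<le>n. (bessel_coeff k * (-(p\<^sup>2/4))^k) * (bessel_coeff (n-k) * (-(q\<^sup>2/4))^(n-k)))"
      unfolding c sum_distrib_left
    proof (rule sum.cong[OF refl])
      fix k assume "k \<in> {..n}"
      then have "(-1/4::real)^n = (-1/4)^k * (-1/4)^(n-k)" by (simp flip: power_add)
      then show "(-1/4)^n * ((bessel_coeff k * (p\<^sup>2)^k) * (bessel_coeff (n-k) * (q\<^sup>2)^(n-k))) =
         (bessel_coeff k * ((-1/4)^k * (p\<^sup>2)^k)) * (bessel_coeff (n-k) * ((-1/4)^(n-k) * (q\<^sup>2)^(n-k)))" by simp
    qed
    finally show ?thesis .
  qed
  moreover have "(\<lambda>n. \<Sum>k\<le>n. (bessel_coeff k * (-(p\<^sup>2/4))^k) * (bessel_coeff (n-k) * (-(q\<^sup>2/4))^(n-k))) sums (j p * j q)"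
    unfolding bessel_j_eq_series bessel_series_def
    by (rule Cauchy_product_sums[OF summable_bessel summable_bessel])
  ultimately show ?thesis using sums_unique2 by (simp add: p_def q_def)
qed

section \<open>Translation, transform and heat kernel\<close>

lemma measurable_cnj [measurable]: "cnj \<in> borel_measurable borel"
  by (intro borel_measurable_continuous_onI continuous_intros)

lemma mu_Fubini:
  fixes F :: "real \<Rightarrow> real \<Rightarrow> 'b::{banach, second_countable_topology}"
  assumes [measurable]: "case_prod F \<in> borel_measurable (borel \<Otimes>\<^sub>M borel)"
    and fin: "(\<integral>\<^sup>+x. \<integral>\<^sup>+y. ennreal (norm (F x y)) \<partial>\<mu> \<partial>\<mu>) < \<infinity>"
  shows "integrable (\<mu> \<Otimes>\<^sub>M \<mu>) (case_prod F)"
    and "(\<integral>x. \<integral>y. F x y \<partial>\<mu> \<partial>\<mu>) = (\<integral>y. \<integral>x. F x y \<partial>\<mu> \<partial>\<mu>)"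
proof -
  show int: "integrable (\<mu> \<Otimes>\<^sub>M \<mu>) (case_prod F)"
  proof (rule integrableI_bounded)
    show "case_prod F \<in> borel_measurable (\<mu> \<Otimes>\<^sub>M \<mu>)" by measurable
    have "(\<integral>\<^sup>+z. ennreal (norm (case_prod F z)) \<partial>(\<mu> \<Otimes>\<^sub>M \<mu>)) = (\<integral>\<^sup>+x. \<integral>\<^sup>+y. ennreal (norm (F x y)) \<partial>\<mu> \<partial>\<mu>)"
      by (subst mu.nn_integral_fst[symmetric]) auto
    then show "(\<integral>\<^sup>+z. ennreal (norm (case_prod F z)) \<partial>(\<mu> \<Otimes>\<^sub>M \<mu>)) < \<infinity>" using fin by simp
  qed
  show "(\<integral>x. \<integral>y. F x y \<partial>\<mu> \<partial>\<mu>) = (\<integral>y. \<integral>x. F x y \<partial>\<mu> \<partial>\<mu>)"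
    using mm.Fubini_integral[OF int] by simp
qed

lemma mu_angle_Fubini:
  fixes F :: "real \<Rightarrow> real \<Rightarrow> 'b::{banach, second_countable_topology}"
  assumes [measurable]: "case_prod F \<in> borel_measurable (borel \<Otimes>\<^sub>M borel)"
    and fin: "(\<integral>\<^sup>+x. \<integral>\<^sup>+\<theta>. ennreal (norm (F x \<theta>)) \<partial>angle_measure \<partial>\<mu>) < \<infinity>"
  shows "integrable (\<mu> \<Otimes>\<^sub>M angle_measure) (case_prod F)"
    and "(\<integral>x. \<integral>\<theta>. F x \<theta> \<partial>angle_measure \<partial>\<mu>) = (\<integral>\<theta>. \<integral>x. F x \<theta> \<partial>\<mu> \<partial>angle_measure)"
    and "(\<integral>x. \<integral>\<theta>. F x \<theta> \<partial>angle_measure \<partial>\<mu>) = (\<integral>z. case_prod F z \<partial>(\<mu> \<Otimes>\<^sub>M angle_measure))"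
proof -
  show int: "integrable (\<mu> \<Otimes>\<^sub>M angle_measure) (case_prod F)"
  proof (rule integrableI_bounded)
    show "case_prod F \<in> borel_measurable (\<mu> \<Otimes>\<^sub>M angle_measure)" by measurable
    have "(\<integral>\<^sup>+z. ennreal (norm (case_prod F z)) \<partial>(\<mu> \<Otimes>\<^sub>M angle_measure)) = (\<integral>\<^sup>+x. \<integral>\<^sup>+\<theta>. ennreal (norm (F x \<theta>)) \<partial>angle_measure \<partial>\<mu>)"
      by (subst ang.nn_integral_fst[symmetric]) auto
    then show "(\<integral>\<^sup>+z. ennreal (norm (case_prod F z)) \<partial>(\<mu> \<Otimes>\<^sub>M angle_measure)) < \<infinity>" using fin by simp
  qed
  show "(\<integral>x. \<integral>\<theta>. F x \<theta> \<partial>angle_measure \<partial>\<mu>) = (\<integral>\<theta>. \<integral>x. F x \<theta> \<partial>\<mu> \<partial>angle_measure)"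
    using ma.Fubini_integral[OF int] by simp
  show "(\<integral>x. \<integral>\<theta>. F x \<theta> \<partial>angle_measure \<partial>\<mu>) = (\<integral>z. case_prod F z \<partial>(\<mu> \<Otimes>\<^sub>M angle_measure))"
    using ma.integral_fst'[OF int] by simp
qed

text \<open>Recasting \<open>nn_integral_hyp_swap\<close> as an equality of image measures lets it
  carry over to Bochner integrals through \<open>integral_distr\<close>.\<close>

lemma distr_hyp_swap:
  "distr (\<mu> \<Otimes>\<^sub>M angle_measure) (borel \<Otimes>\<^sub>M borel) (\<lambda>(x,\<theta>). (x, hyp t x \<theta>)) =
   distr (\<mu> \<Otimes>\<^sub>M angle_measure) (borel \<Otimes>\<^sub>M borel) (\<lambda>(x,\<theta>). (hyp t x \<theta>, x))" (is "?L = ?R")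
proof (rule measure_eqI)
  fix A assume "A \<in> sets ?L"
  then have [measurable]: "A \<in> sets (borel \<Otimes>\<^sub>M borel)" by simp
  have "emeasure ?L A = (\<integral>\<^sup>+z. indicator A z \<partial>?L)" by simp
  also have "\<dots> = (\<integral>\<^sup>+x. \<integral>\<^sup>+\<theta>. indicator A (x, hyp t x \<theta>) \<partial>angle_measure \<partial>\<mu>)"
    by (subst nn_integral_distr, measurable, subst ang.nn_integral_fst[symmetric]) (auto simp: split_beta')
  also have "\<dots> = (\<integral>\<^sup>+x. \<integral>\<^sup>+\<theta>. indicator A (hyp t x \<theta>, x) \<partial>angle_measure \<partial>\<mu>)"
    by (rule nn_integral_hyp_swap) measurable
  also have "\<dots> = (\<integral>\<^sup>+z. indicator A z \<partial>?R)"
    by (subst nn_integral_distr, measurable, subst ang.nn_integral_fst[symmetric]) (auto simp: split_beta')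
  also have "\<dots> = emeasure ?R A" by simp
  finally show "emeasure ?L A = emeasure ?R A" .
qed simp

lemma integral_hyp_swap:
  fixes \<Psi> :: "real \<Rightarrow> real \<Rightarrow> 'b::{banach, second_countable_topology}"
  assumes [measurable]: "case_prod \<Psi> \<in> borel_measurable (borel \<Otimes>\<^sub>M borel)"
    and fin: "(\<integral>\<^sup>+x. \<integral>\<^sup>+\<theta>. ennreal (norm (\<Psi> x (hyp t x \<theta>))) \<partial>angle_measure \<partial>\<mu>) < \<infinity>"
  shows "(\<integral>x. \<integral>\<theta>. \<Psi> x (hyp t x \<theta>) \<partial>angle_measure \<partial>\<mu>) = (\<integral>x. \<integral>\<theta>. \<Psi> (hyp t x \<theta>) x \<partial>angle_measure \<partial>\<mu>)"
proof -
  have fin': "(\<integral>\<^sup>+x. \<integral>\<^sup>+\<theta>. ennreal (norm (\<Psi> (hyp t x \<theta>) x)) \<partial>angle_measure \<partial>\<mu>) < \<infinity>"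
    using fin by (subst (asm) nn_integral_hyp_swap) auto
  have "(\<integral>x. \<integral>\<theta>. \<Psi> x (hyp t x \<theta>) \<partial>angle_measure \<partial>\<mu>) =
     (\<integral>z. case_prod \<Psi> z \<partial>distr (\<mu> \<Otimes>\<^sub>M angle_measure) (borel \<Otimes>\<^sub>M borel) (\<lambda>(x,\<theta>). (x, hyp t x \<theta>)))"
    by (subst mu_angle_Fubini(3)[OF _ fin], measurable, subst integral_distr) (auto simp: split_beta')
  also have "\<dots> = (\<integral>x. \<integral>\<theta>. \<Psi> (hyp t x \<theta>) x \<partial>angle_measure \<partial>\<mu>)"
    unfolding distr_hyp_swap
    by (subst mu_angle_Fubini(3)[OF _ fin'], measurable, subst integral_distr) (auto simp: split_beta')
  finally show ?thesis .
qed

abbreviation "H \<equiv> hankel_L1 \<alpha>"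

lemma H_measurable [measurable]:
  assumes [measurable]: "f \<in> borel_measurable borel"
  shows "H f \<in> borel_measurable borel"
  unfolding hankel_L1_def[abs_def] by measurable

lemma integrable_mu_measurable: "integrable \<mu> f \<Longrightarrow> f \<in> borel_measurable borel"
  by (drule borel_measurable_integrable) (simp cong: measurable_cong_sets)

lemma integrable_bessel:
  fixes f :: "real \<Rightarrow> complex"
  assumes "integrable \<mu> f"
  shows "integrable \<mu> (\<lambda>x. f x * complex_of_real (j (x * \<xi>)))"
proof (rule Bochner_Integration.integrable_bound[OF assms])
  have [measurable]: "f \<in> borel_measurable borel" by (rule integrable_mu_measurable[OF assms])
  show "(\<lambda>x. f x * complex_of_real (j (x * \<xi>))) \<in> borel_measurable \<mu>" by measurable
  show "AE x in \<mu>. norm (f x * complex_of_real (j (x * \<xi>))) \<le> norm (f x)"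
    by (intro AE_I2) (auto simp: norm_mult intro!: mult_left_le bessel_j_le_1)
qed

lemma H_bound: "integrable \<mu> f \<Longrightarrow> norm (H f \<xi>) \<le> (\<integral>x. norm (f x) \<partial>\<mu>)"
  unfolding hankel_L1_def
  by (rule order.trans[OF integral_norm_bound], intro integral_mono integrable_norm integrable_bessel)
     (auto simp: norm_mult intro!: mult_left_le bessel_j_le_1)

lemma H_diff:
  assumes "integrable \<mu> f" "integrable \<mu> g"
  shows "H (\<lambda>x. f x - g x) \<xi> = H f \<xi> - H g \<xi>"
  unfolding hankel_L1_def by (simp add: left_diff_distrib Bochner_Integration.integral_diff integrable_bessel assms)

lemma H_cnj: "H (\<lambda>x. cnj (f x)) \<xi> = cnj (H f \<xi>)"
  unfolding hankel_L1_def by (subst Bochner_Integration.integral_cnj[symmetric]) simp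

text \<open>Fubini's theorem applies because the kernel j(x xi) is symmetric in its two variables
  and bounded by 1. \<open>heat_form\<close> uses this twice.\<close>

lemma multiplication_formula:
  fixes f \<phi> :: "real \<Rightarrow> complex"
  assumes f: "integrable \<mu> f" and \<phi>: "integrable \<mu> \<phi>"
  shows "(\<integral>\<xi>. \<phi> \<xi> * H f \<xi> \<partial>\<mu>) = (\<integral>x. f x * H \<phi> x \<partial>\<mu>)"
proof -
  have [measurable]: "f \<in> borel_measurable borel" "\<phi> \<in> borel_measurable borel"
    by (intro integrable_mu_measurable f \<phi>)+
  define F where "F x \<xi> = f x * (\<phi> \<xi> * complex_of_real (j (x * \<xi>)))" for x \<xi>
  have [measurable]: "case_prod F \<in> borel_measurable (borel \<Otimes>\<^sub>M borel)" unfolding F_def by measurable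
  have "(\<integral>\<^sup>+x. \<integral>\<^sup>+\<xi>. ennreal (norm (F x \<xi>)) \<partial>\<mu> \<partial>\<mu>) \<le> (\<integral>\<^sup>+x. \<integral>\<^sup>+\<xi>. ennreal (norm (f x)) * ennreal (norm (\<phi> \<xi>)) \<partial>\<mu> \<partial>\<mu>)"
    by (intro nn_integral_mono)
       (auto simp: F_def norm_mult ennreal_mult[symmetric] intro!: ennreal_leI mult_left_mono mult_left_le bessel_j_le_1)
  also have "\<dots> = (\<integral>\<^sup>+x. ennreal (norm (f x)) \<partial>\<mu>) * (\<integral>\<^sup>+\<xi>. ennreal (norm (\<phi> \<xi>)) \<partial>\<mu>)"
    by (simp add: nn_integral_cmult nn_integral_multc)
  also have "\<dots> < \<infinity>" using f \<phi> by (simp add: integrable_iff_bounded ennreal_mult_less_top)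
  finally have fin: "(\<integral>\<^sup>+x. \<integral>\<^sup>+\<xi>. ennreal (norm (F x \<xi>)) \<partial>\<mu> \<partial>\<mu>) < \<infinity>" .
  have "(\<integral>x. f x * H \<phi> x \<partial>\<mu>) = (\<integral>x. \<integral>\<xi>. F x \<xi> \<partial>\<mu> \<partial>\<mu>)"
    unfolding F_def hankel_L1_def by (simp add: mult.commute)
  also have "\<dots> = (\<integral>\<xi>. \<integral>x. F x \<xi> \<partial>\<mu> \<partial>\<mu>)" by (rule mu_Fubini(2)[OF _ fin]) measurable
  also have "\<dots> = (\<integral>\<xi>. \<phi> \<xi> * H f \<xi> \<partial>\<mu>)"
    unfolding F_def hankel_L1_def
    by (intro Bochner_Integration.integral_cong refl, subst integral_mult_right_zero[symmetric]) (simp add: mult_ac)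
  finally show ?thesis by simp
qed

text \<open>The operator \<open>hankel_transl\<close> as an average over the angle measure,
  polymorphic so that it covers the real heat kernel as well as complex functions.\<close>

definition transl :: "(real \<Rightarrow> 'b::{banach, second_countable_topology}) \<Rightarrow> real \<Rightarrow> real \<Rightarrow> 'b" where
  "transl f x y = (\<integral>\<theta>. f (hyp x y \<theta>) \<partial>angle_measure)"

lemma transl_commute: "transl f x y = transl f y x"
  by (simp add: transl_def hyp_commute)

lemma hankel_transl_eq:
  assumes [measurable]: "f \<in> borel_measurable borel"
  shows "hankel_transl \<alpha> x f y = transl f x y"
proof -
  have "transl f x y = (\<integral>\<theta>. (indicator {0..pi} \<theta> * (angle_const * sin \<theta> powr (2*\<alpha>))) *\<^sub>R f (hyp x y \<theta>) \<partial>lborel)"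
    unfolding transl_def angle_measure_def using angle_const_pos
    by (subst integral_density) auto
  also have "\<dots> = (\<integral>\<theta>. complex_of_real angle_const * (indicator {0..pi} \<theta> *\<^sub>R (f (hyp x y \<theta>) * complex_of_real (sin \<theta> powr (2*\<alpha>)))) \<partial>lborel)"
    by (intro Bochner_Integration.integral_cong) (auto simp: indicator_def scaleR_conv_of_real)
  also have "\<dots> = hankel_transl \<alpha> x f y"
    unfolding hankel_transl_def set_lebesgue_integral_def hyp_def angle_const_def[symmetric]
    by (rule integral_mult_right_zero)
  finally show ?thesis ..
qed

lemma transl_measurable [measurable]:
  assumes [measurable]: "f \<in> borel_measurable borel"
  shows "(\<lambda>(x,y). transl f x y) \<in> borel_measurable (borel \<Otimes>\<^sub>M borel)"
  unfolding transl_def by measurable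

lemma norm_transl_le:
  fixes f :: "real \<Rightarrow> 'b::{banach, second_countable_topology}"
  assumes [measurable]: "f \<in> borel_measurable borel"
  shows "ennreal (norm (transl f x y)) \<le> (\<integral>\<^sup>+\<theta>. ennreal (norm (f (hyp x y \<theta>))) \<partial>angle_measure)"
\<comment> \<open>If the average does not exist, \<open>transl\<close> is 0 by the convention for
  the Bochner integral and the bound is trivial.\<close>
proof (cases "integrable angle_measure (\<lambda>\<theta>. f (hyp x y \<theta>))")
  case True
  then show ?thesis unfolding transl_def by (rule integral_norm_bound_ennreal)
qed (simp add: transl_def not_integrable_integral_eq)

text \<open>Swapping moves a function of \<open>hyp\<close> alone to a function of y alone, on which
  the angle average has mass 1.\<close>

lemma nn_integral_hyp:
  assumes [measurable]: "f \<in> borel_measurable borel"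
  shows "(\<integral>\<^sup>+y. \<integral>\<^sup>+\<theta>. f (hyp x y \<theta>) \<partial>angle_measure \<partial>\<mu>) = (\<integral>\<^sup>+y. f y \<partial>\<mu>)"
  using nn_integral_hyp_swap[of "\<lambda>y z. f z" x] by simp

lemma transl_L1:
  fixes f :: "real \<Rightarrow> 'b::{banach, second_countable_topology}"
  assumes [measurable]: "f \<in> borel_measurable borel"
  shows "(\<integral>\<^sup>+y. ennreal (norm (transl f x y)) \<partial>\<mu>) \<le> (\<integral>\<^sup>+y. ennreal (norm (f y)) \<partial>\<mu>)"
proof -
  have "(\<integral>\<^sup>+y. ennreal (norm (transl f x y)) \<partial>\<mu>) \<le> (\<integral>\<^sup>+y. \<integral>\<^sup>+\<theta>. ennreal (norm (f (hyp x y \<theta>))) \<partial>angle_measure \<partial>\<mu>)"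
    by (intro nn_integral_mono norm_transl_le) measurable
  also have "\<dots> = (\<integral>\<^sup>+y. ennreal (norm (f y)) \<partial>\<mu>)" by (rule nn_integral_hyp) measurable
  finally show ?thesis .
qed

text \<open>The swap moves the angle average from f to the Bessel kernel, where the product formula
  evaluates it.\<close>

lemma H_transl:
  assumes f: "integrable \<mu> f"
  shows "H (transl f t) \<xi> = complex_of_real (j (t * \<xi>)) * H f \<xi>"
proof -
  have [measurable]: "f \<in> borel_measurable borel" by (rule integrable_mu_measurable[OF f])
  define \<Psi> where "\<Psi> x z = f z * complex_of_real (j (x * \<xi>))" for x z
  have [measurable]: "case_prod \<Psi> \<in> borel_measurable (borel \<Otimes>\<^sub>M borel)" unfolding \<Psi>_def by measurable
  have "(\<integral>\<^sup>+x. \<integral>\<^sup>+\<theta>. ennreal (norm (\<Psi> x (hyp t x \<theta>))) \<partial>angle_measure \<partial>\<mu>) \<le> (\<integral>\<^sup>+x. \<integral>\<^sup>+\<theta>. ennreal (norm (f (hyp t x \<theta>))) \<partial>angle_measure \<partial>\<mu>)"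
    by (intro nn_integral_mono) (auto simp: \<Psi>_def norm_mult intro!: ennreal_leI mult_left_le bessel_j_le_1)
  also have "\<dots> = (\<integral>\<^sup>+x. ennreal (norm (f x)) \<partial>\<mu>)" by (rule nn_integral_hyp) measurable
  also have "\<dots> < \<infinity>" using f by (simp add: integrable_iff_bounded)
  finally have fin: "(\<integral>\<^sup>+x. \<integral>\<^sup>+\<theta>. ennreal (norm (\<Psi> x (hyp t x \<theta>))) \<partial>angle_measure \<partial>\<mu>) < \<infinity>" .
  have "H (transl f t) \<xi> = (\<integral>x. \<integral>\<theta>. \<Psi> x (hyp t x \<theta>) \<partial>angle_measure \<partial>\<mu>)"
    unfolding hankel_L1_def transl_def \<Psi>_def by simp
  also have "\<dots> = (\<integral>x. \<integral>\<theta>. \<Psi> (hyp t x \<theta>) x \<partial>angle_measure \<partial>\<mu>)"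
    by (rule integral_hyp_swap[OF _ fin]) measurable
  also have "\<dots> = (\<integral>x. f x * complex_of_real (\<integral>\<theta>. j (hyp t x \<theta> * \<xi>) \<partial>angle_measure) \<partial>\<mu>)"
    unfolding \<Psi>_def by simp
  also have "\<dots> = (\<integral>x. complex_of_real (j (t * \<xi>)) * (f x * complex_of_real (j (x * \<xi>))) \<partial>\<mu>)"
    unfolding bessel_product_formula by (simp add: mult_ac)
  also have "\<dots> = complex_of_real (j (t * \<xi>)) * H f \<xi>" unfolding hankel_L1_def by simp
  finally show ?thesis .
qed

section \<open>The heat kernel\<close>

text \<open>The transform of exp (-t xi^2) found in \<open>gaussian_bessel\<close>: the heat kernel
  at the origin, of unit mass with respect to \<open>\<mu>\<close>.\<close>

definition heat_gauss :: "real \<Rightarrow> real \<Rightarrow> real" where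
  "heat_gauss t z = (2*t) powr (-(\<alpha>+1)) * exp (- z\<^sup>2 / (4*t))"

definition heat :: "real \<Rightarrow> real \<Rightarrow> real \<Rightarrow> real" where
  "heat t x y = transl (heat_gauss t) x y"

lemma heat_gauss_measurable [measurable]: "heat_gauss t \<in> borel_measurable borel"
  unfolding heat_gauss_def[abs_def] by measurable

lemma heat_measurable [measurable]: "(\<lambda>(x,y). heat t x y) \<in> borel_measurable (borel \<Otimes>\<^sub>M borel)"
  unfolding heat_def by measurable

lemma heat_gauss_nonneg: "heat_gauss t z \<ge> 0"
  by (simp add: heat_gauss_def)

lemma heat_gauss_le: "t > 0 \<Longrightarrow> heat_gauss t z \<le> (2*t) powr (-(\<alpha>+1))"
  unfolding heat_gauss_def by (rule mult_left_le) auto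

lemma heat_gauss_integrable_angle: "t > 0 \<Longrightarrow> integrable angle_measure (\<lambda>\<theta>. heat_gauss t (hyp x y \<theta>))"
  by (rule integrable_angle_bounded[of _ "(2*t) powr (-(\<alpha>+1))"], measurable,
      subst real_norm_def, subst abs_of_nonneg[OF heat_gauss_nonneg], rule heat_gauss_le)

lemma heat_nonneg [simp]: "heat t x y \<ge> 0"
  unfolding heat_def transl_def by (intro Bochner_Integration.integral_nonneg heat_gauss_nonneg)

lemma heat_commute: "heat t x y = heat t y x"
  unfolding heat_def by (rule transl_commute)

lemma heat_nn: "t > 0 \<Longrightarrow> ennreal (heat t x y) = (\<integral>\<^sup>+\<theta>. ennreal (heat_gauss t (hyp x y \<theta>)) \<partial>angle_measure)"
  unfolding heat_def transl_def
  by (rule nn_integral_eq_integral[symmetric]) (auto intro: heat_gauss_integrable_angle heat_gauss_nonneg)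

lemma nn_integral_heat_gauss:
  assumes t: "t > 0"
  shows "(\<integral>\<^sup>+z. ennreal (heat_gauss t z) \<partial>\<mu>) = 1"
proof -
  have "(\<integral>\<^sup>+z. ennreal (heat_gauss t z) \<partial>\<mu>) = ennreal ((2*t) powr (-(\<alpha>+1))) * (\<integral>\<^sup>+z. ennreal (exp (- (1/(4*t)) * z\<^sup>2)) \<partial>\<mu>)"
    unfolding heat_gauss_def by (subst nn_integral_cmult[symmetric]) (auto simp: ennreal_mult')
  also have "(\<integral>\<^sup>+z. ennreal (exp (- (1/(4*t)) * z\<^sup>2)) \<partial>\<mu>) = ennreal ((2*(1/(4*t))) powr (-(\<alpha>+1)))"
    using nn_integral_gaussian_moment[of "1/(4*t)" 0] t by simp
  also have "ennreal ((2*t) powr (-(\<alpha>+1))) * ennreal ((2*(1/(4*t))) powr (-(\<alpha>+1))) = ennreal ((2*t * (2*(1/(4*t)))) powr (-(\<alpha>+1)))"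
    using t by (subst powr_mult) (auto simp: ennreal_mult')
  also have "2*t * (2*(1/(4*t))) = 1" using t by simp
  finally show ?thesis by simp
qed

lemma nn_integral_heat: "t > 0 \<Longrightarrow> (\<integral>\<^sup>+y. ennreal (heat t x y) \<partial>\<mu>) = 1"
  using nn_integral_hyp[of "\<lambda>z. ennreal (heat_gauss t z)" x] by (simp add: heat_nn nn_integral_heat_gauss)

text \<open>The angle average of j(hyp xi) is a product of two Bessel functions, and
  \<open>gaussian_bessel\<close> evaluates the integral over xi. This exhibits \<open>heat\<close>
  as the kernel of the multiplier exp (-t xi^2).\<close>

lemma heat_eq:
  assumes t: "t > 0"
  shows "heat t x y = (\<integral>\<xi>. exp (- t * \<xi>\<^sup>2) * (j (x * \<xi>) * j (y * \<xi>)) \<partial>\<mu>)"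
proof -
  define F where "F \<xi> \<theta> = exp (- t * \<xi>\<^sup>2) * j (hyp x y \<theta> * \<xi>)" for \<xi> \<theta>
  have [measurable]: "case_prod F \<in> borel_measurable (borel \<Otimes>\<^sub>M borel)" unfolding F_def by measurable
  have "(\<integral>\<^sup>+\<xi>. \<integral>\<^sup>+\<theta>. ennreal (norm (F \<xi> \<theta>)) \<partial>angle_measure \<partial>\<mu>) \<le> (\<integral>\<^sup>+\<xi>. \<integral>\<^sup>+\<theta>. ennreal (exp (- t * \<xi>\<^sup>2)) \<partial>angle_measure \<partial>\<mu>)"
    by (intro nn_integral_mono) (auto simp: F_def abs_mult intro!: ennreal_leI mult_left_le bessel_j_le_1)
  also have "\<dots> < \<infinity>" using gaussian_integrable[OF t] by (simp add: integrable_iff_bounded)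
  finally have fin: "(\<integral>\<^sup>+\<xi>. \<integral>\<^sup>+\<theta>. ennreal (norm (F \<xi> \<theta>)) \<partial>angle_measure \<partial>\<mu>) < \<infinity>" .
  have "(\<integral>\<xi>. exp (- t * \<xi>\<^sup>2) * (j (x * \<xi>) * j (y * \<xi>)) \<partial>\<mu>) = (\<integral>\<xi>. \<integral>\<theta>. F \<xi> \<theta> \<partial>angle_measure \<partial>\<mu>)"
    unfolding F_def bessel_product_formula[symmetric] by simp
  also have "\<dots> = (\<integral>\<theta>. \<integral>\<xi>. F \<xi> \<theta> \<partial>\<mu> \<partial>angle_measure)"
    by (rule mu_angle_Fubini(2)[OF _ fin]) measurable
  also have "\<dots> = heat t x y"
  proof -
    have "(\<integral>\<xi>. F \<xi> \<theta> \<partial>\<mu>) = heat_gauss t (hyp x y \<theta>)" for \<theta>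
      using gaussian_bessel[OF t, of "hyp x y \<theta>"] by (simp add: F_def heat_gauss_def mult.commute)
    then show ?thesis by (simp add: heat_def transl_def)
  qed
  finally show ?thesis ..
qed

lemma heat_le: "t > 0 \<Longrightarrow> heat t x y \<le> (2*t) powr (-(\<alpha>+1))"
proof -
  assume t: "t > 0"
  have "heat t x y \<le> (\<integral>\<theta>. (2*t) powr (-(\<alpha>+1)) \<partial>angle_measure)"
    unfolding heat_def transl_def
    by (intro integral_mono heat_gauss_integrable_angle heat_gauss_le t) auto
  then show ?thesis by simp
qed

text \<open>By \<open>heat_eq\<close> the integral over y becomes the transform of exp (-b y^2), a
  Gaussian in xi with parameter 1/(4b). Its exponent adds to that of the heat multiplier, giving the
  parameter c below, and transforming back yields a Gaussian in x.\<close>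

lemma nn_integral_heat_gaussian:
  assumes t: "t > 0" and b: "b > 0"
  shows "(\<integral>\<^sup>+y. ennreal (heat t x y * exp (- b * y\<^sup>2)) \<partial>\<mu>) =
    ennreal ((1 + 4*b*t) powr (-(\<alpha>+1)) * exp (- b * x\<^sup>2 / (1 + 4*b*t)))"
proof -
  define F where "F y \<xi> = exp (- b * y\<^sup>2) * (exp (- t * \<xi>\<^sup>2) * (j (x * \<xi>) * j (y * \<xi>)))" for y \<xi>
  have [measurable]: "case_prod F \<in> borel_measurable (borel \<Otimes>\<^sub>M borel)" unfolding F_def by measurable
  have jj: "\<bar>j a\<bar> * \<bar>j b\<bar> \<le> 1" for a b using bessel_j_le_1 by (intro mult_le_one) auto
  have "(\<integral>\<^sup>+y. \<integral>\<^sup>+\<xi>. ennreal (norm (F y \<xi>)) \<partial>\<mu> \<partial>\<mu>) \<le> (\<integral>\<^sup>+y. \<integral>\<^sup>+\<xi>. ennreal (exp (- b * y\<^sup>2)) * ennreal (exp (- t * \<xi>\<^sup>2)) \<partial>\<mu> \<partial>\<mu>)"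
    by (intro nn_integral_mono)
       (auto simp: F_def abs_mult ennreal_mult[symmetric] intro!: ennreal_leI mult_left_mono mult_left_le jj)
  also have "\<dots> = (\<integral>\<^sup>+y. ennreal (exp (- b * y\<^sup>2)) \<partial>\<mu>) * (\<integral>\<^sup>+\<xi>. ennreal (exp (- t * \<xi>\<^sup>2)) \<partial>\<mu>)"
    by (simp add: nn_integral_cmult nn_integral_multc)
  also have "\<dots> < \<infinity>" using gaussian_integrable[OF t] gaussian_integrable[OF b]
    by (simp add: integrable_iff_bounded ennreal_mult_less_top)
  finally have fin: "(\<integral>\<^sup>+y. \<integral>\<^sup>+\<xi>. ennreal (norm (F y \<xi>)) \<partial>\<mu> \<partial>\<mu>) < \<infinity>" .
  define c where "c = t + 1/(4*b)"
  have c: "c > 0" using t b by (simp add: c_def add_pos_pos)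
  have "(\<integral>y. heat t x y * exp (- b * y\<^sup>2) \<partial>\<mu>) = (\<integral>y. \<integral>\<xi>. F y \<xi> \<partial>\<mu> \<partial>\<mu>)"
    unfolding F_def heat_eq[OF t] by (simp add: mult.commute)
  also have "\<dots> = (\<integral>\<xi>. \<integral>y. F y \<xi> \<partial>\<mu> \<partial>\<mu>)" by (rule mu_Fubini(2)[OF _ fin]) measurable
  also have "\<dots> = (\<integral>\<xi>. exp (- t * \<xi>\<^sup>2) * j (x * \<xi>) * (\<integral>y. exp (- b * y\<^sup>2) * j (y * \<xi>) \<partial>\<mu>) \<partial>\<mu>)"
    unfolding F_def by (intro Bochner_Integration.integral_cong refl, subst integral_mult_right_zero[symmetric]) (simp add: mult_ac)
  also have "\<dots> = (\<integral>\<xi>. (2*b) powr (-(\<alpha>+1)) * (exp (- c * \<xi>\<^sup>2) * j (\<xi> * x)) \<partial>\<mu>)"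
    unfolding gaussian_bessel[OF b]
  proof (intro Bochner_Integration.integral_cong refl)
    fix \<xi>
    have "exp (- t * \<xi>\<^sup>2) * exp (- \<xi>\<^sup>2 / (4*b)) = exp (- c * \<xi>\<^sup>2)"
      by (simp add: c_def algebra_simps flip: exp_add)
    then show "exp (- t * \<xi>\<^sup>2) * j (x * \<xi>) * ((2*b) powr (-(\<alpha>+1)) * exp (- \<xi>\<^sup>2 / (4*b))) = (2*b) powr (-(\<alpha>+1)) * (exp (- c * \<xi>\<^sup>2) * j (\<xi> * x))"
      by (simp add: mult_ac)
  qed
  also have "\<dots> = (2*b) powr (-(\<alpha>+1)) * ((2*c) powr (-(\<alpha>+1)) * exp (- x\<^sup>2 / (4*c)))"
    using gaussian_bessel[OF c, of x] by simp
  also have "\<dots> = (1 + 4*b*t) powr (-(\<alpha>+1)) * exp (- b * x\<^sup>2 / (1 + 4*b*t))"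
  proof -
    have "(2*b) * (2*c) = 1 + 4*b*t" using b by (simp add: c_def field_simps)
    moreover have "4*c = (1 + 4*b*t) / b" using b by (simp add: c_def field_simps)
    then have "x\<^sup>2 / (4*c) = b * x\<^sup>2 / (1 + 4*b*t)" by (simp add: mult.commute)
    ultimately show ?thesis using b c by (simp add: powr_mult[symmetric])
  qed
  finally have I: "(\<integral>y. heat t x y * exp (- b * y\<^sup>2) \<partial>\<mu>) = (1 + 4*b*t) powr (-(\<alpha>+1)) * exp (- b * x\<^sup>2 / (1 + 4*b*t))" .
  have "integrable \<mu> (\<lambda>y. heat t x y * exp (- b * y\<^sup>2))"
    by (rule Bochner_Integration.integrable_bound[OF integrable_mult_right[OF gaussian_integrable[OF b], of "(2*t) powr (-(\<alpha>+1))"]])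
       (use heat_le[OF t] in \<open>auto intro!: mult_right_mono\<close>)
  then have "(\<integral>\<^sup>+y. ennreal (heat t x y * exp (- b * y\<^sup>2)) \<partial>\<mu>) = ennreal (\<integral>y. heat t x y * exp (- b * y\<^sup>2) \<partial>\<mu>)"
    by (rule nn_integral_eq_integral) auto
  then show ?thesis unfolding I .
qed

text \<open>The multiplication formula is used once with the multiplier times the conjugate
  transform of f, and once, for each x, with the multiplier times j(xi x), whose transform is the
  heat kernel at x.\<close>

lemma heat_form:
  assumes f: "integrable \<mu> f" and t: "t > 0"
  shows "integrable \<mu> (\<lambda>\<xi>. exp (- t * \<xi>\<^sup>2) * (norm (H f \<xi>))\<^sup>2)"
    and "complex_of_real (\<integral>\<xi>. exp (- t * \<xi>\<^sup>2) * (norm (H f \<xi>))\<^sup>2 \<partial>\<mu>) =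
      (\<integral>x. f x * (\<integral>y. cnj (f y) * complex_of_real (heat t x y) \<partial>\<mu>) \<partial>\<mu>)"
proof -
  have [measurable]: "f \<in> borel_measurable borel" by (rule integrable_mu_measurable[OF f])
  define B where "B = (\<integral>x. norm (f x) \<partial>\<mu>)"
  have B: "norm (H f \<xi>) \<le> B" for \<xi> unfolding B_def by (rule H_bound[OF f])
  have B0: "B \<ge> 0" by (simp add: B_def)
  show "integrable \<mu> (\<lambda>\<xi>. exp (- t * \<xi>\<^sup>2) * (norm (H f \<xi>))\<^sup>2)"
    by (rule Bochner_Integration.integrable_bound[OF integrable_mult_left[OF gaussian_integrable[OF t], of "B\<^sup>2"]])
       (use B B0 in \<open>auto intro!: mult_left_mono power_mono\<close>)
  define \<phi> where "\<phi> \<xi> = complex_of_real (exp (- t * \<xi>\<^sup>2)) * cnj (H f \<xi>)" for \<xi>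
  have \<phi>: "integrable \<mu> \<phi>" unfolding \<phi>_def
    by (rule Bochner_Integration.integrable_bound[OF integrable_mult_left[OF gaussian_integrable[OF t], of B]])
       (use B B0 in \<open>auto intro!: mult_left_mono simp: norm_mult\<close>)
  define \<phi>2 where "\<phi>2 x \<xi> = complex_of_real (exp (- t * \<xi>\<^sup>2)) * complex_of_real (j (\<xi> * x))" for x \<xi>
  have \<phi>2: "integrable \<mu> (\<phi>2 x)" for x unfolding \<phi>2_def
    by (rule Bochner_Integration.integrable_bound[OF gaussian_integrable[OF t]])
       (auto intro!: mult_left_le bessel_j_le_1 simp: norm_mult)
  have H2: "H (\<phi>2 x) y = complex_of_real (heat t x y)" for x y
  proof -
    have "H (\<phi>2 x) y = (\<integral>\<xi>. complex_of_real (exp (- t * \<xi>\<^sup>2) * (j (x * \<xi>) * j (y * \<xi>))) \<partial>\<mu>)"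
      unfolding hankel_L1_def \<phi>2_def by (simp add: mult_ac)
    also have "\<dots> = complex_of_real (heat t x y)" unfolding heat_eq[OF t] by (rule integral_complex_of_real)
    finally show ?thesis .
  qed
  have cf: "integrable \<mu> (\<lambda>x. cnj (f x))" using f by simp
  have H1: "H \<phi> x = (\<integral>y. cnj (f y) * complex_of_real (heat t x y) \<partial>\<mu>)" for x
  proof -
    have "H \<phi> x = (\<integral>\<xi>. \<phi>2 x \<xi> * H (\<lambda>x. cnj (f x)) \<xi> \<partial>\<mu>)"
      unfolding H_cnj unfolding hankel_L1_def[of _ \<phi>] \<phi>_def \<phi>2_def by (simp add: mult_ac)
    also have "\<dots> = (\<integral>y. cnj (f y) * H (\<phi>2 x) y \<partial>\<mu>)" by (rule multiplication_formula[OF cf \<phi>2])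
    finally show ?thesis unfolding H2 .
  qed
  have "complex_of_real (\<integral>\<xi>. exp (- t * \<xi>\<^sup>2) * (norm (H f \<xi>))\<^sup>2 \<partial>\<mu>) = (\<integral>\<xi>. complex_of_real (exp (- t * \<xi>\<^sup>2) * (norm (H f \<xi>))\<^sup>2) \<partial>\<mu>)"
    by (rule integral_complex_of_real[symmetric])
  also have "\<dots> = (\<integral>\<xi>. \<phi> \<xi> * H f \<xi> \<partial>\<mu>)"
    unfolding \<phi>_def by (intro Bochner_Integration.integral_cong refl) (simp only: of_real_mult complex_norm_square mult_ac)
  also have "\<dots> = (\<integral>x. f x * H \<phi> x \<partial>\<mu>)" by (rule multiplication_formula[OF f \<phi>])
  finally show "complex_of_real (\<integral>\<xi>. exp (- t * \<xi>\<^sup>2) * (norm (H f \<xi>))\<^sup>2 \<partial>\<mu>) =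
      (\<integral>x. f x * (\<integral>y. cnj (f y) * complex_of_real (heat t x y) \<partial>\<mu>) \<partial>\<mu>)"
    unfolding H1 .
qed

lemma norm_integral_le_nn:
  fixes f :: "'a \<Rightarrow> 'b::{banach, second_countable_topology}"
  shows "ennreal (norm (integral\<^sup>L M f)) \<le> (\<integral>\<^sup>+x. ennreal (norm (f x)) \<partial>M)"
  by (cases "integrable M f") (auto simp: not_integrable_integral_eq intro: integral_norm_bound_ennreal)

text \<open>Schur's test for a positive symmetric kernel: the arithmetic-geometric mean inequality,
  weighted by the ratio of h at the two points, bounds the form by the mean of two double integrals
  that are equal by symmetry of \<open>heat\<close>.\<close>

lemma heat_Schur:
  assumes f: "integrable \<mu> f" and t: "t > 0"
    and [measurable]: "h \<in> borel_measurable borel" and h: "\<And>x. h x > 0"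
  shows "(\<integral>\<^sup>+\<xi>. ennreal (exp (- t * \<xi>\<^sup>2) * (norm (H f \<xi>))\<^sup>2) \<partial>\<mu>) \<le>
    (\<integral>\<^sup>+x. ennreal ((norm (f x))\<^sup>2 / h x) * (\<integral>\<^sup>+y. ennreal (heat t x y * h y) \<partial>\<mu>) \<partial>\<mu>)" (is "?L \<le> ?R")
proof -
  have [measurable]: "f \<in> borel_measurable borel" by (rule integrable_mu_measurable[OF f])
  define Q where "Q x y = ennreal ((norm (f x))\<^sup>2 / h x * (heat t x y * h y))" for x y
  have [measurable]: "case_prod Q \<in> borel_measurable (borel \<Otimes>\<^sub>M borel)" unfolding Q_def by measurable
  have R: "?R = (\<integral>\<^sup>+x. \<integral>\<^sup>+y. Q x y \<partial>\<mu> \<partial>\<mu>)"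
    unfolding Q_def using h by (subst ennreal_mult') (auto intro!: nn_integral_cong nn_integral_cmult[symmetric] divide_nonneg_pos)
  have R': "?R = (\<integral>\<^sup>+x. \<integral>\<^sup>+y. Q y x \<partial>\<mu> \<partial>\<mu>)" unfolding R by (rule mm.Fubini') measurable
  have "?L = ennreal (\<integral>\<xi>. exp (- t * \<xi>\<^sup>2) * (norm (H f \<xi>))\<^sup>2 \<partial>\<mu>)"
    by (rule nn_integral_eq_integral[OF heat_form(1)[OF f t]]) auto
  also have "\<dots> = ennreal (norm (complex_of_real (\<integral>\<xi>. exp (- t * \<xi>\<^sup>2) * (norm (H f \<xi>))\<^sup>2 \<partial>\<mu>)))"
    by (subst norm_of_real, subst abs_of_nonneg) (auto intro!: Bochner_Integration.integral_nonneg)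
  also have "\<dots> \<le> (\<integral>\<^sup>+x. ennreal (norm (f x * (\<integral>y. cnj (f y) * complex_of_real (heat t x y) \<partial>\<mu>))) \<partial>\<mu>)"
    unfolding heat_form(2)[OF f t] by (rule norm_integral_le_nn)
  also have "\<dots> \<le> (\<integral>\<^sup>+x. ennreal (norm (f x)) * (\<integral>\<^sup>+y. ennreal (norm (cnj (f y) * complex_of_real (heat t x y))) \<partial>\<mu>) \<partial>\<mu>)"
    by (intro nn_integral_mono) (auto simp: norm_mult[of "f _"] ennreal_mult' intro!: mult_left_mono norm_integral_le_nn)
  also have "\<dots> = (\<integral>\<^sup>+x. \<integral>\<^sup>+y. ennreal (norm (f x)) * ennreal (norm (f y) * heat t x y) \<partial>\<mu> \<partial>\<mu>)"
    by (simp add: nn_integral_cmult norm_mult)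
  also have "\<dots> \<le> (\<integral>\<^sup>+x. \<integral>\<^sup>+y. (Q x y + Q y x) / 2 \<partial>\<mu> \<partial>\<mu>)"
  proof (intro nn_integral_mono)
    fix x y
    have am: "2 * (a * b) \<le> a\<^sup>2 / p * q + b\<^sup>2 / q * p" if "p > 0" "q > 0" for a b p q :: real
    proof -
      have "0 \<le> (a * q - b * p)\<^sup>2 / (p * q)" using that by auto
      also have "\<dots> = a\<^sup>2 / p * q + b\<^sup>2 / q * p - 2 * (a * b)"
        using that by (simp add: power2_eq_square field_simps)
      finally show ?thesis by simp
    qed
    have "2 * (norm (f x) * norm (f y)) * heat t x y \<le> ((norm (f x))\<^sup>2 / h x * h y + (norm (f y))\<^sup>2 / h y * h x) * heat t x y"
      by (intro mult_right_mono am h) auto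
    then have "norm (f x) * (norm (f y) * heat t x y) \<le> ((norm (f x))\<^sup>2 / h x * (heat t x y * h y) + (norm (f y))\<^sup>2 / h y * (heat t y x * h x)) / 2"
      by (simp add: heat_commute[of t y x] algebra_simps)
    then have "ennreal (norm (f x)) * ennreal (norm (f y) * heat t x y) \<le> ennreal (((norm (f x))\<^sup>2 / h x * (heat t x y * h y) + (norm (f y))\<^sup>2 / h y * (heat t y x * h x)) / 2)"
      by (subst ennreal_mult'[symmetric]) (auto intro: ennreal_leI)
    also have "\<dots> = (Q x y + Q y x) / 2"
    proof -
      have nn: "0 \<le> (norm (f x))\<^sup>2 / h x * (heat t x y * h y)" for x y
        using h[of x] h[of y] by (intro mult_nonneg_nonneg divide_nonneg_nonneg) auto
      show ?thesis unfolding Q_def ennreal_plus[OF nn nn, symmetric]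
        by (rule ennreal_divide_numeral[symmetric]) (intro add_nonneg_nonneg nn)
    qed
    finally show "ennreal (norm (f x)) * ennreal (norm (f y) * heat t x y) \<le> (Q x y + Q y x) / 2" .
  qed
  also have "\<dots> = (?R + ?R) / 2"
    unfolding R[symmetric]
    by (subst (2) R', subst R) (simp add: nn_integral_divide nn_integral_add)
  also have "\<dots> = ?R" unfolding mult_2_right[symmetric] by (rule ennreal_mult_divide_eq) auto
  finally show ?thesis .
qed

section \<open>Plancherel's theorem\<close>

text \<open>An extended nonnegative value, so that it can be used for \<open>H f\<close> before this
  is known to be square integrable.\<close>

definition sq_norm :: "(real \<Rightarrow> complex) \<Rightarrow> ennreal" where
  "sq_norm f = (\<integral>\<^sup>+x. ennreal ((norm (f x))\<^sup>2) \<partial>\<mu>)"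

lemma integral_mu_scale:
  fixes f :: "real \<Rightarrow> complex"
  assumes [measurable]: "f \<in> borel_measurable borel" and a: "a > 0"
  shows "(\<integral>x. f x \<partial>\<mu>) = complex_of_real (a powr (2*\<alpha>+2)) * (\<integral>x. f (a * x) \<partial>\<mu>)"
proof -
  have w: "mu_weight \<alpha> (a * x) = a powr (2*\<alpha>+1) * mu_weight \<alpha> x" for x
    using a by (auto simp: mu_weight_def indicator_def powr_mult zero_le_mult_iff)
  have "(\<integral>x. f x \<partial>\<mu>) = (\<integral>x. mu_weight \<alpha> x *\<^sub>R f x \<partial>lborel)"
    unfolding mu_alpha_def by (subst integral_density) auto
  also have "\<dots> = \<bar>a\<bar> *\<^sub>R (\<integral>x. mu_weight \<alpha> (0 + a * x) *\<^sub>R f (0 + a * x) \<partial>lborel)"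
    by (rule lborel_integral_real_affine) (use a in auto)
  also have "\<dots> = (\<integral>x. (a * a powr (2*\<alpha>+1)) *\<^sub>R (mu_weight \<alpha> x *\<^sub>R f (a * x)) \<partial>lborel)"
    unfolding integral_scaleR_right[symmetric] using a by (simp add: w) (simp add: mult_ac)
  also have "\<dots> = (a * a powr (2*\<alpha>+1)) *\<^sub>R (\<integral>x. (mu_weight \<alpha> x *\<^sub>R f (a * x)) \<partial>lborel)"
    by (rule integral_scaleR_right)
  also have "a * a powr (2*\<alpha>+1) = a powr (2*\<alpha>+2)"
    using powr_add[of a 1 "2*\<alpha>+1"] a by (simp add: add_ac)
  also have "(\<integral>x. (mu_weight \<alpha> x *\<^sub>R f (a * x)) \<partial>lborel) = (\<integral>x. f (a * x) \<partial>\<mu>)"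
    unfolding mu_alpha_def by (subst integral_density) auto
  finally show ?thesis by (simp add: scaleR_conv_of_real)
qed

text \<open>Rescaling moves the time t into the argument of f and leaves the fixed density
  \<open>heat_gauss 1\<close>, which serves as a majorant while t tends to 0.\<close>

lemma integral_heat_gauss_scale:
  fixes f :: "real \<Rightarrow> complex"
  assumes [measurable]: "f \<in> borel_measurable borel" and t: "t > 0"
  shows "(\<integral>z. f z * complex_of_real (heat_gauss t z) \<partial>\<mu>) =
    (\<integral>z. f (sqrt t * z) * complex_of_real (heat_gauss 1 z) \<partial>\<mu>)"
proof -
  have g: "(sqrt t) powr (2*\<alpha>+2) * heat_gauss t (sqrt t * z) = heat_gauss 1 z" for z
  proof -
    have e1: "(sqrt t) powr (2*\<alpha>+2) = t powr (\<alpha>+1)"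
      using t by (simp add: powr_half_sqrt[symmetric] powr_powr algebra_simps)
    have e2: "t powr (\<alpha>+1) * t powr (-(\<alpha>+1)) = 1" using t by (simp add: powr_add[symmetric])
    have e3: "(2*t) powr (-(\<alpha>+1)) = 2 powr (-(\<alpha>+1)) * t powr (-(\<alpha>+1))" using t by (simp add: powr_mult)
    have e4: "- (sqrt t * z)\<^sup>2 / (4*t) = - z\<^sup>2/(4*1)" using t by (simp add: power_mult_distrib)
    have "(sqrt t) powr (2*\<alpha>+2) * heat_gauss t (sqrt t * z) =
       (t powr (\<alpha>+1) * t powr (-(\<alpha>+1))) * (2 powr (-(\<alpha>+1)) * exp (- z\<^sup>2/(4*1)))"
      unfolding heat_gauss_def e1 e3 e4 by (simp only: mult_ac)
    then show ?thesis unfolding e2 heat_gauss_def by simp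
  qed
  show ?thesis
    by (subst integral_mu_scale[of _ "sqrt t"], measurable, use t in simp, subst integral_mult_right_zero[symmetric])
       (intro Bochner_Integration.integral_cong refl, simp only: g[symmetric] of_real_mult mult_ac)
qed

text \<open>One fixed positive null sequence: it serves as heat time, as the regularisation eps, and
  as a positive correction in \<open>sq_limit\<close>.\<close>

definition tseq :: "nat \<Rightarrow> real" where "tseq n = 1 / (real n + 1)"

lemma tseq_pos: "tseq n > 0" by (simp add: tseq_def)

lemma tseq_lim: "tseq \<longlonglongrightarrow> 0"
  unfolding tseq_def[abs_def] using LIMSEQ_inverse_real_of_nat by (simp add: inverse_eq_divide add_ac)

lemma tseq_antimono: "m \<le> n \<Longrightarrow> tseq n \<le> tseq m"
  by (auto simp: tseq_def intro!: frac_le)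

text \<open>Monotone convergence as the weights increase to 1; an infinite limit is allowed.\<close>

lemma heat_weight_limit:
  assumes [measurable]: "g \<in> borel_measurable borel"
  shows "(\<lambda>n. \<integral>\<^sup>+\<xi>. ennreal (exp (- tseq n * \<xi>\<^sup>2) * (norm (g \<xi>))\<^sup>2) \<partial>\<mu>) \<longlonglongrightarrow> sq_norm g"
  unfolding sq_norm_def
proof (rule nn_integral_LIMSEQ)
  show "incseq (\<lambda>n \<xi>. ennreal (exp (- tseq n * \<xi>\<^sup>2) * (norm (g \<xi>))\<^sup>2))"
    by (auto simp: incseq_def le_fun_def intro!: ennreal_leI mult_right_mono tseq_antimono)
  fix \<xi>
  have "(\<lambda>n. exp (- tseq n * \<xi>\<^sup>2) * (norm (g \<xi>))\<^sup>2) \<longlonglongrightarrow> exp (- 0 * \<xi>\<^sup>2) * (norm (g \<xi>))\<^sup>2"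
    by (intro tendsto_intros tseq_lim)
  then show "(\<lambda>n. ennreal (exp (- tseq n * \<xi>\<^sup>2) * (norm (g \<xi>))\<^sup>2)) \<longlonglongrightarrow> ennreal ((norm (g \<xi>))\<^sup>2)"
    by (intro tendsto_ennrealI) simp
qed measurable

text \<open>The swap transfers the angle average from the heat kernel to the conjugate of f; after
  rescaling, t occurs only in the argument of the translation.\<close>

lemma heat_conv_eq:
  assumes f: "integrable \<mu> f" and t: "t > 0"
  shows "(\<integral>y. cnj (f y) * complex_of_real (heat t x y) \<partial>\<mu>) =
    (\<integral>z. transl (\<lambda>y. cnj (f y)) x (sqrt t * z) * complex_of_real (heat_gauss 1 z) \<partial>\<mu>)"
proof -
  have [measurable]: "f \<in> borel_measurable borel" by (rule integrable_mu_measurable[OF f])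
  define \<Psi> where "\<Psi> a b = cnj (f a) * complex_of_real (heat_gauss t b)" for a b
  have [measurable]: "case_prod \<Psi> \<in> borel_measurable (borel \<Otimes>\<^sub>M borel)" unfolding \<Psi>_def by measurable
  have "(\<integral>\<^sup>+y. \<integral>\<^sup>+\<theta>. ennreal (norm (\<Psi> y (hyp x y \<theta>))) \<partial>angle_measure \<partial>\<mu>) \<le>
      (\<integral>\<^sup>+y. \<integral>\<^sup>+\<theta>. ennreal (norm (f y)) * ennreal ((2*t) powr (-(\<alpha>+1))) \<partial>angle_measure \<partial>\<mu>)"
    by (intro nn_integral_mono, subst ennreal_mult'[symmetric])
       (use heat_gauss_nonneg heat_gauss_le[OF t] in \<open>auto simp: \<Psi>_def norm_mult intro!: ennreal_leI mult_left_mono\<close>)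
  also have "\<dots> < \<infinity>" using f by (simp add: nn_integral_multc integrable_iff_bounded ennreal_mult_less_top)
  finally have fin: "(\<integral>\<^sup>+y. \<integral>\<^sup>+\<theta>. ennreal (norm (\<Psi> y (hyp x y \<theta>))) \<partial>angle_measure \<partial>\<mu>) < \<infinity>" .
  have "(\<integral>y. cnj (f y) * complex_of_real (heat t x y) \<partial>\<mu>) = (\<integral>y. \<integral>\<theta>. \<Psi> y (hyp x y \<theta>) \<partial>angle_measure \<partial>\<mu>)"
    unfolding \<Psi>_def heat_def transl_def by simp
  also have "\<dots> = (\<integral>y. \<integral>\<theta>. \<Psi> (hyp x y \<theta>) y \<partial>angle_measure \<partial>\<mu>)"
    by (rule integral_hyp_swap[OF _ fin]) measurable
  also have "\<dots> = (\<integral>y. transl (\<lambda>y. cnj (f y)) x y * complex_of_real (heat_gauss t y) \<partial>\<mu>)"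
    unfolding \<Psi>_def transl_def by simp
  also have "\<dots> = (\<integral>z. transl (\<lambda>y. cnj (f y)) x (sqrt t * z) * complex_of_real (heat_gauss 1 z) \<partial>\<mu>)"
    by (rule integral_heat_gauss_scale[OF _ t]) measurable
  finally show ?thesis .
qed

lemma heat_gauss_integrable: "t > 0 \<Longrightarrow> integrable \<mu> (heat_gauss t)"
  using nn_integral_heat_gauss[of t] by (intro integrableI_nonneg) (auto simp: heat_gauss_nonneg)

lemma integral_heat_gauss: "t > 0 \<Longrightarrow> (\<integral>z. heat_gauss t z \<partial>\<mu>) = 1"
  using nn_integral_heat_gauss[of t] by (subst integral_eq_nn_integral) (auto simp: heat_gauss_nonneg)

text \<open>The same heat form has two limits as t tends to 0. On the frequency side monotone
  convergence gives the norm of \<open>H f\<close>; on the space side the heat kernel is an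
  approximate identity and gives the norm of f. Continuity and the bound \<open>C\<close> serve the
  second limit, which is taken by dominated convergence.\<close>

lemma Plancherel_continuous:
  assumes f: "integrable \<mu> f" and cont: "continuous_on UNIV f" and C: "\<And>x. norm (f x) \<le> C"
  shows "sq_norm (H f) = sq_norm f"
proof -
  have [measurable]: "f \<in> borel_measurable borel" by (rule integrable_mu_measurable[OF f])
  have C0: "C \<ge> 0" using C[of 0] norm_ge_zero order_trans by blast
  define fc where "fc y = cnj (f y)" for y
  have [measurable]: "fc \<in> borel_measurable borel" unfolding fc_def by measurable
  have fcC: "norm (fc y) \<le> C" for y using C by (simp add: fc_def)
  define K where "K n x = (\<integral>y. cnj (f y) * complex_of_real (heat (tseq n) x y) \<partial>\<mu>)" for n x
  have [measurable]: "K n \<in> borel_measurable borel" for n unfolding K_def by measurable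
  have K: "K n x = (\<integral>z. transl fc x (sqrt (tseq n) * z) * complex_of_real (heat_gauss 1 z) \<partial>\<mu>)" for n x
    unfolding K_def fc_def by (rule heat_conv_eq[OF f tseq_pos])
  have tb: "norm (transl fc x y) \<le> C" for x y
  proof -
    have "norm (transl fc x y) \<le> (\<integral>\<theta>. norm (fc (hyp x y \<theta>)) \<partial>angle_measure)"
      unfolding transl_def by (rule integral_norm_bound)
    also have "\<dots> \<le> (\<integral>\<theta>. C \<partial>angle_measure)"
      by (intro integral_mono integrable_angle_bounded[of _ C]) (auto simp: fcC C0)
    finally show ?thesis by simp
  qed
  have nb: "norm (transl fc x y * complex_of_real (heat_gauss 1 z)) \<le> C * heat_gauss 1 z" for x y z
    using tb[of x y] heat_gauss_nonneg[of 1 z] by (auto simp: norm_mult intro!: mult_right_mono)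
  have Kb: "norm (K n x) \<le> C" for n x
  proof -
    have "norm (K n x) \<le> (\<integral>z. norm (transl fc x (sqrt (tseq n) * z) * complex_of_real (heat_gauss 1 z)) \<partial>\<mu>)"
      unfolding K by (rule integral_norm_bound)
    also have "\<dots> \<le> (\<integral>z. C * heat_gauss 1 z \<partial>\<mu>)"
    proof (rule integral_mono)
      show "integrable \<mu> (\<lambda>z. norm (transl fc x (sqrt (tseq n) * z) * complex_of_real (heat_gauss 1 z)))"
        by (rule Bochner_Integration.integrable_bound[OF integrable_mult_right[OF heat_gauss_integrable[of 1], of C]])
           (use nb heat_gauss_nonneg[of 1] C0 in auto)
    qed (use nb heat_gauss_integrable[of 1] in auto)
    finally show ?thesis using integral_heat_gauss[of 1] by simp
  qed
  have isc: "isCont fc x" for x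
    using cont unfolding fc_def by (intro continuous_intros) (simp add: continuous_on_eq_continuous_at)
  \<comment> \<open>The limit of \<open>hyp\<close> is the square root of x^2, which is x only for x
    >= 0; by \<open>AE_mu_pos\<close> the positive x are enough.\<close>
  have tl: "(\<lambda>n. transl fc x (sqrt (tseq n) * z)) \<longlonglongrightarrow> fc x" if x: "x > 0" for x z
  proof -
    have "(\<lambda>n. \<integral>\<theta>. fc (hyp x (sqrt (tseq n) * z) \<theta>) \<partial>angle_measure) \<longlonglongrightarrow> (\<integral>\<theta>. fc x \<partial>angle_measure)"
    proof (rule integral_dominated_convergence[where w="\<lambda>_. C"])
      show "AE \<theta> in angle_measure. (\<lambda>n. fc (hyp x (sqrt (tseq n) * z) \<theta>)) \<longlonglongrightarrow> fc x"
      proof (rule AE_I2)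
        fix \<theta>
        have "(\<lambda>n. hyp x (sqrt (tseq n) * z) \<theta>) \<longlonglongrightarrow> sqrt (x\<^sup>2 + (sqrt 0 * z)\<^sup>2 + 2*x*(sqrt 0 * z)*cos \<theta>)"
          unfolding hyp_def by (intro tendsto_intros tseq_lim)
        then have "(\<lambda>n. hyp x (sqrt (tseq n) * z) \<theta>) \<longlonglongrightarrow> x" using x by simp
        then show "(\<lambda>n. fc (hyp x (sqrt (tseq n) * z) \<theta>)) \<longlonglongrightarrow> fc x"
          by (rule isCont_tendsto_compose[OF isc])
      qed
    qed (auto simp: fcC)
    then show ?thesis unfolding transl_def by simp
  qed
  have Kl: "(\<lambda>n. K n x) \<longlonglongrightarrow> fc x" if x: "x > 0" for x
  proof -
    have "(\<lambda>n. K n x) \<longlonglongrightarrow> (\<integral>z. fc x * complex_of_real (heat_gauss 1 z) \<partial>\<mu>)"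
      unfolding K
    proof (rule integral_dominated_convergence[where w="\<lambda>z. C * heat_gauss 1 z"])
      show "integrable \<mu> (\<lambda>z. C * heat_gauss 1 z)" by (intro integrable_mult_right heat_gauss_integrable) simp
      show "AE z in \<mu>. (\<lambda>n. transl fc x (sqrt (tseq n) * z) * complex_of_real (heat_gauss 1 z)) \<longlonglongrightarrow> fc x * complex_of_real (heat_gauss 1 z)"
        by (intro AE_I2 tendsto_intros tl x)
    qed (use nb in auto)
    then show ?thesis using integral_heat_gauss[of 1] by simp
  qed
  have fcf: "f x * fc x = complex_of_real ((norm (f x))\<^sup>2)" for x
    unfolding fc_def by (simp only: complex_norm_square)
  have "(\<lambda>n. \<integral>x. f x * K n x \<partial>\<mu>) \<longlonglongrightarrow> (\<integral>x. f x * fc x \<partial>\<mu>)"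
  proof (rule integral_dominated_convergence[where w="\<lambda>x. norm (f x) * C"])
    show "AE x in \<mu>. (\<lambda>n. f x * K n x) \<longlonglongrightarrow> f x * fc x"
      using AE_mu_pos by eventually_elim (intro tendsto_intros Kl)
    show "integrable \<mu> (\<lambda>x. norm (f x) * C)" using f by simp
  qed (use Kb in \<open>auto simp: norm_mult intro!: mult_left_mono\<close>)
  moreover have "(\<integral>x. f x * fc x \<partial>\<mu>) = complex_of_real (\<integral>x. (norm (f x))\<^sup>2 \<partial>\<mu>)"
    unfolding fcf by (rule integral_complex_of_real)
  ultimately have "(\<lambda>n. complex_of_real (\<integral>\<xi>. exp (- tseq n * \<xi>\<^sup>2) * (norm (H f \<xi>))\<^sup>2 \<partial>\<mu>)) \<longlonglongrightarrow> complex_of_real (\<integral>x. (norm (f x))\<^sup>2 \<partial>\<mu>)"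
    unfolding heat_form(2)[OF f tseq_pos] K_def by simp
  then have "(\<lambda>n. \<integral>\<xi>. exp (- tseq n * \<xi>\<^sup>2) * (norm (H f \<xi>))\<^sup>2 \<partial>\<mu>) \<longlonglongrightarrow> (\<integral>x. (norm (f x))\<^sup>2 \<partial>\<mu>)"
    unfolding tendsto_of_real_iff .
  then have "(\<lambda>n. ennreal (\<integral>\<xi>. exp (- tseq n * \<xi>\<^sup>2) * (norm (H f \<xi>))\<^sup>2 \<partial>\<mu>)) \<longlonglongrightarrow> ennreal (\<integral>x. (norm (f x))\<^sup>2 \<partial>\<mu>)"
    by (rule tendsto_ennrealI)
  moreover have "ennreal (\<integral>\<xi>. exp (- tseq n * \<xi>\<^sup>2) * (norm (H f \<xi>))\<^sup>2 \<partial>\<mu>) = (\<integral>\<^sup>+\<xi>. ennreal (exp (- tseq n * \<xi>\<^sup>2) * (norm (H f \<xi>))\<^sup>2) \<partial>\<mu>)" for n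
    by (rule nn_integral_eq_integral[symmetric, OF heat_form(1)[OF f tseq_pos]]) auto
  moreover have "ennreal (\<integral>x. (norm (f x))\<^sup>2 \<partial>\<mu>) = sq_norm f"
    unfolding sq_norm_def
  proof (rule nn_integral_eq_integral[symmetric])
    show "integrable \<mu> (\<lambda>x. (norm (f x))\<^sup>2)"
      by (rule Bochner_Integration.integrable_bound[OF integrable_mult_right[OF f, of "complex_of_real C"]])
         (use C C0 in \<open>auto simp: power2_eq_square norm_mult intro!: mult_right_mono\<close>)
  qed auto
  ultimately show ?thesis using heat_weight_limit[of "H f"] LIMSEQ_unique by fastforce
qed

section \<open>Limits in L^2\<close>

text \<open>The free parameter d takes the place of Minkowski's inequality: the factor of v can be
  brought as close to 1 as desired, at the price of a large factor on the difference.\<close>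

lemma norm_sq_split:
  fixes u v :: complex
  assumes "d > 0"
  shows "(norm u)\<^sup>2 \<le> (1 + d) * (norm v)\<^sup>2 + (1 + 1/d) * (norm (u - v))\<^sup>2"
proof -
  define p q where "p = norm v" and "q = norm (u - v)"
  have "norm u \<le> p + q" unfolding p_def q_def using norm_triangle_ineq[of v "u - v"] by simp
  then have "(norm u)\<^sup>2 \<le> (p + q)\<^sup>2" by (intro power_mono) auto
  also have "(p + q)\<^sup>2 \<le> (1 + d) * p\<^sup>2 + (1 + 1/d) * q\<^sup>2"
  proof -
    have "0 \<le> (d * p - q)\<^sup>2 / d" using assms by simp
    also have "\<dots> = d * p\<^sup>2 - 2 * p * q + q\<^sup>2 / d"
      using assms by (simp add: power2_eq_square field_simps)
    finally show ?thesis by (simp add: power2_sum algebra_simps)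
  qed
  finally show ?thesis by (simp add: p_def q_def)
qed

lemma nn_sq_split:
  assumes [measurable]: "u \<in> borel_measurable borel" "v \<in> borel_measurable borel" "w \<in> borel_measurable borel"
    and w: "\<And>x. 0 \<le> w x" "\<And>x. w x \<le> W" and d: "d > 0"
  shows "(\<integral>\<^sup>+x. ennreal (w x * (norm (u x))\<^sup>2) \<partial>\<mu>) \<le>
    ennreal (1 + d) * (\<integral>\<^sup>+x. ennreal (w x * (norm (v x))\<^sup>2) \<partial>\<mu>) + ennreal (1 + 1/d) * (ennreal W * sq_norm (\<lambda>x. u x - v x))"
proof -
  have W: "W \<ge> 0" using w[of 0] by linarith
  have "(\<integral>\<^sup>+x. ennreal (w x * (norm (u x))\<^sup>2) \<partial>\<mu>) \<le>
     (\<integral>\<^sup>+x. ennreal (1 + d) * ennreal (w x * (norm (v x))\<^sup>2) + ennreal (1 + 1/d) * (ennreal W * ennreal ((norm (u x - v x))\<^sup>2)) \<partial>\<mu>)"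
  proof (rule nn_integral_mono)
    fix x
    have "w x * (norm (u x))\<^sup>2 \<le> w x * ((1 + d) * (norm (v x))\<^sup>2 + (1 + 1/d) * (norm (u x - v x))\<^sup>2)"
      by (intro mult_left_mono norm_sq_split d w)
    also have "\<dots> \<le> (1 + d) * (w x * (norm (v x))\<^sup>2) + (1 + 1/d) * (W * (norm (u x - v x))\<^sup>2)"
    proof -
      have "w x * ((1 + 1/d) * (norm (u x - v x))\<^sup>2) \<le> W * ((1 + 1/d) * (norm (u x - v x))\<^sup>2)"
        using d by (intro mult_right_mono w) auto
      then show ?thesis by (simp add: algebra_simps)
    qed
    finally have "ennreal (w x * (norm (u x))\<^sup>2) \<le> ennreal ((1 + d) * (w x * (norm (v x))\<^sup>2) + (1 + 1/d) * (W * (norm (u x - v x))\<^sup>2))"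
      by (rule ennreal_leI)
    also have "\<dots> = ennreal (1 + d) * ennreal (w x * (norm (v x))\<^sup>2) + ennreal (1 + 1/d) * (ennreal W * ennreal ((norm (u x - v x))\<^sup>2))"
      using d w W by (subst ennreal_plus) (auto simp: ennreal_mult)
    finally show "ennreal (w x * (norm (u x))\<^sup>2) \<le> \<dots>" .
  qed
  also have "\<dots> = ennreal (1 + d) * (\<integral>\<^sup>+x. ennreal (w x * (norm (v x))\<^sup>2) \<partial>\<mu>) + ennreal (1 + 1/d) * (ennreal W * sq_norm (\<lambda>x. u x - v x))"
    unfolding sq_norm_def by (subst nn_integral_add) (auto simp: nn_integral_cmult)
  finally show ?thesis .
qed

lemma sq_norm_triangle:
  assumes [measurable]: "u \<in> borel_measurable borel" "v \<in> borel_measurable borel"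
  shows "sq_norm (\<lambda>x. u x + v x) \<le> 2 * sq_norm u + 2 * sq_norm v"
  using nn_sq_split[of "\<lambda>x. u x + v x" u "\<lambda>_. 1" 1 1] by (simp add: sq_norm_def)

lemma sq_norm_minus: "sq_norm (\<lambda>x. u x - v x) = sq_norm (\<lambda>x. v x - u x)"
  unfolding sq_norm_def by (simp add: norm_minus_commute)

lemma sq_norm_triangle_diff:
  assumes [measurable]: "u \<in> borel_measurable borel" "v \<in> borel_measurable borel"
  shows "sq_norm (\<lambda>x. u x - v x) \<le> 2 * sq_norm u + 2 * sq_norm v"
  using sq_norm_triangle[of u "\<lambda>x. - v x"] by (simp add: sq_norm_def)

text \<open>Applying \<open>nn_sq_split\<close> in both directions squeezes the weighted integrals
  of u n around that of F. Boundedness of the weight lets the unweighted distance control the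
  error.\<close>

lemma sq_limit:
  assumes [measurable]: "\<And>n. u n \<in> borel_measurable borel" "F \<in> borel_measurable borel" "w \<in> borel_measurable borel"
    and w: "\<And>x. 0 \<le> w x" "\<And>x. w x \<le> W"
    and fin: "sq_norm F < \<infinity>" "\<And>n. sq_norm (u n) < \<infinity>"
    and lim: "(\<lambda>n. sq_norm (\<lambda>x. u n x - F x)) \<longlonglongrightarrow> 0"
  shows "(\<lambda>n. \<integral>\<^sup>+x. ennreal (w x * (norm (u n x))\<^sup>2) \<partial>\<mu>) \<longlonglongrightarrow> (\<integral>\<^sup>+x. ennreal (w x * (norm (F x))\<^sup>2) \<partial>\<mu>)"
proof -
  have W: "W \<ge> 0" using w[of 0] by linarith
  have finw: "(\<integral>\<^sup>+x. ennreal (w x * (norm (v x))\<^sup>2) \<partial>\<mu>) < \<infinity>" if "sq_norm v < \<infinity>" and [measurable]: "v \<in> borel_measurable borel" for v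
  proof -
    have "(\<integral>\<^sup>+x. ennreal (w x * (norm (v x))\<^sup>2) \<partial>\<mu>) \<le> (\<integral>\<^sup>+x. ennreal W * ennreal ((norm (v x))\<^sup>2) \<partial>\<mu>)"
      using w W by (intro nn_integral_mono) (auto simp: ennreal_mult'[symmetric] intro!: ennreal_leI mult_right_mono)
    also have "\<dots> = ennreal W * sq_norm v" unfolding sq_norm_def by (rule nn_integral_cmult) measurable
    also have "\<dots> < \<infinity>" using that by (simp add: ennreal_mult_less_top)
    finally show ?thesis .
  qed
  define a where "a = enn2real (\<integral>\<^sup>+x. ennreal (w x * (norm (F x))\<^sup>2) \<partial>\<mu>)"
  define b where "b n = enn2real (\<integral>\<^sup>+x. ennreal (w x * (norm (u n x))\<^sup>2) \<partial>\<mu>)" for n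
  define r where "r n = enn2real (sq_norm (\<lambda>x. u n x - F x))" for n
  have findiff: "sq_norm (\<lambda>x. u n x - F x) < \<infinity>" for n
    by (rule le_less_trans[OF sq_norm_triangle_diff]) (use fin in \<open>auto simp: ennreal_mult_less_top\<close>)
  have ea: "(\<integral>\<^sup>+x. ennreal (w x * (norm (F x))\<^sup>2) \<partial>\<mu>) = ennreal a"
    unfolding a_def using finw[OF fin(1)] by (subst ennreal_enn2real) auto
  have eb: "(\<integral>\<^sup>+x. ennreal (w x * (norm (u n x))\<^sup>2) \<partial>\<mu>) = ennreal (b n)" for n
    unfolding b_def using finw[OF fin(2)] by (subst ennreal_enn2real) auto
  have er: "sq_norm (\<lambda>x. u n x - F x) = ennreal (r n)" "sq_norm (\<lambda>x. F x - u n x) = ennreal (r n)" for n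
    unfolding r_def using findiff[of n] by (simp_all add: ennreal_enn2real sq_norm_minus[of F])
  have nn: "a \<ge> 0" "b n \<ge> 0" "r n \<ge> 0" for n by (simp_all add: a_def b_def r_def)
  \<comment> \<open>With d close to sqrt r both d and r/d tend to 0 along with r; adding
    \<open>tseq n\<close> keeps d positive where r n = 0.\<close>
  define d where "d n = sqrt (r n) + tseq n" for n
  have d: "d n > 0" for n using tseq_pos[of n] nn by (simp add: d_def add_nonneg_pos)
  have rl: "r \<longlonglongrightarrow> 0"
    using lim unfolding er(1) by (subst (asm) ennreal_0[symmetric], subst (asm) tendsto_ennreal_iff) (auto simp: nn)
  have rd: "(1 + 1 / d n) * (W * r n) \<le> W * (r n + sqrt (r n))" for n
  proof -
    have "r n = sqrt (r n) * sqrt (r n)" using nn by simp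
    also have "\<dots> \<le> sqrt (r n) * d n" using tseq_pos[of n] nn by (intro mult_left_mono) (auto simp: d_def)
    finally have "r n / d n \<le> sqrt (r n)" using d by (simp add: divide_le_eq)
    then have "W * (r n + r n / d n) \<le> W * (r n + sqrt (r n))" using W by (intro mult_left_mono) auto
    then show ?thesis by (simp add: algebra_simps)
  qed
  have 1: "b n \<le> (1 + d n) * a + W * (r n + sqrt (r n))" for n
  proof -
    have "ennreal (b n) \<le> ennreal (1 + d n) * ennreal a + ennreal (1 + 1 / d n) * (ennreal W * ennreal (r n))"
      using nn_sq_split[of "u n" F w W "d n"] w d by (simp add: ea eb er)
    also have "\<dots> = ennreal ((1 + d n) * a + (1 + 1 / d n) * (W * r n))"
      using nn d[of n] W by (subst ennreal_plus) (auto simp: ennreal_mult less_imp_le)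
    finally have "b n \<le> (1 + d n) * a + (1 + 1 / d n) * (W * r n)"
      using nn d[of n] W by (subst (asm) ennreal_le_iff) (auto intro!: add_nonneg_nonneg mult_nonneg_nonneg)
    then show ?thesis using rd[of n] by linarith
  qed
  have 2: "(a - W * (r n + sqrt (r n))) / (1 + d n) \<le> b n" for n
  proof -
    have "ennreal a \<le> ennreal (1 + d n) * ennreal (b n) + ennreal (1 + 1 / d n) * (ennreal W * ennreal (r n))"
      using nn_sq_split[of F "u n" w W "d n"] w d by (simp add: ea eb er)
    also have "\<dots> = ennreal ((1 + d n) * b n + (1 + 1 / d n) * (W * r n))"
      using nn d[of n] W by (subst ennreal_plus) (auto simp: ennreal_mult less_imp_le)
    finally have "a \<le> (1 + d n) * b n + (1 + 1 / d n) * (W * r n)"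
      using nn d[of n] W by (subst (asm) ennreal_le_iff) (auto intro!: add_nonneg_nonneg mult_nonneg_nonneg)
    then have "a - W * (r n + sqrt (r n)) \<le> b n * (1 + d n)" using rd[of n] by (simp add: mult.commute)
    then show ?thesis using d[of n] by (simp add: divide_le_eq)
  qed
  have dl: "d \<longlonglongrightarrow> sqrt 0 + 0" unfolding d_def[abs_def] by (intro tendsto_intros rl tseq_lim)
  have l1: "(\<lambda>n. (1 + d n) * a + W * (r n + sqrt (r n))) \<longlonglongrightarrow> (1 + (sqrt 0 + 0)) * a + W * (0 + sqrt 0)"
    by (intro tendsto_intros rl dl)
  have l2: "(\<lambda>n. (a - W * (r n + sqrt (r n))) / (1 + d n)) \<longlonglongrightarrow> (a - W * (0 + sqrt 0)) / (1 + (sqrt 0 + 0))"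
    by (intro tendsto_intros rl dl) simp
  have "b \<longlonglongrightarrow> a"
    by (rule tendsto_sandwich[where f="\<lambda>n. (a - W * (r n + sqrt (r n))) / (1 + d n)" and h="\<lambda>n. (1 + d n) * a + W * (r n + sqrt (r n))"])
       (use 1 2 l1 l2 in auto)
  then show ?thesis unfolding ea eb by (rule tendsto_ennrealI)
qed

text \<open>The class on which \<open>H\<close> is an absolutely convergent integral and
  Plancherel's theorem is proved; \<open>is_hankel\<close> closes the graph over it.\<close>

definition L12 :: "(real \<Rightarrow> complex) \<Rightarrow> bool" where
  "L12 f \<longleftrightarrow> integrable \<mu> f \<and> sq_norm f < \<infinity>"

lemma L12D: "L12 f \<Longrightarrow> integrable \<mu> f" "L12 f \<Longrightarrow> sq_norm f < \<infinity>" "L12 f \<Longrightarrow> f \<in> borel_measurable borel"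
  by (auto simp: L12_def intro: integrable_mu_measurable)

lemma L12_diff: "L12 f \<Longrightarrow> L12 g \<Longrightarrow> L12 (\<lambda>x. f x - g x)"
  unfolding L12_def
  by (auto intro!: le_less_trans[OF sq_norm_triangle_diff] integrable_mu_measurable simp: ennreal_mult_less_top)

text \<open>Schur's test with a constant weight: the heat kernel has mass 1, so the heat form is at
  most the squared norm of f for every t. This bound precedes Plancherel's theorem and is what
  extends it along L^2 limits.\<close>

lemma H_contraction:
  assumes f: "L12 f"
  shows "sq_norm (H f) \<le> sq_norm f"
proof (rule LIMSEQ_le_const2[OF heat_weight_limit])
  have [measurable]: "f \<in> borel_measurable borel" by (rule L12D[OF f])
  show "H f \<in> borel_measurable borel" by measurable
  have "(\<integral>\<^sup>+\<xi>. ennreal (exp (- tseq n * \<xi>\<^sup>2) * (norm (H f \<xi>))\<^sup>2) \<partial>\<mu>) \<le> sq_norm f" for n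
    using heat_Schur[OF L12D(1)[OF f] tseq_pos, of "\<lambda>_. 1" n] nn_integral_heat[OF tseq_pos]
    by (simp add: sq_norm_def)
  then show "\<exists>N. \<forall>n\<ge>N. (\<integral>\<^sup>+\<xi>. ennreal (exp (- tseq n * \<xi>\<^sup>2) * (norm (H f \<xi>))\<^sup>2) \<partial>\<mu>) \<le> sq_norm f" by blast
qed

lemma sq_norm_H_finite: "L12 f \<Longrightarrow> sq_norm (H f) < \<infinity>"
  using H_contraction[of f] L12D(2)[of f] by (rule le_less_trans)

lemma H_diff_limit:
  assumes u: "\<And>n. L12 (u n)" and f: "L12 f" and lim: "(\<lambda>n. sq_norm (\<lambda>x. u n x - f x)) \<longlonglongrightarrow> 0"
  shows "(\<lambda>n. sq_norm (\<lambda>x. H (u n) x - H f x)) \<longlonglongrightarrow> 0"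
proof (rule tendsto_sandwich[OF _ _ tendsto_const lim])
  show "\<forall>\<^sub>F n in sequentially. sq_norm (\<lambda>x. H (u n) x - H f x) \<le> sq_norm (\<lambda>x. u n x - f x)"
  proof (rule always_eventually, rule allI)
    fix n
    have "(\<lambda>x. H (u n) x - H f x) = H (\<lambda>x. u n x - f x)"
      using H_diff[OF L12D(1)[OF u] L12D(1)[OF f]] by auto
    then show "sq_norm (\<lambda>x. H (u n) x - H f x) \<le> sq_norm (\<lambda>x. u n x - f x)"
      using H_contraction[OF L12_diff[OF u f]] by simp
  qed
qed auto

lemma Plancherel_limit:
  assumes u: "\<And>n. L12 (u n)" and f: "L12 f" and lim: "(\<lambda>n. sq_norm (\<lambda>x. u n x - f x)) \<longlonglongrightarrow> 0"
    and P: "\<And>n. sq_norm (H (u n)) = sq_norm (u n)"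
  shows "sq_norm (H f) = sq_norm f"
proof -
  have [measurable]: "f \<in> borel_measurable borel" "\<And>n. u n \<in> borel_measurable borel" using L12D(3) u f by auto
  have "(\<lambda>n. sq_norm (u n)) \<longlonglongrightarrow> sq_norm f"
    using sq_limit[of u f "\<lambda>_. 1" 1, OF _ _ _ _ _ L12D(2)[OF f] L12D(2)[OF u] lim] by (simp add: sq_norm_def)
  moreover have "(\<lambda>n. sq_norm (H (u n))) \<longlonglongrightarrow> sq_norm (H f)"
    using sq_limit[of "\<lambda>n. H (u n)" "H f" "\<lambda>_. 1" 1, OF _ _ _ _ _ sq_norm_H_finite[OF f] sq_norm_H_finite[OF u] H_diff_limit[OF u f lim]]
    by (simp add: sq_norm_def)
  ultimately show ?thesis unfolding P using LIMSEQ_unique by blast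
qed

lemma sq_norm_dominated:
  fixes u :: "nat \<Rightarrow> real \<Rightarrow> complex"
  assumes [measurable]: "\<And>n. u n \<in> borel_measurable borel" "f \<in> borel_measurable borel" "g \<in> borel_measurable borel"
    and g: "integrable \<mu> g" and b: "\<And>n x. (norm (u n x - f x))\<^sup>2 \<le> g x"
    and lim: "AE x in \<mu>. (\<lambda>n. u n x) \<longlonglongrightarrow> f x"
  shows "(\<lambda>n. sq_norm (\<lambda>x. u n x - f x)) \<longlonglongrightarrow> 0"
proof -
  have "(\<lambda>n. \<integral>\<^sup>+x. ennreal ((norm (u n x - f x))\<^sup>2) \<partial>\<mu>) \<longlonglongrightarrow> (\<integral>\<^sup>+x. 0 \<partial>\<mu>)"
  proof (rule nn_integral_dominated_convergence[where w="\<lambda>x. ennreal (g x)"])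
    show "(\<integral>\<^sup>+x. ennreal (g x) \<partial>\<mu>) < \<infinity>"
      by (rule le_less_trans[of _ "(\<integral>\<^sup>+x. ennreal (norm (g x)) \<partial>\<mu>)"])
         (use g in \<open>auto simp: integrable_iff_bounded intro!: nn_integral_mono ennreal_leI\<close>)
    show "AE x in \<mu>. (\<lambda>n. ennreal ((norm (u n x - f x))\<^sup>2)) \<longlonglongrightarrow> 0"
      using lim
    proof eventually_elim
      fix x assume "(\<lambda>n. u n x) \<longlonglongrightarrow> f x"
      then have "(\<lambda>n. (norm (u n x - f x))\<^sup>2) \<longlonglongrightarrow> (norm (f x - f x))\<^sup>2" by (intro tendsto_intros)
      then show "(\<lambda>n. ennreal ((norm (u n x - f x))\<^sup>2)) \<longlonglongrightarrow> 0"
        using tendsto_ennrealI by fastforce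
    qed
  qed (use b in \<open>auto intro!: ennreal_leI\<close>)
  then show ?thesis by (simp add: sq_norm_def)
qed

lemma integrable_indicator_mu: "integrable \<mu> (indicator {-R..R} :: real \<Rightarrow> real)"
proof (rule Bochner_Integration.integrable_bound[OF integrable_mult_right[OF gaussian_integrable[of 1], of "exp (R\<^sup>2)"]])
  show "AE x in \<mu>. norm (indicator {-R..R} x :: real) \<le> norm (exp (R\<^sup>2) * exp (- 1 * x\<^sup>2))"
  proof (rule AE_I2)
    fix x
    have "x\<^sup>2 \<le> R\<^sup>2" if "x \<in> {-R..R}" using that by (auto intro: power2_le_iff_abs_le[THEN iffD2] simp: abs_le_iff)
    then show "norm (indicator {-R..R} x :: real) \<le> norm (exp (R\<^sup>2) * exp (- 1 * x\<^sup>2))"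
      by (auto simp: indicator_def exp_add[symmetric] simp del: exp_le_cancel_iff)
  qed
qed auto

lemma L12_bounded:
  assumes [measurable]: "f \<in> borel_measurable borel" and C: "\<And>x. norm (f x) \<le> C * indicator {-R..R} x"
  shows "L12 f"
proof -
  have nonneg: "C * indicator {-R..R} x \<ge> 0" for x using C[of x] norm_ge_zero order_trans by blast
  have i: "integrable \<mu> (\<lambda>x. C * indicator {-R..R} x)" by (intro integrable_mult_right integrable_indicator_mu)
  have "integrable \<mu> f" by (rule Bochner_Integration.integrable_bound[OF i]) (use C nonneg in auto)
  moreover have "integrable \<mu> (\<lambda>x. (norm (f x))\<^sup>2)"
  proof (rule Bochner_Integration.integrable_bound[OF integrable_mult_right[OF i, of C]])
    show "AE x in \<mu>. norm ((norm (f x))\<^sup>2) \<le> norm (C * (C * indicator {-R..R} x))"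
    proof (rule AE_I2)
      fix x
      have "(norm (f x))\<^sup>2 \<le> (C * indicator {-R..R} x)\<^sup>2" using C by (intro power_mono) auto
      then show "norm ((norm (f x))\<^sup>2) \<le> norm (C * (C * indicator {-R..R} x))"
        by (auto simp: power2_eq_square indicator_def)
    qed
  qed auto
  ultimately show ?thesis unfolding L12_def sq_norm_def by (auto simp: integrable_iff_bounded)
qed

text \<open>A measurable function is almost everywhere a limit of continuous ones, but these come
  without any bound. Clipping their values and cutting off their support preserves continuity and
  gives a common majorant, so \<open>Plancherel_limit\<close> applies.\<close>

lemma Plancherel_bounded:
  assumes [measurable]: "f \<in> borel_measurable borel" and C: "\<And>x. norm (f x) \<le> C * indicator {-R..R} x" and C0: "C > 0"
  shows "sq_norm (H f) = sq_norm f"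
proof -
  have fC: "norm (f x) \<le> C" for x using C[of x] C0 by (cases "x \<in> {-R..R}") auto
  have f0: "f x = 0" if "\<bar>x\<bar> > R" for x using C[of x] that by (cases "x \<in> {-R..R}") auto
  have "f \<in> borel_measurable (lebesgue_on UNIV)" by (simp add: lebesgue_on_UNIV_eq measurable_completion)
  then have "f measurable_on UNIV" using measurable_on_iff_borel_measurable[of UNIV f] by simp
  then obtain N g where N: "negligible N" and g: "\<And>n::nat. continuous_on UNIV (g n)"
    and lim: "\<And>x. x \<notin> N \<Longrightarrow> (\<lambda>n. g n x) \<longlonglongrightarrow> f x"
    unfolding measurable_on_def by auto
  \<comment> \<open>A trapezoid: 1 on [-R, R] and 0 outside [-(R+1), R+1].\<close>
  define cut where "cut x = max 0 (min 1 (R + 1 - \<bar>x\<bar>))" for x :: real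
  \<comment> \<open>Radial projection onto the disc of radius C; it fixes every value of f.\<close>
  define cl where "cl z = z /\<^sub>R max 1 (norm z / C)" for z :: complex
  define u where "u n x = cut x *\<^sub>R cl (g n x)" for n x
  have cl: "norm (cl z) \<le> C" for z
  proof -
    have "norm (cl z) = norm z / max 1 (norm z / C)" by (simp add: cl_def divide_inverse mult.commute)
    also have "\<dots> \<le> C" using C0 by (simp add: divide_le_eq max_def field_simps)
    finally show ?thesis .
  qed
  have cl_id: "cl z = z" if "norm z \<le> C" for z using that C0 by (simp add: cl_def max_def)
  have cl_cont: "continuous_on UNIV cl" unfolding cl_def[abs_def] by (intro continuous_intros) (use C0 in auto)
  have cut: "0 \<le> cut x" "cut x \<le> 1" "\<bar>x\<bar> \<le> R \<Longrightarrow> cut x = 1" "\<bar>x\<bar> > R + 1 \<Longrightarrow> cut x = 0" for x by (auto simp: cut_def)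
  have ucont: "continuous_on UNIV (u n)" for n
    unfolding u_def[abs_def] cut_def
    by (intro continuous_intros continuous_on_compose2[OF cl_cont g]) auto
  then have [measurable]: "u n \<in> borel_measurable borel" for n by (rule borel_measurable_continuous_onI)
  have ub: "norm (u n x) \<le> C * indicator {-(R+1)..R+1} x" for n x
  proof (cases "\<bar>x\<bar> \<le> R + 1")
    case True
    then show ?thesis using mult_mono[OF cut(2)[of x] cl[of "g n x"]] cut(1)[of x] by (simp add: u_def abs_le_iff indicator_def)
  qed (use cut(4)[of x] in \<open>auto simp: u_def indicator_def\<close>)
  have uC: "norm (u n x) \<le> C" for n x using ub[of n x] C0 by (cases "x \<in> {-(R+1)..R+1}") auto
  have L: "L12 (u n)" for n by (rule L12_bounded[OF _ ub]) measurable
  show ?thesis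
  proof (rule Plancherel_limit[OF L])
    show "L12 f" by (rule L12_bounded[OF _ C]) measurable
    show "sq_norm (H (u n)) = sq_norm (u n)" for n
      by (rule Plancherel_continuous[OF L12D(1)[OF L] ucont uC])
    show "(\<lambda>n. sq_norm (\<lambda>x. u n x - f x)) \<longlonglongrightarrow> 0"
    proof (rule sq_norm_dominated[where g="\<lambda>x. (2 * C)\<^sup>2 * indicator {-(R+1)..R+1} x"])
      show "integrable \<mu> (\<lambda>x. (2 * C)\<^sup>2 * indicator {-(R+1)..R+1} x)" by (intro integrable_mult_right integrable_indicator_mu)
      show "(norm (u n x - f x))\<^sup>2 \<le> (2 * C)\<^sup>2 * indicator {-(R+1)..R+1} x" for n x
      proof (cases "\<bar>x\<bar> \<le> R + 1")
        case True
        have "norm (u n x - f x) \<le> 2 * C" using uC[of n x] fC[of x] norm_triangle_ineq4[of "u n x" "f x"] by linarith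
        then have "(norm (u n x - f x))\<^sup>2 \<le> (2 * C)\<^sup>2" by (intro power_mono) auto
        then show ?thesis using True by (auto simp: indicator_def abs_le_iff)
      next
        case False
        then have "u n x = 0" "f x = 0" using cut(4)[of x] f0[of x] by (auto simp: u_def)
        then show ?thesis by simp
      qed
      \<comment> \<open>The exceptional set is negligible for the completed measure; the statement
        is carried from there to \<open>lborel\<close> and then to the density measure.\<close>
      have "AE x in lebesgue. x \<notin> N" using N by (auto intro!: AE_not_in simp: negligible_iff_null_sets)
      then have "AE x in lborel. x \<notin> N" by (simp add: AE_completion_iff)
      then have "AE x in \<mu>. x \<notin> N" unfolding mu_alpha_def by (subst AE_density) auto
      then show "AE x in \<mu>. (\<lambda>n. u n x) \<longlonglongrightarrow> f x"
      proof eventually_elim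
        fix x assume "x \<notin> N"
        then have "(\<lambda>n. cl (g n x)) \<longlonglongrightarrow> cl (f x)"
          using cl_cont lim by (auto simp: continuous_on_eq_continuous_at intro!: isCont_tendsto_compose[of _ cl])
        then have "(\<lambda>n. u n x) \<longlonglongrightarrow> cut x *\<^sub>R cl (f x)" unfolding u_def by (intro tendsto_intros)
        moreover have "cut x *\<^sub>R cl (f x) = f x" unfolding cl_id[OF fC] using cut(3)[of x] f0[of x] by (cases "\<bar>x\<bar> \<le> R") auto
        ultimately show "(\<lambda>n. u n x) \<longlonglongrightarrow> f x" by simp
      qed
    qed measurable
  qed
qed

text \<open>Truncating both the variable and the value reduces to \<open>Plancherel_bounded\<close>,
  with |f|^2 as majorant of the squared error.\<close>

lemma Plancherel_L12:
  assumes f: "L12 f"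
  shows "sq_norm (H f) = sq_norm f"
proof -
  have [measurable]: "f \<in> borel_measurable borel" by (rule L12D[OF f])
  define u where "u n x = (if \<bar>x\<bar> \<le> real n + 1 \<and> norm (f x) \<le> real n + 1 then f x else 0)" for n x
  have [measurable]: "u n \<in> borel_measurable borel" for n unfolding u_def by measurable
  have ub: "norm (u n x) \<le> (real n + 1) * indicator {-(real n+1)..real n+1} x" for n x
    by (auto simp: u_def indicator_def abs_le_iff)
  have L: "L12 (u n)" for n by (rule L12_bounded[OF _ ub]) measurable
  show ?thesis
  proof (rule Plancherel_limit[OF L f])
    show "sq_norm (H (u n)) = sq_norm (u n)" for n
      by (rule Plancherel_bounded[OF _ ub]) auto
    show "(\<lambda>n. sq_norm (\<lambda>x. u n x - f x)) \<longlonglongrightarrow> 0"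
    proof (rule sq_norm_dominated[where g="\<lambda>x. (norm (f x))\<^sup>2"])
      show "integrable \<mu> (\<lambda>x. (norm (f x))\<^sup>2)" using L12D(2)[OF f] by (auto simp: sq_norm_def integrable_iff_bounded)
      show "AE x in \<mu>. (\<lambda>n. u n x) \<longlonglongrightarrow> f x"
      proof (rule AE_I2)
        fix x
        obtain N where N: "real N > max \<bar>x\<bar> (norm (f x))" using reals_Archimedean2 by blast
        have "u n x = f x" if "n \<ge> N" for n using N that by (auto simp: u_def)
        then have "\<forall>\<^sub>F n in sequentially. u n x = f x" by (auto simp: eventually_sequentially)
        then show "(\<lambda>n. u n x) \<longlonglongrightarrow> f x" by (rule tendsto_eventually)
      qed
    qed (auto simp: u_def)
  qed
qed

section \<open>The uncertainty inequality for transform pairs\<close>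

text \<open>Closure in L^2 of the graph of \<open>H\<close> on \<open>L12\<close>. Identities and
  inequalities that survive L^2 limits transfer to such pairs along the approximating
  sequence.\<close>

definition is_hankel :: "(real \<Rightarrow> complex) \<Rightarrow> (real \<Rightarrow> complex) \<Rightarrow> bool" where
  "is_hankel F G \<longleftrightarrow> F \<in> borel_measurable borel \<and> G \<in> borel_measurable borel \<and>
     sq_norm F < \<infinity> \<and> sq_norm G < \<infinity> \<and>
     (\<exists>u. (\<forall>n. L12 (u n)) \<and> (\<lambda>n. sq_norm (\<lambda>x. u n x - F x)) \<longlonglongrightarrow> 0 \<and>
          (\<lambda>n. sq_norm (\<lambda>x. H (u n) x - G x)) \<longlonglongrightarrow> 0)"

lemma is_hankelD:
  assumes "is_hankel F G"
  shows "F \<in> borel_measurable borel" "G \<in> borel_measurable borel" "sq_norm F < \<infinity>" "sq_norm G < \<infinity>"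
  using assms by (auto simp: is_hankel_def)

lemma is_hankel_norm:
  assumes FG: "is_hankel F G"
  shows "sq_norm G = sq_norm F"
proof -
  obtain u where u: "\<And>n. L12 (u n)" and l1: "(\<lambda>n. sq_norm (\<lambda>x. u n x - F x)) \<longlonglongrightarrow> 0"
    and l2: "(\<lambda>n. sq_norm (\<lambda>x. H (u n) x - G x)) \<longlonglongrightarrow> 0" using FG unfolding is_hankel_def by blast
  note [measurable] = is_hankelD(1,2)[OF FG] L12D(3)[OF u]
  have "(\<lambda>n. sq_norm (u n)) \<longlonglongrightarrow> sq_norm F"
    using sq_limit[of u F "\<lambda>_. 1" 1, OF _ _ _ _ _ is_hankelD(3)[OF FG] L12D(2)[OF u] l1] by (simp add: sq_norm_def)
  moreover have "(\<lambda>n. sq_norm (H (u n))) \<longlonglongrightarrow> sq_norm G"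
    using sq_limit[of "\<lambda>n. H (u n)" G "\<lambda>_. 1" 1, OF _ _ _ _ _ is_hankelD(4)[OF FG] sq_norm_H_finite[OF u] l2]
    by (simp add: sq_norm_def)
  ultimately show ?thesis unfolding Plancherel_L12[OF u] using LIMSEQ_unique by blast
qed

text \<open>Passage to the limit in \<open>heat_Schur\<close>. The bound \<open>W\<close> on k/h is
  what \<open>sq_limit\<close> demands of a weight, and it shapes the later choice of h.\<close>

lemma is_hankel_Schur:
  assumes FG: "is_hankel F G" and t: "t > 0"
    and [measurable]: "h \<in> borel_measurable borel" "k \<in> borel_measurable borel"
    and h: "\<And>x. h x > 0" and k: "\<And>x. (\<integral>\<^sup>+y. ennreal (heat t x y * h y) \<partial>\<mu>) = ennreal (k x)"
    and W: "\<And>x. 0 \<le> k x / h x" "\<And>x. k x / h x \<le> W"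
  shows "(\<integral>\<^sup>+\<xi>. ennreal (exp (- t * \<xi>\<^sup>2) * (norm (G \<xi>))\<^sup>2) \<partial>\<mu>) \<le> (\<integral>\<^sup>+x. ennreal (k x / h x * (norm (F x))\<^sup>2) \<partial>\<mu>)"
proof -
  obtain u where u: "\<And>n. L12 (u n)" and l1: "(\<lambda>n. sq_norm (\<lambda>x. u n x - F x)) \<longlonglongrightarrow> 0"
    and l2: "(\<lambda>n. sq_norm (\<lambda>x. H (u n) x - G x)) \<longlonglongrightarrow> 0" using FG unfolding is_hankel_def by blast
  note [measurable] = is_hankelD(1,2)[OF FG] L12D(3)[OF u]
  have "(\<lambda>n. \<integral>\<^sup>+x. ennreal (k x / h x * (norm (u n x))\<^sup>2) \<partial>\<mu>) \<longlonglongrightarrow> (\<integral>\<^sup>+x. ennreal (k x / h x * (norm (F x))\<^sup>2) \<partial>\<mu>)"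
    by (rule sq_limit[OF _ _ _ W is_hankelD(3)[OF FG] L12D(2)[OF u] l1]) measurable
  moreover have "(\<lambda>n. \<integral>\<^sup>+\<xi>. ennreal (exp (- t * \<xi>\<^sup>2) * (norm (H (u n) \<xi>))\<^sup>2) \<partial>\<mu>) \<longlonglongrightarrow>
      (\<integral>\<^sup>+\<xi>. ennreal (exp (- t * \<xi>\<^sup>2) * (norm (G \<xi>))\<^sup>2) \<partial>\<mu>)"
    by (rule sq_limit[of "\<lambda>n. H (u n)" G _ 1, OF _ _ _ _ _ is_hankelD(4)[OF FG] sq_norm_H_finite[OF u] l2]) (use t in auto)
  moreover have "(\<integral>\<^sup>+\<xi>. ennreal (exp (- t * \<xi>\<^sup>2) * (norm (H (u n) \<xi>))\<^sup>2) \<partial>\<mu>) \<le> (\<integral>\<^sup>+x. ennreal (k x / h x * (norm (u n x))\<^sup>2) \<partial>\<mu>)" for n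
  proof -
    have k0: "k x \<ge> 0" for x using W(1)[of x] h[of x] by (simp add: zero_le_divide_iff)
    have "(\<integral>\<^sup>+\<xi>. ennreal (exp (- t * \<xi>\<^sup>2) * (norm (H (u n) \<xi>))\<^sup>2) \<partial>\<mu>) \<le> (\<integral>\<^sup>+x. ennreal ((norm (u n x))\<^sup>2 / h x) * ennreal (k x) \<partial>\<mu>)"
      using heat_Schur[where h=h, OF L12D(1)[OF u[of n]] t _ h] by (simp add: k)
    also have "\<dots> = (\<integral>\<^sup>+x. ennreal (k x / h x * (norm (u n x))\<^sup>2) \<partial>\<mu>)"
      by (intro nn_integral_cong) (subst ennreal_mult''[symmetric, OF k0], simp add: mult.commute)
    finally show ?thesis .
  qed
  ultimately show ?thesis by (intro LIMSEQ_le) auto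
qed

section \<open>Evolution of the Gaussian weight and the Heisenberg inequality\<close>

text \<open>The function exp (-b x^2) after heat time t, as computed in
  \<open>nn_integral_heat_gaussian\<close>.\<close>

definition evolved_gauss :: "real \<Rightarrow> real \<Rightarrow> real \<Rightarrow> real" where
  "evolved_gauss b t x = (1 + 4*b*t) powr (-(\<alpha>+1)) * exp (- b * x\<^sup>2 / (1 + 4*b*t))"

lemma evolved_gauss_measurable [measurable]: "evolved_gauss b t \<in> borel_measurable borel"
  unfolding evolved_gauss_def[abs_def] by measurable

lemma evolved_gauss_bounds:
  assumes "b > 0" "t > 0"
  shows "0 \<le> evolved_gauss b t x" "evolved_gauss b t x \<le> 1"
proof -
  have q: "1 + 4*b*t > 0" using assms by (simp add: add_pos_pos)
  have "(1 + 4*b*t) powr (-(\<alpha>+1)) \<le> (1 + 4*b*t) powr 0" using assms alpha by (intro powr_mono) auto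
  then have "(1 + 4*b*t) powr (-(\<alpha>+1)) \<le> 1" using q by simp
  then show "evolved_gauss b t x \<le> 1"
    unfolding evolved_gauss_def using assms by (intro mult_le_one) auto
qed (auto simp: evolved_gauss_def)

text \<open>With q = 1 + 4bt the evolved Gaussian k satisfies k e^z = exp (-b x^2). Then e^z >= 1 +
  z and ln q >= 1 - 1/q = 4bt/q bound the loss from below by t times a quantity with the correct
  limit as t tends to 0; no derivative in t is taken.\<close>

lemma evolved_gauss_decay:
  assumes b: "b > 0" and t: "t > 0"
  shows "t * (evolved_gauss b t x * (4*b/(1+4*b*t)) * ((\<alpha>+1) - b*x\<^sup>2)) \<le> exp (- b * x\<^sup>2) - evolved_gauss b t x"
proof -
  define q where "q = 1 + 4*b*t"
  have q: "q > 1" using b t by (simp add: q_def)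
  define k where "k = evolved_gauss b t x"
  define z where "z = (\<alpha>+1) * ln q - b * x\<^sup>2 * (1 - 1/q)"
  have k0: "k \<ge> 0" unfolding k_def using evolved_gauss_bounds[OF b t] by simp
  have "k * exp z = exp (- b * x\<^sup>2)"
    using q unfolding k_def evolved_gauss_def q_def[symmetric] z_def powr_def
    by (simp add: exp_add[symmetric] right_diff_distrib) (simp add: algebra_simps)
  moreover have "1 + z \<le> exp z" by (rule exp_ge_add_one_self)
  ultimately have 1: "k * z \<le> exp (- b * x\<^sup>2) - k" using k0 mult_left_mono[of "1+z" "exp z" k] by (simp add: distrib_left)
  have "ln (1/q) \<le> 1/q - 1" using q by (intro ln_le_minus_one) auto
  then have "1 - 1/q \<le> ln q" using q by (simp add: ln_div)
  then have "(\<alpha>+1) * (1 - 1/q) \<le> (\<alpha>+1) * ln q" using alpha by (intro mult_left_mono) auto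
  then have "((\<alpha>+1) - b*x\<^sup>2) * (1 - 1/q) \<le> z" by (simp add: z_def left_diff_distrib)
  then have "k * (((\<alpha>+1) - b*x\<^sup>2) * (1 - 1/q)) \<le> k * z" using k0 by (rule mult_left_mono)
  moreover have "1 - 1/q = t * (4*b/q)" using q by (simp add: q_def field_simps)
  ultimately have "t * (k * (4*b/q) * ((\<alpha>+1) - b*x\<^sup>2)) \<le> k * z" by (simp add: mult_ac)
  with 1 show ?thesis by (simp add: k_def q_def)
qed

text \<open>Constants are invariant under the heat flow because the kernel has mass 1, so eps is
  carried along unchanged.\<close>

lemma nn_integral_heat_shifted:
  assumes "b > 0" "t > 0" "\<epsilon> > 0"
  shows "(\<integral>\<^sup>+y. ennreal (heat t x y * (exp (- b * y\<^sup>2) + \<epsilon>)) \<partial>\<mu>) = ennreal (evolved_gauss b t x + \<epsilon>)"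
proof -
  have "(\<integral>\<^sup>+y. ennreal (heat t x y * (exp (- b * y\<^sup>2) + \<epsilon>)) \<partial>\<mu>) =
      (\<integral>\<^sup>+y. ennreal (heat t x y * exp (- b * y\<^sup>2)) + ennreal (heat t x y) * ennreal \<epsilon> \<partial>\<mu>)"
    using assms by (intro nn_integral_cong) (auto simp: distrib_left ennreal_mult)
  also have "\<dots> = ennreal (evolved_gauss b t x) + ennreal \<epsilon>"
    using assms nn_integral_heat_gaussian[of t b x]
    by (subst nn_integral_add) (auto simp: nn_integral_multc nn_integral_heat evolved_gauss_def)
  also have "\<dots> = ennreal (evolved_gauss b t x + \<epsilon>)"
    using assms evolved_gauss_bounds[of b t x] by (subst ennreal_plus) auto
  finally show ?thesis .
qed

text \<open>Subtracting the Schur bound from Plancherel's identity compares two losses over time t.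
  The loss of G, with density (1 - exp (-t xi^2)) |G|^2, is at most t xi^2 |G|^2; the loss of F is
  at least t times the integrand on the left by \<open>evolved_gauss_decay\<close>. Dividing by t
  gives the claim.\<close>

lemma heisenberg_aux:
  assumes FG: "is_hankel F G" and b: "b > 0" and t: "t > 0" and \<epsilon>: "\<epsilon> > 0"
    and iF: "integrable \<mu> (\<lambda>x. (norm (F x))\<^sup>2)" "integrable \<mu> (\<lambda>x. x\<^sup>2 * (norm (F x))\<^sup>2)"
    and iG: "integrable \<mu> (\<lambda>x. (norm (G x))\<^sup>2)" "integrable \<mu> (\<lambda>x. x\<^sup>2 * (norm (G x))\<^sup>2)"
  shows "(\<integral>x. evolved_gauss b t x * (4*b/(1+4*b*t)) * ((\<alpha>+1) - b*x\<^sup>2) / (exp (- b * x\<^sup>2) + \<epsilon>) * (norm (F x))\<^sup>2 \<partial>\<mu>) \<le>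
    (\<integral>\<xi>. \<xi>\<^sup>2 * (norm (G \<xi>))\<^sup>2 \<partial>\<mu>)"
proof -
  note [measurable] = is_hankelD(1,2)[OF FG]
  define h where "h x = exp (- b * x\<^sup>2) + \<epsilon>" for x
  have h: "h x > 0" "\<epsilon> \<le> h x" for x using \<epsilon> by (auto simp: h_def add_pos_pos)
  have [measurable]: "h \<in> borel_measurable borel" unfolding h_def by measurable
  define k where "k = evolved_gauss b t"
  have [measurable]: "k \<in> borel_measurable borel" unfolding k_def by measurable
  have k: "0 \<le> k x" "k x \<le> 1" for x unfolding k_def using evolved_gauss_bounds[OF b t] by auto
  \<comment> \<open>Here k <= 1 and h >= eps are used; without eps the ratio of the evolved to the
    original Gaussian would be unbounded in x.\<close>
  have W: "0 \<le> (k x + \<epsilon>) / h x" "(k x + \<epsilon>) / h x \<le> (1 + \<epsilon>) / \<epsilon>" for x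
    using k[of x] h[of x] \<epsilon> by (auto intro!: divide_nonneg_pos frac_le)
  define \<psi> where "\<psi> x = k x * (4*b/(1+4*b*t)) * ((\<alpha>+1) - b*x\<^sup>2) / h x * (norm (F x))\<^sup>2" for x
  have iW: "integrable \<mu> (\<lambda>x. (k x + \<epsilon>) / h x * (norm (F x))\<^sup>2)"
  proof (rule Bochner_Integration.integrable_bound[OF integrable_mult_right[OF iF(1), of "(1 + \<epsilon>) / \<epsilon>"]])
    show "AE x in \<mu>. norm ((k x + \<epsilon>) / h x * (norm (F x))\<^sup>2) \<le> norm ((1 + \<epsilon>) / \<epsilon> * (norm (F x))\<^sup>2)"
    proof (rule AE_I2)
      fix x
      have "(k x + \<epsilon>) / h x * (norm (F x))\<^sup>2 \<le> (1 + \<epsilon>) / \<epsilon> * (norm (F x))\<^sup>2"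
        by (intro mult_right_mono W) auto
      moreover have "0 \<le> (k x + \<epsilon>) / h x * (norm (F x))\<^sup>2" by (intro mult_nonneg_nonneg W) auto
      ultimately show "norm ((k x + \<epsilon>) / h x * (norm (F x))\<^sup>2) \<le> norm ((1 + \<epsilon>) / \<epsilon> * (norm (F x))\<^sup>2)"
        unfolding real_norm_def by linarith
    qed
  qed measurable
  have iE: "integrable \<mu> (\<lambda>\<xi>. exp (- t * \<xi>\<^sup>2) * (norm (G \<xi>))\<^sup>2)"
    by (rule Bochner_Integration.integrable_bound[OF iG(1)]) (use t in \<open>auto simp: abs_mult intro!: mult_left_le_one_le\<close>)
  \<comment> \<open>In the difference eps cancels from the numerator, because it occurs in the
    weight and unchanged in its evolution.\<close>
  have hk: "1 - (k x + \<epsilon>) / h x = (exp (- b * x\<^sup>2) - k x) / h x" for x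
    using h[of x] by (simp add: field_simps h_def)
  have ik: "integrable \<mu> (\<lambda>x. (exp (- b * x\<^sup>2) - k x) / h x * (norm (F x))\<^sup>2)"
    using Bochner_Integration.integrable_diff[OF iF(1) iW] unfolding hk[symmetric] by (simp add: left_diff_distrib)
  have S: "(\<integral>\<xi>. exp (- t * \<xi>\<^sup>2) * (norm (G \<xi>))\<^sup>2 \<partial>\<mu>) \<le> (\<integral>x. (k x + \<epsilon>) / h x * (norm (F x))\<^sup>2 \<partial>\<mu>)"
  proof -
    have "(\<integral>\<^sup>+\<xi>. ennreal (exp (- t * \<xi>\<^sup>2) * (norm (G \<xi>))\<^sup>2) \<partial>\<mu>) \<le> (\<integral>\<^sup>+x. ennreal ((k x + \<epsilon>) / h x * (norm (F x))\<^sup>2) \<partial>\<mu>)"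
      by (rule is_hankel_Schur[OF FG t _ _ _ _ W])
         (auto simp: h(1) nn_integral_heat_shifted[OF b t \<epsilon>, folded h_def k_def])
    moreover have "(\<integral>\<^sup>+\<xi>. ennreal (exp (- t * \<xi>\<^sup>2) * (norm (G \<xi>))\<^sup>2) \<partial>\<mu>) = ennreal (\<integral>\<xi>. exp (- t * \<xi>\<^sup>2) * (norm (G \<xi>))\<^sup>2 \<partial>\<mu>)"
      by (rule nn_integral_eq_integral[OF iE]) auto
    moreover have "(\<integral>\<^sup>+x. ennreal ((k x + \<epsilon>) / h x * (norm (F x))\<^sup>2) \<partial>\<mu>) = ennreal (\<integral>x. (k x + \<epsilon>) / h x * (norm (F x))\<^sup>2 \<partial>\<mu>)"
      by (rule nn_integral_eq_integral[OF iW]) (intro AE_I2 mult_nonneg_nonneg W, simp)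
    moreover have "0 \<le> (\<integral>x. (k x + \<epsilon>) / h x * (norm (F x))\<^sup>2 \<partial>\<mu>)"
      by (intro Bochner_Integration.integral_nonneg mult_nonneg_nonneg W) simp
    ultimately show ?thesis by (simp add: ennreal_le_iff)
  qed
  have eqn: "(\<integral>x. (norm (F x))\<^sup>2 \<partial>\<mu>) = (\<integral>\<xi>. (norm (G \<xi>))\<^sup>2 \<partial>\<mu>)"
  proof -
    have "sq_norm F = ennreal (\<integral>x. (norm (F x))\<^sup>2 \<partial>\<mu>)" "sq_norm G = ennreal (\<integral>x. (norm (G x))\<^sup>2 \<partial>\<mu>)"
      unfolding sq_norm_def by (rule nn_integral_eq_integral[OF iF(1)], simp) (rule nn_integral_eq_integral[OF iG(1)], simp)
    then show ?thesis using is_hankel_norm[OF FG] by (simp add: ennreal_inj)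
  qed
  have pw: "t * \<psi> x \<le> (exp (- b * x\<^sup>2) - k x) / h x * (norm (F x))\<^sup>2" for x
  proof -
    have "t * \<psi> x = t * (k x * (4*b/(1+4*b*t)) * ((\<alpha>+1) - b*x\<^sup>2)) / h x * (norm (F x))\<^sup>2"
      by (simp add: \<psi>_def)
    also have "\<dots> \<le> (exp (- b * x\<^sup>2) - k x) / h x * (norm (F x))\<^sup>2"
      unfolding k_def using h(1)[of x]
      by (intro mult_right_mono divide_right_mono evolved_gauss_decay[OF b t]) auto
    finally show ?thesis .
  qed
  have i\<psi>: "integrable \<mu> \<psi>"
  proof (rule Bochner_Integration.integrable_bound)
    show "integrable \<mu> (\<lambda>x. 4*b/\<epsilon> * (\<alpha>+1) * (norm (F x))\<^sup>2 + 4*b/\<epsilon> * b * (x\<^sup>2 * (norm (F x))\<^sup>2))"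
      by (intro Bochner_Integration.integrable_add integrable_mult_right iF)
    show "AE x in \<mu>. norm (\<psi> x) \<le> norm (4*b/\<epsilon> * (\<alpha>+1) * (norm (F x))\<^sup>2 + 4*b/\<epsilon> * b * (x\<^sup>2 * (norm (F x))\<^sup>2))"
    proof (rule AE_I2)
      fix x
      have "k x * (4*b/(1+4*b*t)) / h x \<le> 1 * (4*b/1) / \<epsilon>"
        using k[of x] h[of x] b t \<epsilon> by (intro frac_le mult_mono) (auto intro!: divide_left_mono simp: divide_le_eq)
      moreover have "0 \<le> k x * (4*b/(1+4*b*t)) / h x"
        using k[of x] h[of x] b t add_pos_pos[of 1 "4*b*t"] by (intro divide_nonneg_pos mult_nonneg_nonneg) auto
      ultimately have "\<bar>k x * (4*b/(1+4*b*t)) / h x\<bar> \<le> 4*b/\<epsilon>"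
        by (subst abs_of_nonneg) auto
      moreover have "\<bar>(\<alpha>+1) - b*x\<^sup>2\<bar> \<le> (\<alpha>+1) + b*x\<^sup>2" using alpha b by (auto simp: abs_le_iff)
      ultimately have "\<bar>k x * (4*b/(1+4*b*t)) / h x\<bar> * \<bar>(\<alpha>+1) - b*x\<^sup>2\<bar> * (norm (F x))\<^sup>2 \<le> 4*b/\<epsilon> * ((\<alpha>+1) + b*x\<^sup>2) * (norm (F x))\<^sup>2"
        using b \<epsilon> by (intro mult_right_mono mult_mono) (assumption | simp)+
      moreover have "norm (\<psi> x) = \<bar>k x * (4*b/(1+4*b*t)) / h x\<bar> * \<bar>(\<alpha>+1) - b*x\<^sup>2\<bar> * (norm (F x))\<^sup>2"
        by (simp add: \<psi>_def abs_mult)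
      moreover have "4*b/\<epsilon> * ((\<alpha>+1) + b*x\<^sup>2) * (norm (F x))\<^sup>2 = 4*b/\<epsilon> * (\<alpha>+1) * (norm (F x))\<^sup>2 + 4*b/\<epsilon> * b * (x\<^sup>2 * (norm (F x))\<^sup>2)"
        by (simp only: distrib_left distrib_right mult_ac)
      ultimately show "norm (\<psi> x) \<le> norm (4*b/\<epsilon> * (\<alpha>+1) * (norm (F x))\<^sup>2 + 4*b/\<epsilon> * b * (x\<^sup>2 * (norm (F x))\<^sup>2))"
        by simp
    qed
  qed (unfold \<psi>_def, measurable)
  have "t * (\<integral>x. \<psi> x \<partial>\<mu>) = (\<integral>x. t * \<psi> x \<partial>\<mu>)" by simp
  also have "\<dots> \<le> (\<integral>x. (exp (- b * x\<^sup>2) - k x) / h x * (norm (F x))\<^sup>2 \<partial>\<mu>)"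
    by (intro integral_mono integrable_mult_right i\<psi> ik pw)
  also have "\<dots> = (\<integral>x. (norm (F x))\<^sup>2 \<partial>\<mu>) - (\<integral>x. (k x + \<epsilon>) / h x * (norm (F x))\<^sup>2 \<partial>\<mu>)"
    unfolding hk[symmetric] left_diff_distrib using iF(1) iW by simp
  also have "\<dots> \<le> (\<integral>\<xi>. (norm (G \<xi>))\<^sup>2 \<partial>\<mu>) - (\<integral>\<xi>. exp (- t * \<xi>\<^sup>2) * (norm (G \<xi>))\<^sup>2 \<partial>\<mu>)"
    using S eqn by simp
  also have "\<dots> = (\<integral>\<xi>. (norm (G \<xi>))\<^sup>2 - exp (- t * \<xi>\<^sup>2) * (norm (G \<xi>))\<^sup>2 \<partial>\<mu>)"
    using iG(1) iE by simp
  also have "\<dots> \<le> (\<integral>\<xi>. t * (\<xi>\<^sup>2 * (norm (G \<xi>))\<^sup>2) \<partial>\<mu>)"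
  proof (intro integral_mono Bochner_Integration.integrable_diff iG(1) iE integrable_mult_right iG(2))
    fix \<xi>
    have "(1 - exp (- t * \<xi>\<^sup>2)) * (norm (G \<xi>))\<^sup>2 \<le> (t * \<xi>\<^sup>2) * (norm (G \<xi>))\<^sup>2"
      using exp_ge_add_one_self[of "- t * \<xi>\<^sup>2"] by (intro mult_right_mono) auto
    then show "(norm (G \<xi>))\<^sup>2 - exp (- t * \<xi>\<^sup>2) * (norm (G \<xi>))\<^sup>2 \<le> t * (\<xi>\<^sup>2 * (norm (G \<xi>))\<^sup>2)"
      by (simp add: left_diff_distrib mult.assoc)
  qed
  also have "\<dots> = t * (\<integral>\<xi>. \<xi>\<^sup>2 * (norm (G \<xi>))\<^sup>2 \<partial>\<mu>)" by simp
  finally have "(\<integral>x. \<psi> x \<partial>\<mu>) \<le> (\<integral>\<xi>. \<xi>\<^sup>2 * (norm (G \<xi>))\<^sup>2 \<partial>\<mu>)" using t by simp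
  then show ?thesis unfolding \<psi>_def k_def h_def .
qed

text \<open>Two dominated limits in \<open>heisenberg_aux\<close>: t tends to 0 for fixed eps, with
  a majorant depending on eps; then eps tends to 0, where the quotient of exp (-b x^2) by itself
  plus eps is at most 1 and the majorant no longer contains eps.\<close>

lemma heisenberg_real:
  assumes FG: "is_hankel F G" and b: "b > 0"
    and iF: "integrable \<mu> (\<lambda>x. (norm (F x))\<^sup>2)" "integrable \<mu> (\<lambda>x. x\<^sup>2 * (norm (F x))\<^sup>2)"
    and iG: "integrable \<mu> (\<lambda>x. (norm (G x))\<^sup>2)" "integrable \<mu> (\<lambda>x. x\<^sup>2 * (norm (G x))\<^sup>2)"
  shows "4*b*(\<alpha>+1) * (\<integral>x. (norm (F x))\<^sup>2 \<partial>\<mu>) \<le>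
    (\<integral>\<xi>. \<xi>\<^sup>2 * (norm (G \<xi>))\<^sup>2 \<partial>\<mu>) + 4*b\<^sup>2 * (\<integral>x. x\<^sup>2 * (norm (F x))\<^sup>2 \<partial>\<mu>)"
proof -
  note [measurable] = is_hankelD(1,2)[OF FG]
  define B where "B = (\<integral>\<xi>. \<xi>\<^sup>2 * (norm (G \<xi>))\<^sup>2 \<partial>\<mu>)"
  \<comment> \<open>The majorant of both limits up to constants; its integrability uses the second
    moment of F.\<close>
  define w where "w x = ((\<alpha>+1) + b*x\<^sup>2) * (norm (F x))\<^sup>2" for x
  have iw: "integrable \<mu> w"
    unfolding w_def distrib_right mult.assoc
    by (intro Bochner_Integration.integrable_add integrable_mult_right iF)
  have ab: "\<bar>(\<alpha>+1) - b*x\<^sup>2\<bar> \<le> (\<alpha>+1) + b*x\<^sup>2" for x using alpha b by (auto simp: abs_le_iff)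
  have bound: "norm (c * ((\<alpha>+1) - b*x\<^sup>2) / h * (norm (F x))\<^sup>2) \<le> C * w x"
    if "0 \<le> c / h" "c / h \<le> C" for c h C x
  proof -
    have "norm (c * ((\<alpha>+1) - b*x\<^sup>2) / h * (norm (F x))\<^sup>2) = \<bar>c / h\<bar> * (\<bar>(\<alpha>+1) - b*x\<^sup>2\<bar> * (norm (F x))\<^sup>2)"
      by (simp add: abs_mult)
    also have "\<dots> \<le> C * (((\<alpha>+1) + b*x\<^sup>2) * (norm (F x))\<^sup>2)"
      using that ab[of x] by (intro mult_mono mult_right_mono) auto
    finally show ?thesis by (simp add: w_def)
  qed
  have h0: "exp (- b * x\<^sup>2) + \<epsilon> > 0" if "\<epsilon> > 0" for x \<epsilon> :: real using that by (simp add: add_pos_pos)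
  have step1: "(\<integral>x. exp (- b * x\<^sup>2) * (4*b) * ((\<alpha>+1) - b*x\<^sup>2) / (exp (- b * x\<^sup>2) + \<epsilon>) * (norm (F x))\<^sup>2 \<partial>\<mu>) \<le> B" if \<epsilon>: "\<epsilon> > 0" for \<epsilon>
  proof (rule LIMSEQ_le_const2)
    show "(\<lambda>n. \<integral>x. evolved_gauss b (tseq n) x * (4*b/(1+4*b*tseq n)) * ((\<alpha>+1) - b*x\<^sup>2) / (exp (- b * x\<^sup>2) + \<epsilon>) * (norm (F x))\<^sup>2 \<partial>\<mu>)
      \<longlonglongrightarrow> (\<integral>x. exp (- b * x\<^sup>2) * (4*b) * ((\<alpha>+1) - b*x\<^sup>2) / (exp (- b * x\<^sup>2) + \<epsilon>) * (norm (F x))\<^sup>2 \<partial>\<mu>)"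
    proof (rule integral_dominated_convergence[where w="\<lambda>x. 4*b/\<epsilon> * w x"])
      show "AE x in \<mu>. (\<lambda>n. evolved_gauss b (tseq n) x * (4*b/(1+4*b*tseq n)) * ((\<alpha>+1) - b*x\<^sup>2) / (exp (- b * x\<^sup>2) + \<epsilon>) * (norm (F x))\<^sup>2)
        \<longlonglongrightarrow> exp (- b * x\<^sup>2) * (4*b) * ((\<alpha>+1) - b*x\<^sup>2) / (exp (- b * x\<^sup>2) + \<epsilon>) * (norm (F x))\<^sup>2"
      proof (rule AE_I2)
        fix x
        have 1: "(\<lambda>n. evolved_gauss b (tseq n) x) \<longlonglongrightarrow> (1 + 4*b*0) powr (-(\<alpha>+1)) * exp (- b * x\<^sup>2 / (1 + 4*b*0))"
          unfolding evolved_gauss_def by (intro tendsto_intros tseq_lim) auto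
        have 2: "(\<lambda>n. 4*b/(1+4*b*tseq n)) \<longlonglongrightarrow> 4*b/(1+4*b*0)" by (intro tendsto_intros tseq_lim) auto
        show "(\<lambda>n. evolved_gauss b (tseq n) x * (4*b/(1+4*b*tseq n)) * ((\<alpha>+1) - b*x\<^sup>2) / (exp (- b * x\<^sup>2) + \<epsilon>) * (norm (F x))\<^sup>2)
        \<longlonglongrightarrow> exp (- b * x\<^sup>2) * (4*b) * ((\<alpha>+1) - b*x\<^sup>2) / (exp (- b * x\<^sup>2) + \<epsilon>) * (norm (F x))\<^sup>2"
          using 1 2 h0[OF \<epsilon>, of x] by (intro tendsto_intros) auto
      qed
      show "integrable \<mu> (\<lambda>x. 4*b/\<epsilon> * w x)" by (intro integrable_mult_right iw)
      fix n
      show "AE x in \<mu>. norm (evolved_gauss b (tseq n) x * (4*b/(1+4*b*tseq n)) * ((\<alpha>+1) - b*x\<^sup>2) / (exp (- b * x\<^sup>2) + \<epsilon>) * (norm (F x))\<^sup>2) \<le> 4*b/\<epsilon> * w x"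
      proof (intro AE_I2 bound)
        fix x
        note e = evolved_gauss_bounds[OF b tseq_pos, of n x] and t = tseq_pos[of n]
        have q: "0 < 1 + 4*b*tseq n" using b t by (simp add: add_pos_pos)
        show "0 \<le> evolved_gauss b (tseq n) x * (4*b/(1+4*b*tseq n)) / (exp (- b * x\<^sup>2) + \<epsilon>)"
          using e t b q h0[OF \<epsilon>, of x] by (intro divide_nonneg_pos mult_nonneg_nonneg) auto
        have "evolved_gauss b (tseq n) x * (4*b/(1+4*b*tseq n)) / (exp (- b * x\<^sup>2) + \<epsilon>) \<le> 1 * (4*b/1) / \<epsilon>"
          using e t b \<epsilon> q by (intro frac_le mult_mono) (auto simp: divide_le_eq)
        then show "evolved_gauss b (tseq n) x * (4*b/(1+4*b*tseq n)) / (exp (- b * x\<^sup>2) + \<epsilon>) \<le> 4*b/\<epsilon>" by simp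
      qed
    qed measurable
    show "\<exists>N. \<forall>n\<ge>N. (\<integral>x. evolved_gauss b (tseq n) x * (4*b/(1+4*b*tseq n)) * ((\<alpha>+1) - b*x\<^sup>2) / (exp (- b * x\<^sup>2) + \<epsilon>) * (norm (F x))\<^sup>2 \<partial>\<mu>) \<le> B"
      unfolding B_def using heisenberg_aux[OF FG b tseq_pos \<epsilon> iF iG] by blast
  qed
  have "(\<integral>x. 4*b * ((\<alpha>+1) - b*x\<^sup>2) * (norm (F x))\<^sup>2 \<partial>\<mu>) \<le> B"
  proof (rule LIMSEQ_le_const2)
    show "(\<lambda>n. \<integral>x. exp (- b * x\<^sup>2) * (4*b) * ((\<alpha>+1) - b*x\<^sup>2) / (exp (- b * x\<^sup>2) + tseq n) * (norm (F x))\<^sup>2 \<partial>\<mu>)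
      \<longlonglongrightarrow> (\<integral>x. 4*b * ((\<alpha>+1) - b*x\<^sup>2) * (norm (F x))\<^sup>2 \<partial>\<mu>)"
    proof (rule integral_dominated_convergence[where w="\<lambda>x. 4*b * w x"])
      show "AE x in \<mu>. (\<lambda>n. exp (- b * x\<^sup>2) * (4*b) * ((\<alpha>+1) - b*x\<^sup>2) / (exp (- b * x\<^sup>2) + tseq n) * (norm (F x))\<^sup>2)
        \<longlonglongrightarrow> 4*b * ((\<alpha>+1) - b*x\<^sup>2) * (norm (F x))\<^sup>2"
      proof (rule AE_I2)
        fix x
        have "(\<lambda>n. exp (- b * x\<^sup>2) * (4*b) * ((\<alpha>+1) - b*x\<^sup>2) / (exp (- b * x\<^sup>2) + tseq n) * (norm (F x))\<^sup>2)
          \<longlonglongrightarrow> exp (- b * x\<^sup>2) * (4*b) * ((\<alpha>+1) - b*x\<^sup>2) / (exp (- b * x\<^sup>2) + 0) * (norm (F x))\<^sup>2"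
          by (intro tendsto_intros tseq_lim) auto
        then show "(\<lambda>n. exp (- b * x\<^sup>2) * (4*b) * ((\<alpha>+1) - b*x\<^sup>2) / (exp (- b * x\<^sup>2) + tseq n) * (norm (F x))\<^sup>2)
          \<longlonglongrightarrow> 4*b * ((\<alpha>+1) - b*x\<^sup>2) * (norm (F x))\<^sup>2" by (simp add: mult.assoc)
      qed
      show "integrable \<mu> (\<lambda>x. 4*b * w x)" by (intro integrable_mult_right iw)
      fix n
      show "AE x in \<mu>. norm (exp (- b * x\<^sup>2) * (4*b) * ((\<alpha>+1) - b*x\<^sup>2) / (exp (- b * x\<^sup>2) + tseq n) * (norm (F x))\<^sup>2) \<le> 4*b * w x"
      proof (intro AE_I2 bound)
        fix x
        show "0 \<le> exp (- b * x\<^sup>2) * (4*b) / (exp (- b * x\<^sup>2) + tseq n)"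
          using b h0[OF tseq_pos, of x n] by (intro divide_nonneg_pos) auto
        show "exp (- b * x\<^sup>2) * (4*b) / (exp (- b * x\<^sup>2) + tseq n) \<le> 4*b"
          using b h0[OF tseq_pos, of x n] tseq_pos[of n] by (simp add: divide_le_eq mult.commute)
      qed
    qed measurable
    show "\<exists>N. \<forall>n\<ge>N. (\<integral>x. exp (- b * x\<^sup>2) * (4*b) * ((\<alpha>+1) - b*x\<^sup>2) / (exp (- b * x\<^sup>2) + tseq n) * (norm (F x))\<^sup>2 \<partial>\<mu>) \<le> B"
      using step1[OF tseq_pos] by blast
  qed
  moreover have "(\<integral>x. 4*b * ((\<alpha>+1) - b*x\<^sup>2) * (norm (F x))\<^sup>2 \<partial>\<mu>) =
     (\<integral>x. 4*b*(\<alpha>+1) * (norm (F x))\<^sup>2 - 4*b\<^sup>2 * (x\<^sup>2 * (norm (F x))\<^sup>2) \<partial>\<mu>)"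
    by (intro Bochner_Integration.integral_cong refl) (simp add: algebra_simps power2_eq_square)
  moreover have "\<dots> = 4*b*(\<alpha>+1) * (\<integral>x. (norm (F x))\<^sup>2 \<partial>\<mu>) - 4*b\<^sup>2 * (\<integral>x. x\<^sup>2 * (norm (F x))\<^sup>2 \<partial>\<mu>)"
    using iF by simp
  ultimately show ?thesis unfolding B_def by simp
qed

text \<open>An infinite moment makes the right side infinite since 4b^2 > 0; otherwise all integrals
  are finite and \<open>heisenberg_real\<close> applies. The norm of G is used on the left because
  it is the transform of a slice whose norm is integrated over the scales later.\<close>

lemma heisenberg:
  assumes FG: "is_hankel F G" and b: "b > 0"
  shows "ennreal (4*b*(\<alpha>+1)) * sq_norm G \<le>
    (\<integral>\<^sup>+\<xi>. ennreal (\<xi>\<^sup>2 * (norm (G \<xi>))\<^sup>2) \<partial>\<mu>) + ennreal (4*b\<^sup>2) * (\<integral>\<^sup>+x. ennreal (x\<^sup>2 * (norm (F x))\<^sup>2) \<partial>\<mu>)"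
proof -
  note [measurable] = is_hankelD(1,2)[OF FG]
  consider "(\<integral>\<^sup>+\<xi>. ennreal (\<xi>\<^sup>2 * (norm (G \<xi>))\<^sup>2) \<partial>\<mu>) = \<infinity>" | "(\<integral>\<^sup>+x. ennreal (x\<^sup>2 * (norm (F x))\<^sup>2) \<partial>\<mu>) = \<infinity>"
    | "(\<integral>\<^sup>+\<xi>. ennreal (\<xi>\<^sup>2 * (norm (G \<xi>))\<^sup>2) \<partial>\<mu>) < \<infinity>" "(\<integral>\<^sup>+x. ennreal (x\<^sup>2 * (norm (F x))\<^sup>2) \<partial>\<mu>) < \<infinity>"
    by (auto simp: less_top[symmetric])
  then show ?thesis
  proof cases
    case 2
    then show ?thesis using b by (simp add: ennreal_mult_top)
  next
    case 3
    have iF: "integrable \<mu> (\<lambda>x. (norm (F x))\<^sup>2)" "integrable \<mu> (\<lambda>x. x\<^sup>2 * (norm (F x))\<^sup>2)"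
      using 3 is_hankelD(3)[OF FG] by (auto simp: sq_norm_def integrable_iff_bounded)
    have iG: "integrable \<mu> (\<lambda>x. (norm (G x))\<^sup>2)" "integrable \<mu> (\<lambda>x. x\<^sup>2 * (norm (G x))\<^sup>2)"
      using 3 is_hankelD(4)[OF FG] by (auto simp: sq_norm_def integrable_iff_bounded)
    have n: "(\<integral>x. (norm (F x))\<^sup>2 \<partial>\<mu>) \<ge> 0" "(\<integral>x. x\<^sup>2 * (norm (F x))\<^sup>2 \<partial>\<mu>) \<ge> 0" "(\<integral>x. x\<^sup>2 * (norm (G x))\<^sup>2 \<partial>\<mu>) \<ge> 0"
      by (auto intro!: Bochner_Integration.integral_nonneg)
    have "ennreal (4*b*(\<alpha>+1) * (\<integral>x. (norm (F x))\<^sup>2 \<partial>\<mu>)) \<le>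
       ennreal ((\<integral>\<xi>. \<xi>\<^sup>2 * (norm (G \<xi>))\<^sup>2 \<partial>\<mu>) + 4*b\<^sup>2 * (\<integral>x. x\<^sup>2 * (norm (F x))\<^sup>2 \<partial>\<mu>))"
      by (rule ennreal_leI[OF heisenberg_real[OF FG b iF iG]])
    then have "ennreal (4*b*(\<alpha>+1)) * ennreal (\<integral>x. (norm (F x))\<^sup>2 \<partial>\<mu>) \<le>
       ennreal (\<integral>\<xi>. \<xi>\<^sup>2 * (norm (G \<xi>))\<^sup>2 \<partial>\<mu>) + ennreal (4*b\<^sup>2) * ennreal (\<integral>x. x\<^sup>2 * (norm (F x))\<^sup>2 \<partial>\<mu>)"
      using n b alpha by (simp only: ennreal_plus ennreal_mult'' mult_nonneg_nonneg zero_le_power2 zero_le_numeral)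
    moreover have "ennreal (\<integral>x. (norm (F x))\<^sup>2 \<partial>\<mu>) = sq_norm G"
      by (subst is_hankel_norm[OF FG], unfold sq_norm_def, rule nn_integral_eq_integral[symmetric, OF iF(1)]) auto
    moreover have "ennreal (\<integral>\<xi>. \<xi>\<^sup>2 * (norm (G \<xi>))\<^sup>2 \<partial>\<mu>) = (\<integral>\<^sup>+\<xi>. ennreal (\<xi>\<^sup>2 * (norm (G \<xi>))\<^sup>2) \<partial>\<mu>)"
      by (rule nn_integral_eq_integral[symmetric, OF iG(2)]) auto
    moreover have "ennreal (\<integral>\<xi>. \<xi>\<^sup>2 * (norm (F \<xi>))\<^sup>2 \<partial>\<mu>) = (\<integral>\<^sup>+\<xi>. ennreal (\<xi>\<^sup>2 * (norm (F \<xi>))\<^sup>2) \<partial>\<mu>)"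
      by (rule nn_integral_eq_integral[symmetric, OF iF(2)]) auto
    ultimately show ?thesis by simp
  qed simp
qed

section \<open>The transform on square-integrable functions and convolution\<close>

definition trunc :: "(real \<Rightarrow> complex) \<Rightarrow> real \<Rightarrow> real \<Rightarrow> complex" where
  "trunc f R = (\<lambda>x. indicator {0..R} x * f x)"

lemma L2_alpha_iff: "f \<in> L2_alpha \<alpha> \<longleftrightarrow> f \<in> borel_measurable borel \<and> sq_norm f < \<infinity>"
  unfolding L2_alpha_def sq_norm_def by (auto simp: integrable_iff_bounded)

lemma trunc_measurable [measurable]: "f \<in> borel_measurable borel \<Longrightarrow> trunc f R \<in> borel_measurable borel"
  unfolding trunc_def by measurable

text \<open>On a bounded interval |f| <= 1 + |f|^2, and the right side is integrable there.\<close>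

lemma L12_trunc:
  assumes f: "f \<in> L2_alpha \<alpha>"
  shows "L12 (trunc f R)"
proof -
  have [measurable]: "f \<in> borel_measurable borel" using f by (simp add: L2_alpha_iff)
  have i: "integrable \<mu> (\<lambda>x. (norm (f x))\<^sup>2)" using f by (simp add: L2_alpha_def)
  have "integrable \<mu> (trunc f R)"
  proof (rule Bochner_Integration.integrable_bound[OF Bochner_Integration.integrable_add[OF integrable_indicator_mu[of R] i]])
    show "AE x in \<mu>. norm (trunc f R x) \<le> norm (indicator {-R..R} x + (norm (f x))\<^sup>2)"
    proof (rule AE_I2)
      fix x
      have "2 * norm (f x) \<le> 1 + (norm (f x))\<^sup>2" using zero_le_power2[of "norm (f x) - 1"] by (simp add: power2_diff)
      then have "norm (f x) \<le> 1 + (norm (f x))\<^sup>2" using norm_ge_zero[of "f x"] by linarith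
      then show "norm (trunc f R x) \<le> norm (indicator {-R..R} x + (norm (f x))\<^sup>2)"
        by (auto simp: trunc_def indicator_def)
    qed
  qed measurable
  moreover have "sq_norm (trunc f R) \<le> sq_norm f"
    unfolding sq_norm_def trunc_def by (intro nn_integral_mono) (auto simp: indicator_def)
  ultimately show ?thesis using f by (auto simp: L12_def L2_alpha_iff)
qed

lemma trunc_limit:
  assumes f: "f \<in> L2_alpha \<alpha>"
  shows "((\<lambda>R. sq_norm (\<lambda>x. trunc f R x - f x)) \<longlongrightarrow> 0) at_top"
proof (rule tendsto_at_topI_sequentially)
  fix X :: "nat \<Rightarrow> real" assume X: "filterlim X at_top sequentially"
  have [measurable]: "f \<in> borel_measurable borel" using f by (simp add: L2_alpha_iff)
  show "(\<lambda>n. sq_norm (\<lambda>x. trunc f (X n) x - f x)) \<longlonglongrightarrow> 0"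
  proof (rule sq_norm_dominated[where g="\<lambda>x. (norm (f x))\<^sup>2"])
    show "integrable \<mu> (\<lambda>x. (norm (f x))\<^sup>2)" using f by (simp add: L2_alpha_def)
    show "AE x in \<mu>. (\<lambda>n. trunc f (X n) x) \<longlonglongrightarrow> f x"
      using AE_mu_pos
    proof eventually_elim
      fix x :: real assume "x > 0"
      have "\<forall>\<^sub>F n in sequentially. X n \<ge> x" using X by (simp add: filterlim_at_top)
      then have "\<forall>\<^sub>F n in sequentially. trunc f (X n) x = f x"
        by eventually_elim (use \<open>x > 0\<close> in \<open>auto simp: trunc_def\<close>)
      then show "(\<lambda>n. trunc f (X n) x) \<longlonglongrightarrow> f x" by (rule tendsto_eventually)
    qed
  qed (auto simp: trunc_def indicator_def)
qed

text \<open>A Riesz-Fischer argument for the transforms of truncations: \<open>H_contraction\<close>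
  makes them Cauchy, a fast subsequence converges almost everywhere, and Fatou's lemma bounds the
  distance of its limit to the transform of every truncation, not only of the selected ones.\<close>

lemma hankel_L2_exists:
  assumes f: "f \<in> L2_alpha \<alpha>"
  shows "\<exists>g. g \<in> L2_alpha \<alpha> \<and> ((\<lambda>R. sq_norm (\<lambda>\<xi>. g \<xi> - H (trunc f R) \<xi>)) \<longlongrightarrow> 0) at_top"
proof -
  have [measurable]: "f \<in> borel_measurable borel" using f by (simp add: L2_alpha_iff)
  define e where "e R = sq_norm (\<lambda>x. trunc f R x - f x)" for R
  have el: "(e \<longlongrightarrow> 0) at_top" unfolding e_def by (rule trunc_limit[OF f])
  \<comment> \<open>The rate 16^-k pays for the weight 4^k in \<open>S\<close> below and still
    leaves the summable 4^-k.\<close>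
  have "\<exists>R. e R < ennreal ((1/16)^k)" for k :: nat
  proof -
    have "\<forall>\<^sub>F R in at_top. e R < ennreal ((1/16)^k)" by (rule order_tendstoD(2)[OF el]) simp
    then show ?thesis using eventually_happens'[OF trivial_limit_at_top_linorder] by blast
  qed
  then obtain R where R: "\<And>k::nat. e (R k) < ennreal ((1/16)^k)" by metis
  define u where "u k = H (trunc f (R k))" for k
  have L: "L12 (trunc f r)" for r by (rule L12_trunc[OF f])
  have [measurable]: "u k \<in> borel_measurable borel" for k unfolding u_def by measurable
  have dist: "sq_norm (\<lambda>\<xi>. H (trunc f r) \<xi> - H (trunc f s) \<xi>) \<le> 2 * e r + 2 * e s" for r s
  proof -
    have "(\<lambda>\<xi>. H (trunc f r) \<xi> - H (trunc f s) \<xi>) = H (\<lambda>x. trunc f r x - trunc f s x)"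
      using H_diff[OF L12D(1)[OF L] L12D(1)[OF L]] by auto
    then have "sq_norm (\<lambda>\<xi>. H (trunc f r) \<xi> - H (trunc f s) \<xi>) \<le> sq_norm (\<lambda>x. trunc f r x - trunc f s x)"
      using H_contraction[OF L12_diff[OF L L]] by simp
    also have "\<dots> = sq_norm (\<lambda>x. (trunc f r x - f x) - (trunc f s x - f x))" by simp
    also have "\<dots> \<le> 2 * e r + 2 * e s" unfolding e_def by (rule sq_norm_triangle_diff) measurable
    finally show ?thesis .
  qed
  have step: "sq_norm (\<lambda>\<xi>. u (Suc k) \<xi> - u k \<xi>) \<le> ennreal (4 * (1/16)^k)" for k
  proof -
    have "e (R (Suc k)) \<le> ennreal ((1/16)^k)"
      by (rule order.trans[OF less_imp_le[OF R]]) (auto intro!: ennreal_leI power_decreasing)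
    then have "2 * e (R (Suc k)) + 2 * e (R k) \<le> 2 * ennreal ((1/16)^k) + 2 * ennreal ((1/16)^k)"
      using less_imp_le[OF R[of k]] by (intro add_mono mult_left_mono) auto
    also have "\<dots> = ennreal (4 * (1/16)^k)"
      by (simp add: ennreal_mult flip: distrib_right)
    finally show ?thesis using dist unfolding u_def by (rule order.trans[rotated])
  qed
  \<comment> \<open>Because of the weight 4^k, finiteness of S at a point forces the k-th increment
    to be at most a constant times 2^-k, so the telescoping series converges there.\<close>
  define S where "S \<xi> = (\<Sum>k. ennreal (4^k * (norm (u (Suc k) \<xi> - u k \<xi>))\<^sup>2))" for \<xi>
  have [measurable]: "S \<in> borel_measurable borel" unfolding S_def by measurable
  have "(\<integral>\<^sup>+\<xi>. S \<xi> \<partial>\<mu>) = (\<Sum>k. \<integral>\<^sup>+\<xi>. ennreal (4^k * (norm (u (Suc k) \<xi> - u k \<xi>))\<^sup>2) \<partial>\<mu>)"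
    unfolding S_def by (rule nn_integral_suminf) measurable
  also have "\<dots> = (\<Sum>k. ennreal (4^k) * sq_norm (\<lambda>\<xi>. u (Suc k) \<xi> - u k \<xi>))"
    by (simp add: sq_norm_def ennreal_mult nn_integral_cmult)
  also have "\<dots> \<le> (\<Sum>k. ennreal (4^k) * ennreal (4 * (1/16)^k))"
    by (intro suminf_le mult_left_mono step) auto
  also have "\<dots> = (\<Sum>k. ennreal (4 * (1/4)^k))"
  proof -
    have "(4::real)^k * (1/16)^k = (1/4)^k" for k by (subst power_mult_distrib[symmetric]) simp
    then have "4^k * (4 * (1/16)^k) = 4 * (1/4::real)^k" for k by (simp only: mult.left_commute[of "4^k"])
    then show ?thesis by (simp only: ennreal_mult'[symmetric] zero_le_power zero_le_numeral)
  qed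
  also have "\<dots> < \<infinity>"
    by (subst suminf_ennreal2) (auto intro!: summable_mult summable_geometric)
  finally have "(\<integral>\<^sup>+\<xi>. S \<xi> \<partial>\<mu>) \<noteq> \<infinity>" by simp
  then have AES: "AE \<xi> in \<mu>. S \<xi> \<noteq> \<infinity>" by (intro nn_integral_PInf_AE) auto
  define g where "g \<xi> = lim (\<lambda>k. u k \<xi>)" for \<xi>
  have [measurable]: "g \<in> borel_measurable borel" unfolding g_def by measurable
  have gl: "AE \<xi> in \<mu>. (\<lambda>k. u k \<xi>) \<longlonglongrightarrow> g \<xi>"
    using AES
  proof eventually_elim
    fix \<xi> assume S: "S \<xi> \<noteq> \<infinity>"
    define M where "M = enn2real (S \<xi>)"
    have M: "4^k * (norm (u (Suc k) \<xi> - u k \<xi>))\<^sup>2 \<le> M" for k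
    proof -
      have "(\<Sum>i\<in>{k}. ennreal (4^i * (norm (u (Suc i) \<xi> - u i \<xi>))\<^sup>2)) \<le> S \<xi>"
        unfolding S_def by (rule sum_le_suminf) auto
      also have "S \<xi> = ennreal M" using S by (simp add: M_def ennreal_enn2real less_top)
      finally show ?thesis by (simp add: ennreal_le_iff M_def)
    qed
    have b: "norm (u (Suc k) \<xi> - u k \<xi>) \<le> sqrt M * (1/2)^k" for k
    proof -
      have "(2^k * norm (u (Suc k) \<xi> - u k \<xi>))\<^sup>2 \<le> M"
        using M[of k] by (simp add: power_mult_distrib power_mult[symmetric] mult.commute[of k] power_mult)
      then have "2^k * norm (u (Suc k) \<xi> - u k \<xi>) \<le> sqrt M" by (rule real_le_rsqrt)
      then show ?thesis by (simp add: power_divide field_simps)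
    qed
    have "summable (\<lambda>k. u (Suc k) \<xi> - u k \<xi>)"
      by (rule summable_comparison_test'[OF summable_mult[OF summable_geometric[of "1/2::real"]], of 0 _ "sqrt M"]) (use b in auto)
    then have "convergent (\<lambda>n. \<Sum>k<n. u (Suc k) \<xi> - u k \<xi>)" by (simp add: summable_iff_convergent)
    then have "convergent (\<lambda>n. (u n \<xi> - u 0 \<xi>) + u 0 \<xi>)"
      unfolding sum_lessThan_telescope[of "\<lambda>k. u k \<xi>"] by (intro convergent_add convergent_const)
    then have "convergent (\<lambda>n. u n \<xi>)" by simp
    then show "(\<lambda>k. u k \<xi>) \<longlonglongrightarrow> g \<xi>" unfolding g_def by (simp add: convergent_LIMSEQ_iff)
  qed
  have Fatou: "sq_norm (\<lambda>\<xi>. g \<xi> - H (trunc f r) \<xi>) \<le> 2 * e r" for r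
  proof -
    have "sq_norm (\<lambda>\<xi>. g \<xi> - H (trunc f r) \<xi>) = (\<integral>\<^sup>+\<xi>. liminf (\<lambda>k. ennreal ((norm (u k \<xi> - H (trunc f r) \<xi>))\<^sup>2)) \<partial>\<mu>)"
      unfolding sq_norm_def
    proof (rule nn_integral_cong_AE)
      show "AE \<xi> in \<mu>. ennreal ((norm (g \<xi> - H (trunc f r) \<xi>))\<^sup>2) = liminf (\<lambda>k. ennreal ((norm (u k \<xi> - H (trunc f r) \<xi>))\<^sup>2))"
        using gl
      proof eventually_elim
        fix \<xi> assume "(\<lambda>k. u k \<xi>) \<longlonglongrightarrow> g \<xi>"
        then have "(\<lambda>k. ennreal ((norm (u k \<xi> - H (trunc f r) \<xi>))\<^sup>2)) \<longlonglongrightarrow> ennreal ((norm (g \<xi> - H (trunc f r) \<xi>))\<^sup>2)"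
          by (intro tendsto_intros tendsto_ennrealI)
        then show "ennreal ((norm (g \<xi> - H (trunc f r) \<xi>))\<^sup>2) = liminf (\<lambda>k. ennreal ((norm (u k \<xi> - H (trunc f r) \<xi>))\<^sup>2))"
          by (intro lim_imp_Liminf[symmetric]) auto
      qed
    qed
    also have "\<dots> \<le> liminf (\<lambda>k. sq_norm (\<lambda>\<xi>. u k \<xi> - H (trunc f r) \<xi>))"
      unfolding sq_norm_def by (rule nn_integral_liminf) measurable
    also have "\<dots> \<le> liminf (\<lambda>k. ennreal (2 * (1/16)^k) + 2 * e r)"
    proof (rule Liminf_mono, rule always_eventually, rule allI)
      fix k
      have "2 * e (R k) \<le> 2 * ennreal ((1/16)^k)" using less_imp_le[OF R[of k]] by (intro mult_left_mono) auto
      then have "2 * e (R k) + 2 * e r \<le> ennreal (2 * (1/16)^k) + 2 * e r" by (intro add_right_mono) (simp add: ennreal_mult)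
      then show "sq_norm (\<lambda>\<xi>. u k \<xi> - H (trunc f r) \<xi>) \<le> ennreal (2 * (1/16)^k) + 2 * e r"
        using dist[of "R k" r] unfolding u_def by (rule order.trans[rotated])
    qed
    also have "\<dots> = 2 * e r"
    proof (rule lim_imp_Liminf)
      have "(\<lambda>k. 2 * (1/16::real)^k) \<longlonglongrightarrow> 2 * 0" by (intro tendsto_intros LIMSEQ_power_zero) auto
      then have "(\<lambda>k. ennreal (2 * (1/16)^k) + 2 * e r) \<longlonglongrightarrow> ennreal (2 * 0) + 2 * e r"
        by (intro tendsto_add tendsto_const tendsto_ennrealI)
      then show "(\<lambda>k. ennreal (2 * (1/16)^k) + 2 * e r) \<longlonglongrightarrow> 2 * e r" by simp
    qed simp
    finally show ?thesis .
  qed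
  have "sq_norm g < \<infinity>"
  proof -
    have "sq_norm g = sq_norm (\<lambda>\<xi>. (g \<xi> - H (trunc f (R 0)) \<xi>) + H (trunc f (R 0)) \<xi>)" by simp
    also have "\<dots> \<le> 2 * sq_norm (\<lambda>\<xi>. g \<xi> - H (trunc f (R 0)) \<xi>) + 2 * sq_norm (H (trunc f (R 0)))"
      by (rule sq_norm_triangle) measurable
    also have "\<dots> < \<infinity>"
    proof -
      have "sq_norm (\<lambda>\<xi>. g \<xi> - H (trunc f (R 0)) \<xi>) < \<infinity>"
        by (rule le_less_trans[OF Fatou]) (use R[of 0] in \<open>auto simp: ennreal_mult_less_top intro: less_trans\<close>)
      then show ?thesis using sq_norm_H_finite[OF L] by (simp add: ennreal_mult_less_top)
    qed
    finally show ?thesis .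
  qed
  moreover have "((\<lambda>r. sq_norm (\<lambda>\<xi>. g \<xi> - H (trunc f r) \<xi>)) \<longlongrightarrow> 0) at_top"
  proof (rule tendsto_sandwich[OF _ _ tendsto_const])
    have "((\<lambda>r. 2 * e r) \<longlongrightarrow> 2 * 0) at_top" by (intro ennreal_tendsto_cmult el) simp
    then show "((\<lambda>r. 2 * e r) \<longlongrightarrow> 0) at_top" by simp
  qed (use Fatou in auto)
  ultimately show ?thesis by (intro exI[of _ g]) (simp add: L2_alpha_iff)
qed

text \<open>The defining property of \<open>hankel_L2\<close> measures distance by a Bochner
  integral, which would be 0 for a non-integrable function. For functions in L^2 it agrees with
  \<open>sq_norm\<close>, so \<open>hankel_L2_exists\<close> shows that the choice operator has a
  witness and the property holds.\<close>

lemma is_hankel_hankel_L2: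
  assumes f: "f \<in> L2_alpha \<alpha>"
  shows "is_hankel f (hankel_L2 \<alpha> f)"
proof -
  have [measurable]: "f \<in> borel_measurable borel" using f by (simp add: L2_alpha_iff)
  have L: "L12 (trunc f r)" for r by (rule L12_trunc[OF f])
  define P where "P g \<longleftrightarrow> g \<in> L2_alpha \<alpha> \<and>
      ((\<lambda>R. \<integral>\<xi>. (norm (g \<xi> - hankel_L1 \<alpha> (\<lambda>x. indicator {0..R} x * f x) \<xi>))^2 \<partial>mu_alpha \<alpha>) \<longlongrightarrow> 0) at_top" for g
  have eq: "(\<integral>\<^sup>+\<xi>. ennreal ((norm (g \<xi> - H (trunc f r) \<xi>))\<^sup>2) \<partial>\<mu>) = ennreal (\<integral>\<xi>. (norm (g \<xi> - H (trunc f r) \<xi>))\<^sup>2 \<partial>\<mu>)"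
    if g: "g \<in> L2_alpha \<alpha>" for g r
  proof -
    have [measurable]: "g \<in> borel_measurable borel" using g by (simp add: L2_alpha_iff)
    have "sq_norm (\<lambda>\<xi>. g \<xi> - H (trunc f r) \<xi>) < \<infinity>"
      by (rule le_less_trans[OF sq_norm_triangle_diff])
         (use g sq_norm_H_finite[OF L] in \<open>auto simp: L2_alpha_iff ennreal_mult_less_top\<close>)
    then have "integrable \<mu> (\<lambda>\<xi>. (norm (g \<xi> - H (trunc f r) \<xi>))\<^sup>2)"
      by (auto simp: sq_norm_def integrable_iff_bounded)
    then show ?thesis by (rule nn_integral_eq_integral) auto
  qed
  have P: "P g \<longleftrightarrow> g \<in> L2_alpha \<alpha> \<and> ((\<lambda>R. sq_norm (\<lambda>\<xi>. g \<xi> - H (trunc f R) \<xi>)) \<longlongrightarrow> 0) at_top" for g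
    unfolding P_def sq_norm_def trunc_def[symmetric]
    by (rule conj_cong[OF refl], subst eq, assumption, subst ennreal_0[symmetric], subst tendsto_ennreal_iff) auto
  have "\<exists>g. P g" unfolding P by (rule hankel_L2_exists[OF f])
  then have "P (hankel_L2 \<alpha> f)" unfolding hankel_L2_def P_def by (rule someI_ex)
  then have g: "hankel_L2 \<alpha> f \<in> L2_alpha \<alpha>" and l: "((\<lambda>R. sq_norm (\<lambda>\<xi>. hankel_L2 \<alpha> f \<xi> - H (trunc f R) \<xi>)) \<longlongrightarrow> 0) at_top"
    unfolding P by auto
  have "(\<lambda>n. sq_norm (\<lambda>x. trunc f (real n) x - f x)) \<longlonglongrightarrow> 0"
    by (rule filterlim_compose[OF trunc_limit[OF f] filterlim_real_sequentially])
  moreover have "(\<lambda>n. sq_norm (\<lambda>\<xi>. H (trunc f (real n)) \<xi> - hankel_L2 \<alpha> f \<xi>)) \<longlonglongrightarrow> 0"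
    by (subst sq_norm_minus) (rule filterlim_compose[OF l filterlim_real_sequentially])
  ultimately show ?thesis using f g L unfolding is_hankel_def L2_alpha_iff
    by (auto intro!: exI[of _ "\<lambda>n. trunc f (real n)"])
qed

section \<open>Convolution\<close>

text \<open>Hankel convolution. Where the integral diverges the value is 0 by convention; for f in
  L^2 and integrable phi this happens only on a null set, see
  \<open>AE_conv_integrable\<close>.\<close>

definition conv :: "(real \<Rightarrow> complex) \<Rightarrow> (real \<Rightarrow> complex) \<Rightarrow> real \<Rightarrow> complex" where
  "conv f \<phi> x = (\<integral>t. f t * transl \<phi> x t \<partial>\<mu>)"

lemma conv_measurable [measurable]:
  assumes [measurable]: "f \<in> borel_measurable borel" "\<phi> \<in> borel_measurable borel"
  shows "conv f \<phi> \<in> borel_measurable borel"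
  unfolding conv_def[abs_def] by measurable

text \<open>Cauchy-Schwarz after splitting the modulus of the translate into two square roots, one
  of which stays with f; the other factor is bounded by \<open>transl_L1\<close>.\<close>

lemma conv_kernel_bound:
  fixes f \<phi> :: "real \<Rightarrow> complex"
  assumes [measurable]: "f \<in> borel_measurable borel" "\<phi> \<in> borel_measurable borel"
  shows "(\<integral>\<^sup>+t. ennreal (norm (f t * transl \<phi> x t)) \<partial>\<mu>)\<^sup>2 \<le>
    (\<integral>\<^sup>+t. ennreal ((norm (f t))\<^sup>2 * norm (transl \<phi> x t)) \<partial>\<mu>) * (\<integral>\<^sup>+t. ennreal (norm (\<phi> t)) \<partial>\<mu>)"
proof -
  define n where "n t = norm (transl \<phi> x t)" for t
  have [measurable]: "n \<in> borel_measurable borel" unfolding n_def by measurable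
  have "(\<integral>\<^sup>+t. ennreal (norm (f t * transl \<phi> x t)) \<partial>\<mu>)\<^sup>2 = (\<integral>\<^sup>+t. ennreal (norm (f t) * sqrt (n t)) * ennreal (sqrt (n t)) \<partial>\<mu>)\<^sup>2"
    by (simp add: n_def norm_mult ennreal_mult'[symmetric] mult.assoc)
  also have "\<dots> \<le> (\<integral>\<^sup>+t. (ennreal (norm (f t) * sqrt (n t)))\<^sup>2 \<partial>\<mu>) * (\<integral>\<^sup>+t. (ennreal (sqrt (n t)))\<^sup>2 \<partial>\<mu>)"
    by (rule Cauchy_Schwarz_nn_integral) measurable
  also have "\<dots> = (\<integral>\<^sup>+t. ennreal ((norm (f t))\<^sup>2 * n t) \<partial>\<mu>) * (\<integral>\<^sup>+t. ennreal (n t) \<partial>\<mu>)"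
    by (simp add: ennreal_power power_mult_distrib n_def)
  also have "\<dots> \<le> (\<integral>\<^sup>+t. ennreal ((norm (f t))\<^sup>2 * n t) \<partial>\<mu>) * (\<integral>\<^sup>+t. ennreal (norm (\<phi> t)) \<partial>\<mu>)"
    unfolding n_def by (intro mult_left_mono transl_L1) auto
  finally show ?thesis by (simp add: n_def)
qed

text \<open>After Fubini the symmetry of the translation makes the integral over x again the
  integral of a translate, to which \<open>transl_L1\<close> applies.\<close>

lemma conv_weight_bound:
  fixes \<phi> :: "real \<Rightarrow> complex"
  assumes [measurable]: "h \<in> borel_measurable borel" "\<phi> \<in> borel_measurable borel" and h: "\<And>t. h t \<ge> 0"
  shows "(\<integral>\<^sup>+x. \<integral>\<^sup>+t. ennreal (h t * norm (transl \<phi> x t)) \<partial>\<mu> \<partial>\<mu>) \<le>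
     (\<integral>\<^sup>+t. ennreal (h t) \<partial>\<mu>) * (\<integral>\<^sup>+t. ennreal (norm (\<phi> t)) \<partial>\<mu>)"
proof -
  have "(\<integral>\<^sup>+x. \<integral>\<^sup>+t. ennreal (h t * norm (transl \<phi> x t)) \<partial>\<mu> \<partial>\<mu>) = (\<integral>\<^sup>+t. \<integral>\<^sup>+x. ennreal (h t * norm (transl \<phi> x t)) \<partial>\<mu> \<partial>\<mu>)"
    by (rule mm.Fubini') measurable
  also have "\<dots> = (\<integral>\<^sup>+t. ennreal (h t) * (\<integral>\<^sup>+x. ennreal (norm (transl \<phi> t x)) \<partial>\<mu>) \<partial>\<mu>)"
    by (subst transl_commute) (simp add: ennreal_mult' h nn_integral_cmult)
  also have "\<dots> \<le> (\<integral>\<^sup>+t. ennreal (h t) * (\<integral>\<^sup>+t. ennreal (norm (\<phi> t)) \<partial>\<mu>) \<partial>\<mu>)"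
    by (intro nn_integral_mono mult_left_mono transl_L1) auto
  also have "\<dots> = (\<integral>\<^sup>+t. ennreal (h t) \<partial>\<mu>) * (\<integral>\<^sup>+t. ennreal (norm (\<phi> t)) \<partial>\<mu>)"
    by (rule nn_integral_multc) measurable
  finally show ?thesis .
qed

text \<open>Integrate \<open>conv_kernel_bound\<close> over x and use
  \<open>conv_weight_bound\<close> with h = |f|^2; each of the two contributes one factor of the L^1
  norm of phi.\<close>

lemma conv_Young:
  assumes [measurable]: "f \<in> borel_measurable borel" "\<phi> \<in> borel_measurable borel"
  shows "sq_norm (conv f \<phi>) \<le> (\<integral>\<^sup>+t. ennreal (norm (\<phi> t)) \<partial>\<mu>)\<^sup>2 * sq_norm f"
proof -
  define A where "A = (\<integral>\<^sup>+t. ennreal (norm (\<phi> t)) \<partial>\<mu>)"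
  have "sq_norm (conv f \<phi>) \<le> (\<integral>\<^sup>+x. (\<integral>\<^sup>+t. ennreal ((norm (f t))\<^sup>2 * norm (transl \<phi> x t)) \<partial>\<mu>) * A \<partial>\<mu>)"
    unfolding sq_norm_def
  proof (rule nn_integral_mono)
    fix x
    have "ennreal ((norm (conv f \<phi> x))\<^sup>2) = (ennreal (norm (conv f \<phi> x)))\<^sup>2" by (simp add: ennreal_power)
    also have "\<dots> \<le> (\<integral>\<^sup>+t. ennreal (norm (f t * transl \<phi> x t)) \<partial>\<mu>)\<^sup>2"
      unfolding conv_def by (intro power_mono norm_integral_le_nn) auto
    also have "\<dots> \<le> (\<integral>\<^sup>+t. ennreal ((norm (f t))\<^sup>2 * norm (transl \<phi> x t)) \<partial>\<mu>) * A"
      unfolding A_def by (rule conv_kernel_bound) measurable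
    finally show "ennreal ((norm (conv f \<phi> x))\<^sup>2) \<le> (\<integral>\<^sup>+t. ennreal ((norm (f t))\<^sup>2 * norm (transl \<phi> x t)) \<partial>\<mu>) * A" .
  qed
  also have "\<dots> = (\<integral>\<^sup>+x. \<integral>\<^sup>+t. ennreal ((norm (f t))\<^sup>2 * norm (transl \<phi> x t)) \<partial>\<mu> \<partial>\<mu>) * A"
    by (rule nn_integral_multc) measurable
  also have "\<dots> \<le> (sq_norm f * A) * A"
    unfolding A_def sq_norm_def by (intro mult_right_mono conv_weight_bound) auto
  finally show ?thesis by (simp add: A_def power2_eq_square mult_ac)
qed

text \<open>Linearity of \<open>conv\<close> in its first argument requires convergent integrals;
  this supplies convergence almost everywhere, which is enough for L^2 distances.\<close>

lemma AE_conv_integrable: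
  assumes [measurable]: "f \<in> borel_measurable borel" and \<phi>: "integrable \<mu> \<phi>" and fin: "sq_norm f < \<infinity>"
  shows "AE x in \<mu>. integrable \<mu> (\<lambda>t. f t * transl \<phi> x t)"
proof -
  have [measurable]: "\<phi> \<in> borel_measurable borel" by (rule integrable_mu_measurable[OF \<phi>])
  have A: "(\<integral>\<^sup>+t. ennreal (norm (\<phi> t)) \<partial>\<mu>) < \<infinity>" using \<phi> by (simp add: integrable_iff_bounded)
  have "(\<integral>\<^sup>+x. \<integral>\<^sup>+t. ennreal ((norm (f t))\<^sup>2 * norm (transl \<phi> x t)) \<partial>\<mu> \<partial>\<mu>) \<le> sq_norm f * (\<integral>\<^sup>+t. ennreal (norm (\<phi> t)) \<partial>\<mu>)"
    unfolding sq_norm_def by (rule conv_weight_bound) auto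
  also have "\<dots> < \<infinity>" using A fin by (simp add: ennreal_mult_less_top)
  finally have "AE x in \<mu>. (\<integral>\<^sup>+t. ennreal ((norm (f t))\<^sup>2 * norm (transl \<phi> x t)) \<partial>\<mu>) \<noteq> \<infinity>"
    by (intro nn_integral_PInf_AE) auto
  then show ?thesis
  proof eventually_elim
    fix x assume "(\<integral>\<^sup>+t. ennreal ((norm (f t))\<^sup>2 * norm (transl \<phi> x t)) \<partial>\<mu>) \<noteq> \<infinity>"
    then have "(\<integral>\<^sup>+t. ennreal (norm (f t * transl \<phi> x t)) \<partial>\<mu>)\<^sup>2 < \<infinity>"
      by (intro le_less_trans[OF conv_kernel_bound]) (use A in \<open>auto simp: ennreal_mult_less_top less_top\<close>)
    then have "(\<integral>\<^sup>+t. ennreal (norm (f t * transl \<phi> x t)) \<partial>\<mu>) < \<infinity>"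
      by (cases "(\<integral>\<^sup>+t. ennreal (norm (f t * transl \<phi> x t)) \<partial>\<mu>) = top") (auto simp: power2_eq_square less_top)
    then show "integrable \<mu> (\<lambda>t. f t * transl \<phi> x t)" by (intro integrableI_bounded) auto
  qed
qed

text \<open>After Fubini the inner integral is the transform of a translate; the factor j(t xi) from
  \<open>H_transl\<close> rebuilds the transform of f.\<close>

lemma conv_L1:
  assumes f: "integrable \<mu> f" and \<phi>: "integrable \<mu> \<phi>"
  shows "integrable \<mu> (conv f \<phi>)" and "H (conv f \<phi>) \<xi> = H f \<xi> * H \<phi> \<xi>"
proof -
  have [measurable]: "f \<in> borel_measurable borel" "\<phi> \<in> borel_measurable borel"
    by (intro integrable_mu_measurable f \<phi>)+
  have fin: "(\<integral>\<^sup>+x. \<integral>\<^sup>+t. ennreal (norm (f t * transl \<phi> x t)) \<partial>\<mu> \<partial>\<mu>) < \<infinity>"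
    unfolding norm_mult
    by (rule le_less_trans[OF conv_weight_bound]) (use f \<phi> in \<open>auto simp: integrable_iff_bounded ennreal_mult_less_top\<close>)
  show "integrable \<mu> (conv f \<phi>)"
  proof (rule integrableI_bounded)
    show "(\<integral>\<^sup>+x. ennreal (norm (conv f \<phi> x)) \<partial>\<mu>) < \<infinity>"
      unfolding conv_def by (rule le_less_trans[OF nn_integral_mono[OF norm_integral_le_nn] fin])
  qed measurable
  define F where "F x t = f t * transl \<phi> x t * complex_of_real (j (x * \<xi>))" for x t
  have [measurable]: "case_prod F \<in> borel_measurable (borel \<Otimes>\<^sub>M borel)" unfolding F_def by measurable
  have "(\<integral>\<^sup>+x. \<integral>\<^sup>+t. ennreal (norm (F x t)) \<partial>\<mu> \<partial>\<mu>) \<le> (\<integral>\<^sup>+x. \<integral>\<^sup>+t. ennreal (norm (f t * transl \<phi> x t)) \<partial>\<mu> \<partial>\<mu>)"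
    by (intro nn_integral_mono ennreal_leI) (auto simp: F_def norm_mult intro!: mult_left_le bessel_j_le_1)
  with fin have fin': "(\<integral>\<^sup>+x. \<integral>\<^sup>+t. ennreal (norm (F x t)) \<partial>\<mu> \<partial>\<mu>) < \<infinity>" by (rule le_less_trans[rotated])
  have "H (conv f \<phi>) \<xi> = (\<integral>x. \<integral>t. F x t \<partial>\<mu> \<partial>\<mu>)"
    unfolding hankel_L1_def conv_def F_def by simp
  also have "\<dots> = (\<integral>t. \<integral>x. F x t \<partial>\<mu> \<partial>\<mu>)" by (rule mu_Fubini(2)[OF _ fin']) measurable
  also have "\<dots> = (\<integral>t. f t * H (transl \<phi> t) \<xi> \<partial>\<mu>)"
    unfolding hankel_L1_def F_def by (subst transl_commute) (simp add: mult.assoc)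
  also have "\<dots> = (\<integral>t. f t * complex_of_real (j (t * \<xi>)) * H \<phi> \<xi> \<partial>\<mu>)"
    unfolding H_transl[OF \<phi>] by (simp add: mult.assoc)
  also have "\<dots> = H f \<xi> * H \<phi> \<xi>" unfolding hankel_L1_def[of _ f] by simp
  finally show "H (conv f \<phi>) \<xi> = H f \<xi> * H \<phi> \<xi>" .
qed

text \<open>Convolving the approximants of F approximates the convolution: \<open>conv_Young\<close>
  controls the space side, and on the frequency side \<open>H \<phi>\<close> is a multiplier bounded
  by the L^1 norm of phi.\<close>

lemma is_hankel_conv:
  assumes FG: "is_hankel F G" and \<phi>: "integrable \<mu> \<phi>"
  shows "is_hankel (conv F \<phi>) (\<lambda>\<xi>. G \<xi> * H \<phi> \<xi>)"
proof -
  have [measurable]: "\<phi> \<in> borel_measurable borel" by (rule integrable_mu_measurable[OF \<phi>])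
  obtain u where u: "\<And>n. L12 (u n)" and l1: "(\<lambda>n. sq_norm (\<lambda>x. u n x - F x)) \<longlonglongrightarrow> 0"
    and l2: "(\<lambda>n. sq_norm (\<lambda>x. H (u n) x - G x)) \<longlonglongrightarrow> 0" using FG unfolding is_hankel_def by blast
  note [measurable] = is_hankelD(1,2)[OF FG] L12D(3)[OF u]
  define A where "A = (\<integral>\<^sup>+t. ennreal (norm (\<phi> t)) \<partial>\<mu>)"
  define B where "B = (\<integral>t. norm (\<phi> t) \<partial>\<mu>)"
  have A: "A < \<infinity>" using \<phi> by (simp add: A_def integrable_iff_bounded)
  have A2: "A\<^sup>2 < \<infinity>" using A by (simp add: power2_eq_square ennreal_mult_less_top)
  have mult_bound: "sq_norm (\<lambda>\<xi>. g \<xi> * H \<phi> \<xi>) \<le> ennreal (B\<^sup>2) * sq_norm g" if [measurable]: "g \<in> borel_measurable borel" for g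
  proof -
    have "sq_norm (\<lambda>\<xi>. g \<xi> * H \<phi> \<xi>) \<le> (\<integral>\<^sup>+\<xi>. ennreal (B\<^sup>2) * ennreal ((norm (g \<xi>))\<^sup>2) \<partial>\<mu>)"
      unfolding sq_norm_def
    proof (intro nn_integral_mono)
      fix \<xi>
      have "(norm (g \<xi>))\<^sup>2 * (norm (H \<phi> \<xi>))\<^sup>2 \<le> (norm (g \<xi>))\<^sup>2 * B\<^sup>2"
        unfolding B_def by (intro mult_left_mono power_mono H_bound \<phi>) auto
      then show "ennreal ((norm (g \<xi> * H \<phi> \<xi>))\<^sup>2) \<le> ennreal (B\<^sup>2) * ennreal ((norm (g \<xi>))\<^sup>2)"
        by (simp add: norm_mult power_mult_distrib ennreal_mult'[symmetric] mult.commute ennreal_leI)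
    qed
    also have "\<dots> = ennreal (B\<^sup>2) * sq_norm g" unfolding sq_norm_def by (rule nn_integral_cmult) measurable
    finally show ?thesis .
  qed
  have L: "L12 (conv (u n) \<phi>)" for n
    unfolding L12_def
  proof
    show "integrable \<mu> (conv (u n) \<phi>)" by (rule conv_L1[OF L12D(1)[OF u] \<phi>])
    show "sq_norm (conv (u n) \<phi>) < \<infinity>"
      by (rule le_less_trans[OF conv_Young]) (use A2 L12D(2)[OF u, of n] in \<open>auto simp: A_def ennreal_mult_less_top\<close>)
  qed
  have "(\<lambda>n. sq_norm (\<lambda>x. conv (u n) \<phi> x - conv F \<phi> x)) \<longlonglongrightarrow> 0"
  proof (rule tendsto_sandwich[OF _ _ tendsto_const])
    have "(\<lambda>n. A\<^sup>2 * sq_norm (\<lambda>x. u n x - F x)) \<longlonglongrightarrow> A\<^sup>2 * 0" using A2 by (intro ennreal_tendsto_cmult l1) simp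
    then show "(\<lambda>n. A\<^sup>2 * sq_norm (\<lambda>x. u n x - F x)) \<longlonglongrightarrow> 0" by simp
    show "\<forall>\<^sub>F n in sequentially. sq_norm (\<lambda>x. conv (u n) \<phi> x - conv F \<phi> x) \<le> A\<^sup>2 * sq_norm (\<lambda>x. u n x - F x)"
    proof (rule always_eventually, rule allI)
      fix n
      have "AE x in \<mu>. conv (u n) \<phi> x - conv F \<phi> x = conv (\<lambda>t. u n t - F t) \<phi> x"
        using AE_conv_integrable[OF _ \<phi> L12D(2)[OF u[of n]]] AE_conv_integrable[OF _ \<phi> is_hankelD(3)[OF FG]]
        by (auto simp: conv_def left_diff_distrib)
      then have "sq_norm (\<lambda>x. conv (u n) \<phi> x - conv F \<phi> x) = sq_norm (conv (\<lambda>t. u n t - F t) \<phi>)"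
        unfolding sq_norm_def by (intro nn_integral_cong_AE) auto
      also have "\<dots> \<le> A\<^sup>2 * sq_norm (\<lambda>x. u n x - F x)" unfolding A_def by (rule conv_Young) measurable
      finally show "sq_norm (\<lambda>x. conv (u n) \<phi> x - conv F \<phi> x) \<le> A\<^sup>2 * sq_norm (\<lambda>x. u n x - F x)" .
    qed
  qed auto
  moreover have "(\<lambda>n. sq_norm (\<lambda>\<xi>. H (conv (u n) \<phi>) \<xi> - G \<xi> * H \<phi> \<xi>)) \<longlonglongrightarrow> 0"
  proof (rule tendsto_sandwich[OF _ _ tendsto_const])
    have "(\<lambda>n. ennreal (B\<^sup>2) * sq_norm (\<lambda>x. H (u n) x - G x)) \<longlonglongrightarrow> ennreal (B\<^sup>2) * 0" by (intro ennreal_tendsto_cmult l2) simp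
    then show "(\<lambda>n. ennreal (B\<^sup>2) * sq_norm (\<lambda>x. H (u n) x - G x)) \<longlonglongrightarrow> 0" by simp
    show "\<forall>\<^sub>F n in sequentially. sq_norm (\<lambda>\<xi>. H (conv (u n) \<phi>) \<xi> - G \<xi> * H \<phi> \<xi>) \<le> ennreal (B\<^sup>2) * sq_norm (\<lambda>x. H (u n) x - G x)"
    proof (rule always_eventually, rule allI)
      fix n
      have "sq_norm (\<lambda>\<xi>. H (conv (u n) \<phi>) \<xi> - G \<xi> * H \<phi> \<xi>) = sq_norm (\<lambda>\<xi>. (H (u n) \<xi> - G \<xi>) * H \<phi> \<xi>)"
        by (simp add: conv_L1(2)[OF L12D(1)[OF u] \<phi>] left_diff_distrib)
      also have "\<dots> \<le> ennreal (B\<^sup>2) * sq_norm (\<lambda>x. H (u n) x - G x)" by (rule mult_bound) measurable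
      finally show "sq_norm (\<lambda>\<xi>. H (conv (u n) \<phi>) \<xi> - G \<xi> * H \<phi> \<xi>) \<le> ennreal (B\<^sup>2) * sq_norm (\<lambda>x. H (u n) x - G x)" .
    qed
  qed auto
  moreover have "sq_norm (conv F \<phi>) < \<infinity>"
    by (rule le_less_trans[OF conv_Young]) (use A2 is_hankelD(3)[OF FG] in \<open>auto simp: A_def ennreal_mult_less_top\<close>)
  moreover have "sq_norm (\<lambda>\<xi>. G \<xi> * H \<phi> \<xi>) < \<infinity>"
    by (rule le_less_trans[OF mult_bound]) (use is_hankelD(4)[OF FG] in \<open>auto simp: ennreal_mult_less_top\<close>)
  ultimately show ?thesis unfolding is_hankel_def using L by (auto intro!: exI[of _ "\<lambda>n. conv (u n) \<phi>"])
qed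

section \<open>The wavelet transform\<close>

lemma nn_integral_mu_scale:
  assumes [measurable]: "f \<in> borel_measurable borel" and a: "a > 0"
  shows "(\<integral>\<^sup>+x. f x \<partial>\<mu>) = ennreal (a powr (2*\<alpha>+2)) * (\<integral>\<^sup>+x. f (a * x) \<partial>\<mu>)"
proof -
  have w: "a * mu_weight \<alpha> (a * x) = a powr (2*\<alpha>+2) * mu_weight \<alpha> x" for x
    using a powr_add[of a 1 "2*\<alpha>+1"] by (auto simp: mu_weight_def indicator_def powr_mult zero_le_mult_iff add_ac)
  have "(\<integral>\<^sup>+x. f x \<partial>\<mu>) = ennreal a * (\<integral>\<^sup>+x. ennreal (mu_weight \<alpha> (a * x)) * f (a * x) \<partial>lborel)"
    by (subst nn_integral_mu, measurable, subst nn_integral_real_affine[where c=a and t=0]) (use a in auto)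
  also have "\<dots> = (\<integral>\<^sup>+x. ennreal (a powr (2*\<alpha>+2)) * (ennreal (mu_weight \<alpha> x) * f (a * x)) \<partial>lborel)"
    using a by (simp add: nn_integral_cmult[symmetric] ennreal_mult'[symmetric] w mult.assoc[symmetric])
  also have "\<dots> = ennreal (a powr (2*\<alpha>+2)) * (\<integral>\<^sup>+x. f (a * x) \<partial>\<mu>)"
    by (subst nn_integral_cmult, measurable, subst nn_integral_mu, measurable)
  finally show ?thesis .
qed

lemma integrable_dilation:
  assumes f: "integrable \<mu> f" and a: "a > 0"
  shows "integrable \<mu> (dilation \<alpha> a f)"
proof -
  have [measurable]: "f \<in> borel_measurable borel" by (rule integrable_mu_measurable[OF f])
  have "ennreal (a powr (2*\<alpha>+2)) * (\<integral>\<^sup>+x. ennreal (norm (f (a * x))) \<partial>\<mu>) < \<infinity>"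
    using f by (subst nn_integral_mu_scale[symmetric, OF _ a]) (auto simp: integrable_iff_bounded)
  then have "integrable \<mu> (\<lambda>x. f (a * x))"
    using a by (intro integrableI_bounded) (auto simp: ennreal_mult_less_top)
  then show ?thesis unfolding dilation_def[abs_def] by (rule integrable_mult_right)
qed

lemma H_dilation:
  assumes [measurable]: "f \<in> borel_measurable borel" and a: "a > 0"
  shows "H (dilation \<alpha> a f) \<xi> = complex_of_real (a powr (-(\<alpha>+1))) * H f (\<xi> / a)"
proof -
  have "H f (\<xi> / a) = complex_of_real (a powr (2*\<alpha>+2)) * (\<integral>x. f (a * x) * complex_of_real (j (a * x * (\<xi> / a))) \<partial>\<mu>)"
    unfolding hankel_L1_def by (rule integral_mu_scale[OF _ a]) measurable
  also have "(\<lambda>x. f (a * x) * complex_of_real (j (a * x * (\<xi> / a)))) = (\<lambda>x. f (a * x) * complex_of_real (j (x * \<xi>)))"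
    using a by simp
  finally have 1: "H f (\<xi> / a) = complex_of_real (a powr (2*\<alpha>+2)) * (\<integral>x. f (a * x) * complex_of_real (j (x * \<xi>)) \<partial>\<mu>)" .
  have p: "a powr (-(\<alpha>+1)) * a powr (2*\<alpha>+2) = a powr (\<alpha>+1)"
    by (subst powr_add[symmetric]) (simp add: algebra_simps)
  have "H (dilation \<alpha> a f) \<xi> = complex_of_real (a powr (\<alpha>+1)) * (\<integral>x. f (a * x) * complex_of_real (j (x * \<xi>)) \<partial>\<mu>)"
    unfolding hankel_L1_def dilation_def by (simp add: mult.assoc)
  then show ?thesis unfolding 1 p[symmetric] by (simp add: mult.assoc)
qed

text \<open>The squared dilation factor a^(-2 alpha - 2) together with the weight a^(2 alpha + 1) of
  \<open>nu_alpha\<close> leaves the scale-invariant da/a, and the substitution b = xi/a removes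
  xi.\<close>

lemma c_psi_scaled:
  assumes [measurable]: "\<psi> \<in> borel_measurable borel" and \<xi>: "\<xi> > 0"
  shows "(\<integral>\<^sup>+a. ennreal (indicator {0<..} a * a powr (2*\<alpha>+1)) * ennreal ((norm (H (dilation \<alpha> a \<psi>) \<xi>))\<^sup>2) \<partial>lborel) = c_psi \<alpha> \<psi>"
proof -
  define f where "f b = ennreal ((norm (H \<psi> b))\<^sup>2 / b)" for b
  have [measurable]: "f \<in> borel_measurable borel" unfolding f_def by measurable
  have "c_psi \<alpha> \<psi> = (\<integral>\<^sup>+b. f b * indicator {0<..} b \<partial>lborel)"
    unfolding c_psi_def f_def by (simp add: mult.commute)
  also have "\<dots> = (\<integral>\<^sup>+a. f (\<xi> / a) * ennreal (\<xi> / a\<^sup>2) * indicator {0<..} a \<partial>lborel)"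
    by (rule nn_integral_substitution_inverse[OF _ \<xi>]) measurable
  also have "\<dots> = (\<integral>\<^sup>+a. ennreal (indicator {0<..} a * a powr (2*\<alpha>+1)) * ennreal ((norm (H (dilation \<alpha> a \<psi>) \<xi>))\<^sup>2) \<partial>lborel)"
  proof (rule nn_integral_cong)
    fix a
    show "f (\<xi> / a) * ennreal (\<xi> / a\<^sup>2) * indicator {0<..} a = ennreal (indicator {0<..} a * a powr (2*\<alpha>+1)) * ennreal ((norm (H (dilation \<alpha> a \<psi>) \<xi>))\<^sup>2)"
    proof (cases "a > 0")
      case True
      have p: "a powr (2*\<alpha>+1) * (a powr (-(\<alpha>+1)))\<^sup>2 = 1 / a"
      proof -
        have "(a powr (-(\<alpha>+1)))\<^sup>2 = a powr (-(2*\<alpha>+2))" by (simp add: power2_eq_square powr_add[symmetric])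
        moreover have "a powr (2*\<alpha>+1) * a powr (-(2*\<alpha>+2)) = a powr (-1)" by (subst powr_add[symmetric]) simp
        ultimately show ?thesis using True by (simp add: powr_minus_divide)
      qed
      have "a powr (2*\<alpha>+1) * (norm (H (dilation \<alpha> a \<psi>) \<xi>))\<^sup>2 = (a powr (2*\<alpha>+1) * (a powr (-(\<alpha>+1)))\<^sup>2) * (norm (H \<psi> (\<xi>/a)))\<^sup>2"
        by (simp add: H_dilation[OF _ True] norm_mult power_mult_distrib)
      also have "\<dots> = (norm (H \<psi> (\<xi>/a)))\<^sup>2 / (\<xi>/a) * (\<xi>/a\<^sup>2)"
        unfolding p using True \<xi> by (simp add: power2_eq_square)
      finally show ?thesis using True \<xi> by (simp add: f_def ennreal_mult'[symmetric])
    qed auto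
  qed
  finally show ?thesis ..
qed

text \<open>Integrating over the scales first, \<open>c_psi_scaled\<close> gives the same constant
  at almost every frequency.\<close>

lemma c_psi_Fubini:
  assumes [measurable]: "\<psi> \<in> borel_measurable borel" "p \<in> borel_measurable borel"
  shows "(\<integral>\<^sup>+a. ennreal (indicator {0<..} a * a powr (2*\<alpha>+1)) * (\<integral>\<^sup>+\<xi>. p \<xi> * ennreal ((norm (H (dilation \<alpha> a \<psi>) \<xi>))\<^sup>2) \<partial>\<mu>) \<partial>lborel) =
    c_psi \<alpha> \<psi> * (\<integral>\<^sup>+\<xi>. p \<xi> \<partial>\<mu>)"
proof -
  interpret lm: pair_sigma_finite lborel \<mu> by standard
  have [measurable]: "(\<lambda>(a,\<xi>). H (dilation \<alpha> a \<psi>) \<xi>) \<in> borel_measurable (borel \<Otimes>\<^sub>M borel)"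
    unfolding hankel_L1_def dilation_def by measurable
  have "(\<integral>\<^sup>+a. ennreal (indicator {0<..} a * a powr (2*\<alpha>+1)) * (\<integral>\<^sup>+\<xi>. p \<xi> * ennreal ((norm (H (dilation \<alpha> a \<psi>) \<xi>))\<^sup>2) \<partial>\<mu>) \<partial>lborel) =
    (\<integral>\<^sup>+a. \<integral>\<^sup>+\<xi>. p \<xi> * (ennreal (indicator {0<..} a * a powr (2*\<alpha>+1)) * ennreal ((norm (H (dilation \<alpha> a \<psi>) \<xi>))\<^sup>2)) \<partial>\<mu> \<partial>lborel)"
    by (subst nn_integral_cmult[symmetric]) (auto simp: mult_ac)
  also have "\<dots> = (\<integral>\<^sup>+\<xi>. \<integral>\<^sup>+a. p \<xi> * (ennreal (indicator {0<..} a * a powr (2*\<alpha>+1)) * ennreal ((norm (H (dilation \<alpha> a \<psi>) \<xi>))\<^sup>2)) \<partial>lborel \<partial>\<mu>)"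
    by (rule lm.Fubini'[symmetric]) measurable
  also have "\<dots> = (\<integral>\<^sup>+\<xi>. p \<xi> * (\<integral>\<^sup>+a. ennreal (indicator {0<..} a * a powr (2*\<alpha>+1)) * ennreal ((norm (H (dilation \<alpha> a \<psi>) \<xi>))\<^sup>2) \<partial>lborel) \<partial>\<mu>)"
    by (subst nn_integral_cmult) auto
  also have "\<dots> = (\<integral>\<^sup>+\<xi>. p \<xi> * c_psi \<alpha> \<psi> \<partial>\<mu>)"
    by (rule nn_integral_cong_AE, rule AE_mp[OF AE_mu_pos]) (auto simp: c_psi_scaled)
  also have "\<dots> = c_psi \<alpha> \<psi> * (\<integral>\<^sup>+\<xi>. p \<xi> \<partial>\<mu>)"
    by (subst nn_integral_multc) (auto simp: mult.commute)
  finally show ?thesis .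
qed

lemma cnj_hankel_transl:
  assumes [measurable]: "f \<in> borel_measurable borel"
  shows "cnj (hankel_transl \<alpha> x f t) = transl (\<lambda>y. cnj (f y)) x t"
  by (subst hankel_transl_eq, measurable) (simp add: transl_def)

lemma wavelet_transform_eq:
  assumes [measurable]: "\<psi> \<in> borel_measurable borel"
  shows "wavelet_transform \<alpha> \<psi> f (a, x) =
    complex_of_real (1 / sqrt (enn2real (c_psi \<alpha> \<psi>))) * conv f (\<lambda>y. cnj (dilation \<alpha> a \<psi> y)) x"
proof -
  have [measurable]: "dilation \<alpha> a \<psi> \<in> borel_measurable borel" unfolding dilation_def[abs_def] by measurable
  show ?thesis unfolding wavelet_transform_def conv_def by (simp add: cnj_hankel_transl)
qed

lemma nn_integral_nu:
  assumes [measurable]: "case_prod G \<in> borel_measurable (borel \<Otimes>\<^sub>M borel)"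
  shows "(\<integral>\<^sup>+p. case_prod G p \<partial>nu_alpha \<alpha>) =
    (\<integral>\<^sup>+a. ennreal (indicator {0<..} a * a powr (2*\<alpha>+1)) * (\<integral>\<^sup>+x. G a x \<partial>\<mu>) \<partial>lborel)"
proof -
  have "(\<integral>\<^sup>+p. case_prod G p \<partial>nu_alpha \<alpha>) =
     (\<integral>\<^sup>+a. \<integral>\<^sup>+x. ennreal (indicator {0<..} a * a powr (2*\<alpha>+1) * mu_weight \<alpha> x) * G a x \<partial>lborel \<partial>lborel)"
    unfolding nu_alpha_def
    by (subst nn_integral_density, measurable, subst lborel.nn_integral_fst[symmetric]) auto
  also have "\<dots> = (\<integral>\<^sup>+a. ennreal (indicator {0<..} a * a powr (2*\<alpha>+1)) * (\<integral>\<^sup>+x. G a x \<partial>\<mu>) \<partial>lborel)"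
    by (subst nn_integral_mu, measurable) (simp add: ennreal_mult'' mult.assoc nn_integral_cmult)
  finally show ?thesis .
qed

section \<open>Integration of the slice inequality over the scales\<close>

context
  fixes \<psi> f :: "real \<Rightarrow> complex"
  assumes \<psi>: "admissible_wavelet \<alpha> \<psi>" and f: "f \<in> L2_alpha \<alpha>"
begin

definition wavelet_moment :: ennreal where
  "wavelet_moment = (\<integral>\<^sup>+p. ennreal ((snd p)\<^sup>2 * (norm (wavelet_transform \<alpha> \<psi> f p))\<^sup>2) \<partial>nu_alpha \<alpha>)"

definition frequency_moment :: ennreal where
  "frequency_moment = (\<integral>\<^sup>+\<xi>. ennreal (\<xi>\<^sup>2 * (norm (hankel_L2 \<alpha> f \<xi>))\<^sup>2) \<partial>\<mu>)"

lemma measurable_psi_f [measurable]: "\<psi> \<in> borel_measurable borel" "f \<in> borel_measurable borel"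
  using \<psi> f by (auto simp: admissible_wavelet_def L2_alpha_iff)

abbreviation "slice a \<equiv> conv f (\<lambda>y. cnj (dilation \<alpha> a \<psi> y))"

lemma is_hankel_slice:
  assumes "a > 0"
  shows "is_hankel (slice a) (\<lambda>\<xi>. hankel_L2 \<alpha> f \<xi> * cnj (H (dilation \<alpha> a \<psi>) \<xi>))"
proof -
  have "integrable \<mu> (\<lambda>y. cnj (dilation \<alpha> a \<psi> y))"
    using \<psi> integrable_dilation[OF _ assms, of \<psi>] by (auto simp: admissible_wavelet_def)
  from is_hankel_conv[OF is_hankel_hankel_L2[OF f] this] show ?thesis unfolding H_cnj .
qed

lemma slice_measurable [measurable]: "(\<lambda>(a,x). slice a x) \<in> borel_measurable (borel \<Otimes>\<^sub>M borel)"
  unfolding conv_def transl_def dilation_def by measurable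

lemma c_psi_real:
  obtains c where "c > 0" "c_psi \<alpha> \<psi> = ennreal c"
proof -
  have "0 < c_psi \<alpha> \<psi>" "c_psi \<alpha> \<psi> < \<infinity>" using \<psi> by (auto simp: admissible_wavelet_def)
  then show ?thesis using that[of "enn2real (c_psi \<alpha> \<psi>)"] by (auto simp: enn2real_positive_iff)
qed

text \<open>The normalisation c_psi^(-1/2) of the wavelet transform, squared, is moved to the left
  side, so that no division of extended values occurs.\<close>

lemma wavelet_moment_eq:
  "c_psi \<alpha> \<psi> * wavelet_moment =
    (\<integral>\<^sup>+a. ennreal (indicator {0<..} a * a powr (2*\<alpha>+1)) * (\<integral>\<^sup>+x. ennreal (x\<^sup>2 * (norm (slice a x))\<^sup>2) \<partial>\<mu>) \<partial>lborel)"
proof -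
  obtain c where c: "c > 0" "c_psi \<alpha> \<psi> = ennreal c" by (rule c_psi_real)
  have pt: "ennreal c * (case p of (a,x) \<Rightarrow> ennreal (1/c * (x\<^sup>2 * (norm (slice a x))\<^sup>2))) = (case p of (a,x) \<Rightarrow> ennreal (x\<^sup>2 * (norm (slice a x))\<^sup>2))" for p
    using c by (auto simp: ennreal_mult'[symmetric] split: prod.split)
  have "wavelet_moment = (\<integral>\<^sup>+p. (case p of (a,x) \<Rightarrow> ennreal (1/c * (x\<^sup>2 * (norm (slice a x))\<^sup>2))) \<partial>nu_alpha \<alpha>)"
    unfolding wavelet_moment_def
    by (intro nn_integral_cong)
       (use c in \<open>auto simp: wavelet_transform_eq norm_mult power_mult_distrib power_divide norm_divide\<close>)
  then have "ennreal c * wavelet_moment = (\<integral>\<^sup>+p. ennreal c * (case p of (a,x) \<Rightarrow> ennreal (1/c * (x\<^sup>2 * (norm (slice a x))\<^sup>2))) \<partial>nu_alpha \<alpha>)"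
    by (subst nn_integral_cmult) (auto simp: nu_alpha_def)
  then show ?thesis unfolding pt c(2) by (subst (asm) nn_integral_nu) auto
qed

text \<open>An instance of \<open>c_psi_Fubini\<close> with a free weight: q = xi^2 gives the
  frequency moment, q = 1 the squared norm.\<close>

lemma slice_transform_integral:
  assumes [measurable]: "q \<in> borel_measurable borel" and q: "\<And>\<xi>. q \<xi> \<ge> 0"
  shows "(\<integral>\<^sup>+a. ennreal (indicator {0<..} a * a powr (2*\<alpha>+1)) *
     (\<integral>\<^sup>+\<xi>. ennreal (q \<xi> * (norm (hankel_L2 \<alpha> f \<xi> * cnj (H (dilation \<alpha> a \<psi>) \<xi>)))\<^sup>2) \<partial>\<mu>) \<partial>lborel) =
     c_psi \<alpha> \<psi> * (\<integral>\<^sup>+\<xi>. ennreal (q \<xi> * (norm (hankel_L2 \<alpha> f \<xi>))\<^sup>2) \<partial>\<mu>)"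
proof -
  note [measurable] = is_hankelD(2)[OF is_hankel_hankel_L2[OF f]]
  have "ennreal (q \<xi> * (norm (hankel_L2 \<alpha> f \<xi> * cnj (H (dilation \<alpha> a \<psi>) \<xi>)))\<^sup>2) =
      ennreal (q \<xi> * (norm (hankel_L2 \<alpha> f \<xi>))\<^sup>2) * ennreal ((norm (H (dilation \<alpha> a \<psi>) \<xi>))\<^sup>2)" for a \<xi>
    using q by (subst ennreal_mult''[symmetric]) (auto simp: norm_mult power_mult_distrib mult.assoc)
  then show ?thesis by (simp only: c_psi_Fubini measurable_psi_f) (rule c_psi_Fubini, measurable)
qed

text \<open>The slice inequality is used with the same b at every scale. Integrated against a^(2
  alpha + 1), each of its three terms acquires the same factor \<open>c_psi\<close>, which is finite
  and positive and cancels.\<close>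

lemma uncertainty_scaled:
  assumes b: "b > 0"
  shows "ennreal (4*b*(\<alpha>+1)) * sq_norm f \<le> frequency_moment + ennreal (4*b\<^sup>2) * wavelet_moment"
proof -
  define w where "w a = ennreal (indicator {0<..} a * a powr (2*\<alpha>+1))" for a
  have [measurable]: "w \<in> borel_measurable borel" unfolding w_def by measurable
  define T where "T a \<xi> = hankel_L2 \<alpha> f \<xi> * cnj (H (dilation \<alpha> a \<psi>) \<xi>)" for a \<xi>
  note [measurable] = is_hankelD(2)[OF is_hankel_hankel_L2[OF f]]
  have [measurable]: "(\<lambda>(a,\<xi>). H (dilation \<alpha> a \<psi>) \<xi>) \<in> borel_measurable (borel \<Otimes>\<^sub>M borel)"
    unfolding hankel_L1_def dilation_def by measurable
  have [measurable]: "case_prod T \<in> borel_measurable (borel \<Otimes>\<^sub>M borel)" unfolding T_def by measurable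
  have "w a * (ennreal (4*b*(\<alpha>+1)) * sq_norm (T a)) \<le>
     w a * ((\<integral>\<^sup>+\<xi>. ennreal (\<xi>\<^sup>2 * (norm (T a \<xi>))\<^sup>2) \<partial>\<mu>) + ennreal (4*b\<^sup>2) * (\<integral>\<^sup>+x. ennreal (x\<^sup>2 * (norm (slice a x))\<^sup>2) \<partial>\<mu>))" for a
  proof (cases "a > 0")
    case True
    show ?thesis using heisenberg[OF is_hankel_slice[OF True] b] unfolding T_def[symmetric] by (intro mult_left_mono) auto
  qed (simp add: w_def)
  then have "(\<integral>\<^sup>+a. ennreal (4*b*(\<alpha>+1)) * (w a * sq_norm (T a)) \<partial>lborel) \<le>
     (\<integral>\<^sup>+a. w a * (\<integral>\<^sup>+\<xi>. ennreal (\<xi>\<^sup>2 * (norm (T a \<xi>))\<^sup>2) \<partial>\<mu>) + ennreal (4*b\<^sup>2) * (w a * (\<integral>\<^sup>+x. ennreal (x\<^sup>2 * (norm (slice a x))\<^sup>2) \<partial>\<mu>)) \<partial>lborel)"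
    by (intro nn_integral_mono) (simp add: distrib_left mult.left_commute)
  also have "\<dots> = (\<integral>\<^sup>+a. w a * (\<integral>\<^sup>+\<xi>. ennreal (\<xi>\<^sup>2 * (norm (T a \<xi>))\<^sup>2) \<partial>\<mu>) \<partial>lborel) +
      ennreal (4*b\<^sup>2) * (\<integral>\<^sup>+a. w a * (\<integral>\<^sup>+x. ennreal (x\<^sup>2 * (norm (slice a x))\<^sup>2) \<partial>\<mu>) \<partial>lborel)"
    by (subst nn_integral_add) (auto simp: nn_integral_cmult)
  also have "\<dots> = c_psi \<alpha> \<psi> * frequency_moment + ennreal (4*b\<^sup>2) * (c_psi \<alpha> \<psi> * wavelet_moment)"
    unfolding wavelet_moment_eq w_def T_def frequency_moment_def by (subst slice_transform_integral) auto
  also have "(\<integral>\<^sup>+a. ennreal (4*b*(\<alpha>+1)) * (w a * sq_norm (T a)) \<partial>lborel) = ennreal (4*b*(\<alpha>+1)) * (\<integral>\<^sup>+a. w a * sq_norm (T a) \<partial>lborel)"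
    unfolding sq_norm_def by (rule nn_integral_cmult) measurable
  also have "(\<integral>\<^sup>+a. w a * sq_norm (T a) \<partial>lborel) = c_psi \<alpha> \<psi> * sq_norm (hankel_L2 \<alpha> f)"
    using slice_transform_integral[of "\<lambda>_. 1"] by (simp add: w_def T_def sq_norm_def)
  also have "sq_norm (hankel_L2 \<alpha> f) = sq_norm f" by (rule is_hankel_norm[OF is_hankel_hankel_L2[OF f]])
  finally have *: "c_psi \<alpha> \<psi> * (ennreal (4*b*(\<alpha>+1)) * sq_norm f) \<le> c_psi \<alpha> \<psi> * (frequency_moment + ennreal (4*b\<^sup>2) * wavelet_moment)"
    by (simp add: distrib_left mult.left_commute)
  obtain c where c: "c > 0" "c_psi \<alpha> \<psi> = ennreal c" by (rule c_psi_real)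
  \<comment> \<open>Cancellation in the extended reals is done by multiplying with the finite value
    1/c.\<close>
  have cancel: "ennreal (1/c) * (ennreal c * z) = z" for z
    using c by (simp add: mult.assoc[symmetric] ennreal_mult'[symmetric])
  show ?thesis using mult_left_mono[OF *[unfolded c(2)], of "ennreal (1/c)"] by (simp only: cancel zero_le)
qed

text \<open>The weight xi^2 is positive almost everywhere, so the transform vanishes almost
  everywhere and Plancherel's identity concludes. The lemma excludes a product of 0 and infinity
  later.\<close>

lemma frequency_moment_zero:
  assumes "frequency_moment = 0"
  shows "sq_norm f = 0"
proof -
  note [measurable] = is_hankelD(2)[OF is_hankel_hankel_L2[OF f]]
  have "AE \<xi> in \<mu>. ennreal (\<xi>\<^sup>2 * (norm (hankel_L2 \<alpha> f \<xi>))\<^sup>2) = 0"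
    using assms unfolding frequency_moment_def by (subst (asm) nn_integral_0_iff_AE) auto
  then have "AE \<xi> in \<mu>. ennreal ((norm (hankel_L2 \<alpha> f \<xi>))\<^sup>2) = 0"
    using AE_mu_pos by eventually_elim (auto simp: ennreal_eq_0_iff mult_le_0_iff)
  then have "sq_norm (hankel_L2 \<alpha> f) = 0" unfolding sq_norm_def by (subst nn_integral_0_iff_AE) auto
  then show ?thesis by (simp add: is_hankel_norm[OF is_hankel_hankel_L2[OF f]])
qed

text \<open>A vanishing moment makes almost every slice vanish, hence also its transform by
  Plancherel's identity. The squared norms of these transforms integrate to \<open>c_psi\<close>
  times that of f, and \<open>c_psi\<close> is not 0.\<close>

lemma wavelet_moment_zero:
  assumes "wavelet_moment = 0"
  shows "sq_norm f = 0"
proof -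
  define w where "w a = ennreal (indicator {0<..} a * a powr (2*\<alpha>+1))" for a
  have [measurable]: "w \<in> borel_measurable borel" unfolding w_def by measurable
  define T where "T a \<xi> = hankel_L2 \<alpha> f \<xi> * cnj (H (dilation \<alpha> a \<psi>) \<xi>)" for a \<xi>
  have "AE a in lborel. w a * (\<integral>\<^sup>+x. ennreal (x\<^sup>2 * (norm (slice a x))\<^sup>2) \<partial>\<mu>) = 0"
    using wavelet_moment_eq assms unfolding w_def[symmetric] by (subst nn_integral_0_iff_AE[symmetric]) auto
  then have "AE a in lborel. w a * sq_norm (T a) = 0"
  proof eventually_elim
    fix a assume a: "w a * (\<integral>\<^sup>+x. ennreal (x\<^sup>2 * (norm (slice a x))\<^sup>2) \<partial>\<mu>) = 0"
    show "w a * sq_norm (T a) = 0"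
    proof (cases "a > 0")
      case True
      have [measurable]: "slice a \<in> borel_measurable borel" by (rule is_hankelD(1)[OF is_hankel_slice[OF True]])
      have "w a \<noteq> 0" using True by (simp add: w_def)
      then have "AE x in \<mu>. ennreal (x\<^sup>2 * (norm (slice a x))\<^sup>2) = 0"
        using a by (subst nn_integral_0_iff_AE[symmetric]) auto
      then have "AE x in \<mu>. ennreal ((norm (slice a x))\<^sup>2) = 0"
        using AE_mu_pos by eventually_elim (auto simp: ennreal_eq_0_iff mult_le_0_iff)
      then have "sq_norm (slice a) = 0" unfolding sq_norm_def by (subst nn_integral_0_iff_AE) auto
      then show ?thesis using is_hankel_norm[OF is_hankel_slice[OF True]] unfolding T_def[symmetric] by simp
    qed (simp add: w_def)
  qed
  then have "(\<integral>\<^sup>+a. w a * sq_norm (T a) \<partial>lborel) = (\<integral>\<^sup>+(a::real). 0 \<partial>lborel)" by (rule nn_integral_cong_AE)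
  moreover have "(\<integral>\<^sup>+a. w a * sq_norm (T a) \<partial>lborel) = c_psi \<alpha> \<psi> * sq_norm (hankel_L2 \<alpha> f)"
    using slice_transform_integral[of "\<lambda>_. 1"] by (simp add: w_def T_def sq_norm_def)
  moreover have "c_psi \<alpha> \<psi> \<noteq> 0" using \<psi> by (auto simp: admissible_wavelet_def)
  ultimately show ?thesis by (simp add: is_hankel_norm[OF is_hankel_hankel_L2[OF f]])
qed

text \<open>For finite moments b is optimised in \<open>uncertainty_scaled\<close>. For an infinite
  moment and f not 0 the other moment is not 0 by the two preceding lemmas, so the product is
  infinite rather than 0.\<close>

lemma uncertainty_product:
  "ennreal ((\<alpha>+1)\<^sup>2) * (sq_norm f)\<^sup>2 \<le> wavelet_moment * frequency_moment"
proof -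
  consider "sq_norm f = 0" | "sq_norm f \<noteq> 0" "wavelet_moment = \<infinity>" | "sq_norm f \<noteq> 0" "frequency_moment = \<infinity>"
    | "sq_norm f \<noteq> 0" "wavelet_moment < \<infinity>" "frequency_moment < \<infinity>" by (auto simp: less_top[symmetric])
  then show ?thesis
  proof cases
    case 2
    then show ?thesis using frequency_moment_zero by (auto simp: ennreal_top_mult)
  next
    case 3
    then show ?thesis using wavelet_moment_zero by (auto simp: ennreal_mult_top)
  next
    case 4
    define n x B where "n = enn2real (sq_norm f)" and "x = enn2real wavelet_moment" and "B = enn2real frequency_moment"
    have "sq_norm f < \<infinity>" using f by (simp add: L2_alpha_iff)
    then have e: "sq_norm f = ennreal n" "wavelet_moment = ennreal x" "frequency_moment = ennreal B"
      using 4 by (simp_all add: n_def x_def B_def ennreal_enn2real)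
    have nn: "n \<ge> 0" "x \<ge> 0" "B \<ge> 0" by (simp_all add: n_def x_def B_def)
    have n: "n > 0" using 4(1) nn(1) e(1) by (cases "n = 0") auto
    have x: "x > 0" using wavelet_moment_zero 4(1) nn(2) e(2) by (cases "x = 0") auto
    \<comment> \<open>The minimiser of 4 b^2 x - 4 b (alpha+1) n; at this b the quadratic term is
      half of the linear one, so half of the linear term is left as a lower bound for
      \<open>B\<close>.\<close>
    define b where "b = (\<alpha>+1) * n / (2 * x)"
    have b: "b > 0" using n x alpha by (simp add: b_def)
    have "ennreal (4*b*(\<alpha>+1)) * ennreal n \<le> ennreal B + ennreal (4*b\<^sup>2) * ennreal x"
      using uncertainty_scaled[OF b] by (simp only: e)
    then have "ennreal (4*b*(\<alpha>+1)*n) \<le> ennreal (B + 4*b\<^sup>2*x)"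
      using nn b alpha by (simp add: ennreal_mult'' )
    then have "4*b*(\<alpha>+1)*n \<le> B + 4*b\<^sup>2*x" using nn by (subst (asm) ennreal_le_iff) auto
    moreover have "4*b*(\<alpha>+1)*n = 2 * ((\<alpha>+1)\<^sup>2 * n\<^sup>2 / x)" "4*b\<^sup>2*x = (\<alpha>+1)\<^sup>2 * n\<^sup>2 / x"
      using x by (simp_all add: b_def power2_eq_square)
    ultimately have "(\<alpha>+1)\<^sup>2 * n\<^sup>2 / x \<le> B" by simp
    then have "(\<alpha>+1)\<^sup>2 * n\<^sup>2 \<le> x * B" using x by (simp add: divide_le_eq mult.commute)
    then have "ennreal ((\<alpha>+1)\<^sup>2 * n\<^sup>2) \<le> ennreal (x * B)" by (rule ennreal_leI)
    then show ?thesis unfolding e using nn by (simp add: ennreal_mult' ennreal_power)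
  qed simp
qed

text \<open>At b = 1/2 the coefficients become 4b(alpha+1) = 2 alpha + 2 and 4b^2 = 1.\<close>

lemma uncertainty_sum:
  "ennreal (2*\<alpha>+2) * sq_norm f \<le> wavelet_moment + frequency_moment"
  using uncertainty_scaled[of "1/2"] by (simp add: power2_eq_square add.commute)

end

end

text \<open>The product inequality appears in squared form, which avoids roots of extended values.
  Infinite moments are covered by the arithmetic of \<open>ennreal\<close>, where 0 times infinity
  is 0.\<close>

theorem mainTheorem4:
  fixes \<alpha> :: real and \<psi> f :: "real \<Rightarrow> complex"
  assumes "\<alpha> > -1/2"
    and "admissible_wavelet \<alpha> \<psi>"
    and "f \<in> L2_alpha \<alpha>"
  shows "((\<integral>\<^sup>+ p. ennreal ((snd p)^2 * (norm (wavelet_transform \<alpha> \<psi> f p))^2) \<partial>nu_alpha \<alpha>)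
         + (\<integral>\<^sup>+ \<xi>. ennreal (\<xi>^2 * (norm (hankel_L2 \<alpha> f \<xi>))^2) \<partial>mu_alpha \<alpha>)
         \<ge> ennreal (2*\<alpha>+2) * (\<integral>\<^sup>+ x. ennreal ((norm (f x))^2) \<partial>mu_alpha \<alpha>)
     \<and> (\<integral>\<^sup>+ p. ennreal ((snd p)^2 * (norm (wavelet_transform \<alpha> \<psi> f p))^2) \<partial>nu_alpha \<alpha>)
         * (\<integral>\<^sup>+ \<xi>. ennreal (\<xi>^2 * (norm (hankel_L2 \<alpha> f \<xi>))^2) \<partial>mu_alpha \<alpha>)
         \<ge> ennreal ((\<alpha>+1)^2) * (\<integral>\<^sup>+ x. ennreal ((norm (f x))^2) \<partial>mu_alpha \<alpha>)^2)"
proof -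
  interpret hankel \<alpha> by standard (rule assms(1))
  show ?thesis
    using uncertainty_sum[OF assms(2,3)] uncertainty_product[OF assms(2,3)]
    unfolding sq_norm_def wavelet_moment_def[OF assms(2,3)] frequency_moment_def[OF assms(2,3)] by simp
qed

end
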